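(* Let $\lambda\in\mathbb{C}\setminus\mathbb{R}$. Suppose that the definiteness condition does not hold (i.e. $\mathcal{L}_0\ne\{0\}$), but that $n_+=n_-$ and that $\lambda\notin\Lambda$. Then the following four cases occur. (1) Assume $\|\psi(\cdot,\lambda)\|=0$. (1a) $H(b,\lambda)$ is a half-plane if and only if $\|\varphi(\cdot,\lambda)\|<\infty$. In this case $n_\pm=1$. (1b) $H(b,\lambda)$ is empty if and only if $\|\varphi(\cdot,\lambda)\|=\infty$. In this case $n_\pm=0$. (2) Assume $\|\psi(\cdot,\lambda)\|>0$. (2a) $D(b,\lambda)$ has positive radius if and only if $\|\psi(\cdot,\lambda)\|<\infty$. In this case $n_\pm=1$. (2b) $D(b,\lambda)$ is a singleton if and only if $\|\psi(\cdot,\lambda)\|=\infty$. In this case $n_\pm=0$.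
   Context: Let $0<b\le\infty$ and $J=\begin{pmatrix}0&-1\\ 1&0\end{pmatrix}$. Let $q,w$ be $2\times2$ matrices whose entries are distributions of order $0$ on $(0,b)$, equivalently local complex measures on $(0,b)$ (complex measures when restricted to compact subsets of $(0,b)$). Here $q$ is Hermitian ($q=q^*$; off-diagonal entries may be non-real), and $w$ is non-negative (a matrix-valued measure with $w(E)\ge0$ as a Hermitian matrix) and not identically $0$. The endpoint $0$ is regular: $q$ and $w$ are finite measures on $(0,c)$ for each $c\in(0,b)$. For a function $u$ of locally bounded variation put $u^\pm(x)$ for its right/left limits; $u$ is balanced if $u=\frac12(u^-+u^+)$. A solution of $Ju'+qu=\lambda wu$ is a balanced function $u:(0,b)\to\mathbb{C}^2$ of locally bounded variation satisfying the equation as an identity of local measures, and $u(0)=\lim_{x\downarrow0}u(x)$. Let $\Delta_q(x)=q(\{x\})$, $\Delta_w(x)=w(\{x\})$, $B_\pm(x,\lambda)=J\pm\frac12(\Delta_q(x)-\lambda\Delta_w(x))$, and $\Lambda=\{\lambda\in\mathbb{C}:\exists x\in(0,b):\det B_+(x,\lambda)\det B_-(x,\lambda)=0\}$; it is assumed throughout that $\Lambda\ne\mathbb{C}$. For $\lambda\notin\Lambda$ initial value problems with data posed at $0$ have unique balanced solutions on $(0,b)$. A point of continuity is an $x\in(0,b)$ with $\Delta_q(x)=\Delta_w(x)=0$. Let $\|u\|_c^2=\int_{(0,c)}u^*wu$ and $\|u\|^2=\int_{(0,b)}u^*wu\in[0,\infty]$; $\mathcal{L}^2(w)$ is the space of functions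 with $\|u\|<\infty$. $\mathcal{L}_0$ is the space of solutions of $Ju'+qu=0$ with norm $0$ (these solve $Ju'+qu=\lambda wu$ for every $\lambda$); it is at most one-dimensional. The deficiency index $n_+$ (resp. $n_-$) is the number of linearly independent solutions of $Ju'+qu=\lambda wu$ of positive finite norm, i.e. the dimension of the space of solutions in $\mathcal{L}^2(w)$ modulo $\mathcal{L}_0$, for $\lambda$ in the upper (resp. lower) half-plane; it is known not to depend on the choice of $\lambda$ in that half-plane. A statement about $n_\pm$ means both $n_+$ and $n_-$. Fix $\alpha\in[0,\pi)$. For $\lambda\notin\Lambda$ let $U(\cdot,\lambda)$ be the fundamental matrix of $Ju'+qu=\lambda wu$ with $U(0,\lambda)=\begin{pmatrix}\cos\alpha&-\sin\alpha\\ \sin\alpha&\cos\alpha\end{pmatrix}$, with first and second columns $\varphi(\cdot,\lambda)$ and $\psi(\cdot,\lambda)$. Weyl disks and half-planes: let $\lambda\in\mathbb{C}\setminus\mathbb{R}$, $\lambda\notin\Lambda$, and let $c\in(0,b)$ be a point of continuity. Write $U(c,\lambda)=\begin{pmatrix}A&C\\ B&D\end{pmatrix}$. If $\|\psi(\cdot,\lambda)\|_c>0$ (equivalently $C\overline D-\overline CD\ne0$), put $\tilde m=\frac{B\overline C-A\overline D}{C\overline D-\overline CD}$, $r(c,\lambda)=\left|\frac{AD-BC}{C\overline D-\overline CD}\right|$ and $D(c,\lambda)=\{m\in\mathbb{C}:|m-\tilde m|\le r(c,\lambda)\}$. If $\|\psi(\cdot,\lambda)\|_c=0$, put $\sigma(c,\lambda)=A\overline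 B-\overline AB\in\mathrm{i}\mathbb{R}$ and $H(c,\lambda)=\{m\in\mathbb{C}:\sigma(c,\lambda)/(2\mathrm{i}\operatorname{Im}\lambda)\le\operatorname{Im}(m)/\operatorname{Im}(\lambda)\}$. These sets are nested decreasing in $c$. If $\|\psi(\cdot,\lambda)\|_c=0$ for all $c$, let $H(b,\lambda)=\bigcap_{0<c<b}H(c,\lambda)$ (over points of continuity $c$), which is empty or a half-plane. If $\|\psi(\cdot,\lambda)\|_c$ is eventually positive as $c\to b$, let $D(b,\lambda)$ be the intersection of all the disks $D(c,\lambda)$, which is a closed disk of radius $r(b,\lambda)=\lim_{c\to b}r(c,\lambda)>0$ or a singleton. *)

theory Defs
  imports "HOL-Analysis.Analysis"
begin

definition ivl :: "ereal \<Rightarrow> real set" where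
  "ivl b = {x. 0 < x \<and> ereal x < b}"

definition local_borel :: "ereal \<Rightarrow> real set set" where
  "local_borel b = {E \<in> sets borel. \<exists>K. compact K \<and> K \<subseteq> ivl b \<and> E \<subseteq> K}"

text \<open>
  Complex measures and local complex measures are set functions; only their values on the
  Borel subsets of the relevant set are meaningful.  A countably additive complex-valued set
  function on a sigma-algebra vanishes on the empty set and has finite total variation.
\<close>

definition complex_measure_on :: "real set \<Rightarrow> (real set \<Rightarrow> complex) \<Rightarrow> bool" where
  "complex_measure_on S \<mu> \<longleftrightarrow>
     (\<forall>A :: nat \<Rightarrow> real set.
        (\<forall>n. A n \<in> sets borel \<and> A n \<subseteq> S) \<and> disjoint_family A \<longrightarrow>
        (\<lambda>n. \<mu> (A n)) sums \<mu> (\<Union>n. A n))"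

definition local_complex_measure :: "ereal \<Rightarrow> (real set \<Rightarrow> complex) \<Rightarrow> bool" where
  "local_complex_measure b \<mu> \<longleftrightarrow> (\<forall>K. compact K \<and> K \<subseteq> ivl b \<longrightarrow> complex_measure_on K \<mu>)"

definition local_matrix_measure :: "ereal \<Rightarrow> (real set \<Rightarrow> complex^2^2) \<Rightarrow> bool" where
  "local_matrix_measure b q \<longleftrightarrow> (\<forall>i j. local_complex_measure b (\<lambda>E. q E $ i $ j))"

definition regular_at_0 :: "ereal \<Rightarrow> (real set \<Rightarrow> complex^2^2) \<Rightarrow> bool" where
  "regular_at_0 b q \<longleftrightarrow>
     (\<forall>c \<in> ivl b. \<forall>i j. complex_measure_on {0<..<c} (\<lambda>E. q E $ i $ j))"

definition conj_transpose :: "complex^2^2 \<Rightarrow> complex^2^2" where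
  "conj_transpose A = (\<chi> i j. cnj (A $ j $ i))"

definition hermitian :: "complex^2^2 \<Rightarrow> bool" where
  "hermitian A \<longleftrightarrow> conj_transpose A = A"

definition nonneg_matrix :: "complex^2^2 \<Rightarrow> bool" where
  "nonneg_matrix A \<longleftrightarrow>
     hermitian A \<and> (\<forall>v :: complex^2. 0 \<le> Re (\<Sum>i\<in>UNIV. cnj (v $ i) * (A *v v) $ i))"

definition hermitian_measure :: "ereal \<Rightarrow> (real set \<Rightarrow> complex^2^2) \<Rightarrow> bool" where
  "hermitian_measure b q \<longleftrightarrow> (\<forall>E \<in> local_borel b. hermitian (q E))"

definition nonneg_measure :: "ereal \<Rightarrow> (real set \<Rightarrow> complex^2^2) \<Rightarrow> bool" where
  "nonneg_measure b w \<longleftrightarrow> (\<forall>E \<in> local_borel b. nonneg_matrix (w E))"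

text \<open>
  Integration against a complex measure on \<open>S\<close>: the integrals against the positive and negative
  variations (Jordan decomposition) of its real and imaginary parts are combined.
\<close>

definition pos_variation :: "real set \<Rightarrow> (real set \<Rightarrow> real) \<Rightarrow> real measure" where
  "pos_variation S \<nu> =
     measure_of S (sets (restrict_space borel S))
       (\<lambda>E. SUP B \<in> {B \<in> sets borel. B \<subseteq> E}. ennreal (\<nu> B))"

definition signed_integral :: "real set \<Rightarrow> (real set \<Rightarrow> real) \<Rightarrow> (real \<Rightarrow> complex) \<Rightarrow> complex" where
  "signed_integral S \<nu> f =
     integral\<^sup>L (pos_variation S \<nu>) f - integral\<^sup>L (pos_variation S (\<lambda>E. - \<nu> E)) f"

definition complex_measure_integral ::
    "real set \<Rightarrow> (real set \<Rightarrow> complex) \<Rightarrow> (real \<Rightarrow> complex) \<Rightarrow> complex" where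
  "complex_measure_integral S \<mu> f =
     signed_integral S (\<lambda>E. Re (\<mu> E)) f + \<i> * signed_integral S (\<lambda>E. Im (\<mu> E)) f"

text \<open>The local \<open>\<complex>\<^sup>2\<close>-valued measure \<open>q u\<close>, evaluated at \<open>E\<close>.\<close>

definition measure_times ::
    "(real set \<Rightarrow> complex^2^2) \<Rightarrow> (real \<Rightarrow> complex^2) \<Rightarrow> real set \<Rightarrow> complex^2" where
  "measure_times q u E =
     (\<chi> i. \<Sum>j\<in>UNIV. complex_measure_integral E (\<lambda>A. q A $ i $ j) (\<lambda>x. u x $ j))"

text \<open>
  \<open>normsq_upto w u c\<close> is the integral of \<open>u\<^sup>* w u\<close> over \<open>(0,c)\<close>.  As \<open>u\<^sup>* w u\<close> is a non-negative
  local measure, the integral over \<open>(0,b)\<close>, where the entries of \<open>w\<close> need not be finite measures,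
  is the supremum of these.
\<close>

definition normsq_upto :: "(real set \<Rightarrow> complex^2^2) \<Rightarrow> (real \<Rightarrow> complex^2) \<Rightarrow> real \<Rightarrow> real" where
  "normsq_upto w u c =
     Re (\<Sum>i\<in>UNIV. \<Sum>j\<in>UNIV.
           complex_measure_integral {0<..<c} (\<lambda>A. w A $ i $ j) (\<lambda>x. cnj (u x $ i) * u x $ j))"

definition normsq :: "ereal \<Rightarrow> (real set \<Rightarrow> complex^2^2) \<Rightarrow> (real \<Rightarrow> complex^2) \<Rightarrow> ennreal" where
  "normsq b w u = (SUP c \<in> ivl b. ennreal (normsq_upto w u c))"

definition Jmat :: "complex^2^2" where
  "Jmat = vector [vector [0, -1], vector [1, 0]]"

definition locally_bounded_variation :: "ereal \<Rightarrow> (real \<Rightarrow> complex^2) \<Rightarrow> bool" where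
  "locally_bounded_variation b u \<longleftrightarrow>
     (\<forall>s t. 0 < s \<and> s \<le> t \<and> ereal t < b \<longrightarrow>
        (\<exists>M. \<forall>(n::nat) p. (\<forall>k\<le>n. p k \<in> {s..t}) \<and> (\<forall>k<n. p k \<le> p (Suc k)) \<longrightarrow>
               (\<Sum>k<n. norm (u (p (Suc k)) - u (p k))) \<le> M))"

definition right_limit :: "(real \<Rightarrow> complex^2) \<Rightarrow> real \<Rightarrow> complex^2" where
  "right_limit u x = Lim (at_right x) u"

definition left_limit :: "(real \<Rightarrow> complex^2) \<Rightarrow> real \<Rightarrow> complex^2" where
  "left_limit u x = Lim (at_left x) u"

definition balanced :: "ereal \<Rightarrow> (real \<Rightarrow> complex^2) \<Rightarrow> bool" where
  "balanced b u \<longleftrightarrow> (\<forall>x \<in> ivl b. u x = (1/2) *\<^sub>R (left_limit u x + right_limit u x))"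

text \<open>
  The distributional derivative \<open>\<nu> = u'\<close> of a function of locally bounded variation: the local
  (Lebesgue-Stieltjes) measure determined by its values on compact intervals.
\<close>

definition is_derivative_measure ::
    "ereal \<Rightarrow> (real \<Rightarrow> complex^2) \<Rightarrow> (real set \<Rightarrow> complex^2) \<Rightarrow> bool" where
  "is_derivative_measure b u \<nu> \<longleftrightarrow>
     (\<forall>i. local_complex_measure b (\<lambda>E. \<nu> E $ i)) \<and>
     (\<forall>s t. 0 < s \<and> s \<le> t \<and> ereal t < b \<longrightarrow> \<nu> {s..t} = right_limit u t - left_limit u s)"

definition is_solution ::
    "ereal \<Rightarrow> (real set \<Rightarrow> complex^2^2) \<Rightarrow> (real set \<Rightarrow> complex^2^2) \<Rightarrow> complex
      \<Rightarrow> (real \<Rightarrow> complex^2) \<Rightarrow> bool" where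
  "is_solution b q w lam u \<longleftrightarrow>
     locally_bounded_variation b u \<and> balanced b u \<and>
     (\<exists>\<nu>. is_derivative_measure b u \<nu> \<and>
        (\<forall>E \<in> local_borel b. Jmat *v \<nu> E + measure_times q u E = lam *s measure_times w u E))"

text \<open>\<open>Bmat s\<close> for \<open>s = 1\<close> and \<open>s = -1\<close> is \<open>B\<^sub>+\<close> and \<open>B\<^sub>-\<close>.\<close>

definition Bmat ::
    "complex \<Rightarrow> (real set \<Rightarrow> complex^2^2) \<Rightarrow> (real set \<Rightarrow> complex^2^2) \<Rightarrow> real \<Rightarrow> complex
      \<Rightarrow> complex^2^2" where
  "Bmat s q w x lam =
     (\<chi> i j. Jmat $ i $ j + s * (1/2) * (q {x} $ i $ j - lam * w {x} $ i $ j))"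

definition Lambda_set ::
    "ereal \<Rightarrow> (real set \<Rightarrow> complex^2^2) \<Rightarrow> (real set \<Rightarrow> complex^2^2) \<Rightarrow> complex set" where
  "Lambda_set b q w =
     {lam. \<exists>x \<in> ivl b. det (Bmat 1 q w x lam) * det (Bmat (-1) q w x lam) = 0}"

definition continuity_points ::
    "ereal \<Rightarrow> (real set \<Rightarrow> complex^2^2) \<Rightarrow> (real set \<Rightarrow> complex^2^2) \<Rightarrow> real set" where
  "continuity_points b q w = {x \<in> ivl b. q {x} = 0 \<and> w {x} = 0}"

text \<open>
  Functions are total on the reals, but membership below depends only on the values on \<open>(0,b)\<close>;
  in particular \<open>null_solutions\<close> contains all functions vanishing on \<open>(0,b)\<close>, so that counting
  modulo \<open>null_solutions\<close> also identifies functions that agree on \<open>(0,b)\<close>.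
\<close>

definition null_solutions ::
    "ereal \<Rightarrow> (real set \<Rightarrow> complex^2^2) \<Rightarrow> (real set \<Rightarrow> complex^2^2) \<Rightarrow> (real \<Rightarrow> complex^2) set" where
  "null_solutions b q w = {u. is_solution b q w 0 u \<and> normsq b w u = 0}"

definition definiteness_condition ::
    "ereal \<Rightarrow> (real set \<Rightarrow> complex^2^2) \<Rightarrow> (real set \<Rightarrow> complex^2^2) \<Rightarrow> bool" where
  "definiteness_condition b q w \<longleftrightarrow> (\<forall>u \<in> null_solutions b q w. \<forall>x \<in> ivl b. u x = 0)"

definition L2_solutions ::
    "ereal \<Rightarrow> (real set \<Rightarrow> complex^2^2) \<Rightarrow> (real set \<Rightarrow> complex^2^2) \<Rightarrow> complex
      \<Rightarrow> (real \<Rightarrow> complex^2) set" where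
  "L2_solutions b q w lam = {u. is_solution b q w lam u \<and> normsq b w u < \<infinity>}"

text \<open>The complex vector space \<open>V\<close> has a basis of \<open>n\<close> elements modulo its subspace \<open>N\<close>.\<close>

definition has_dim_modulo ::
    "(real \<Rightarrow> complex^2) set \<Rightarrow> (real \<Rightarrow> complex^2) set \<Rightarrow> nat \<Rightarrow> bool" where
  "has_dim_modulo V N n \<longleftrightarrow>
     (\<exists>f :: nat \<Rightarrow> real \<Rightarrow> complex^2.
        (\<forall>i<n. f i \<in> V) \<and>
        (\<forall>a :: nat \<Rightarrow> complex. (\<lambda>x. \<Sum>i<n. a i *s f i x) \<in> N \<longrightarrow> (\<forall>i<n. a i = 0)) \<and>
        (\<forall>v\<in>V. \<exists>a :: nat \<Rightarrow> complex. (\<lambda>x. v x - (\<Sum>i<n. a i *s f i x)) \<in> N))"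

text \<open>
  The deficiency index attached to a half-plane \<open>P\<close> is the common dimension for all \<open>lam \<in> P\<close>
  (it is known that the dimension does not depend on \<open>lam\<close>).
\<close>

definition has_deficiency_index ::
    "ereal \<Rightarrow> (real set \<Rightarrow> complex^2^2) \<Rightarrow> (real set \<Rightarrow> complex^2^2) \<Rightarrow> complex set \<Rightarrow> nat \<Rightarrow> bool" where
  "has_deficiency_index b q w P n \<longleftrightarrow>
     (\<forall>lam\<in>P. has_dim_modulo (L2_solutions b q w lam) (null_solutions b q w) n)"

definition is_fundamental_matrix ::
    "ereal \<Rightarrow> (real set \<Rightarrow> complex^2^2) \<Rightarrow> (real set \<Rightarrow> complex^2^2) \<Rightarrow> real \<Rightarrow> complex
      \<Rightarrow> (real \<Rightarrow> complex^2^2) \<Rightarrow> bool" where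
  "is_fundamental_matrix b q w \<alpha> lam U \<longleftrightarrow>
     (\<forall>j. is_solution b q w lam (\<lambda>x. column j (U x))) \<and>
     (U \<longlongrightarrow> vector [vector [of_real (cos \<alpha>), of_real (- sin \<alpha>)],
                   vector [of_real (sin \<alpha>), of_real (cos \<alpha>)]]) (at_right 0)"

definition phi :: "(real \<Rightarrow> complex^2^2) \<Rightarrow> real \<Rightarrow> complex^2" where
  "phi U x = column 1 (U x)"

definition psi :: "(real \<Rightarrow> complex^2^2) \<Rightarrow> real \<Rightarrow> complex^2" where
  "psi U x = column 2 (U x)"

text \<open>Weyl disk and half-plane at \<open>c\<close>, as functions of \<open>M = U(c,lam)\<close> with rows \<open>(A,C)\<close>, \<open>(B,D)\<close>.\<close>

definition weyl_disk :: "complex^2^2 \<Rightarrow> complex set" where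
  "weyl_disk M =
     (let A = M $ 1 $ 1; C = M $ 1 $ 2; B = M $ 2 $ 1; D = M $ 2 $ 2;
          d = C * cnj D - cnj C * D
      in {m. cmod (m - (B * cnj C - A * cnj D) / d) \<le> cmod ((A * D - B * C) / d)})"

text \<open>The quotient whose real part is taken is in fact real.\<close>

definition weyl_half_plane :: "complex \<Rightarrow> complex^2^2 \<Rightarrow> complex set" where
  "weyl_half_plane lam M =
     (let A = M $ 1 $ 1; B = M $ 2 $ 1
      in {m. Re ((A * cnj B - cnj A * B) / (2 * \<i> * of_real (Im lam))) \<le> Im m / Im lam})"

definition limit_half_plane ::
    "ereal \<Rightarrow> (real set \<Rightarrow> complex^2^2) \<Rightarrow> (real set \<Rightarrow> complex^2^2) \<Rightarrow> complex
      \<Rightarrow> (real \<Rightarrow> complex^2^2) \<Rightarrow> complex set" where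
  "limit_half_plane b q w lam U = (\<Inter>c \<in> continuity_points b q w. weyl_half_plane lam (U c))"

definition limit_disk ::
    "ereal \<Rightarrow> (real set \<Rightarrow> complex^2^2) \<Rightarrow> (real set \<Rightarrow> complex^2^2)
      \<Rightarrow> (real \<Rightarrow> complex^2^2) \<Rightarrow> complex set" where
  "limit_disk b q w U =
     (\<Inter>c \<in> {c \<in> continuity_points b q w. normsq_upto w (psi U) c > 0}. weyl_disk (U c))"

definition is_half_plane :: "complex set \<Rightarrow> bool" where
  "is_half_plane H \<longleftrightarrow> (\<exists>a s. a \<noteq> 0 \<and> H = {z. a \<bullet> z \<ge> s})"

definition is_disk_of_positive_radius :: "complex set \<Rightarrow> bool" where
  "is_disk_of_positive_radius D \<longleftrightarrow> (\<exists>z r. r > 0 \<and> D = cball z r)"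

end

theory Submission
  imports Defs
begin

text \<open>
  Everything rests on the Lagrange identity: if \<open>u\<close> solves the equation with parameter \<open>\<lambda>\<close> and
  \<open>v\<close> solves it with parameter \<open>\<mu>\<close>, then at a point \<open>c\<close> of continuity
  \<open>v(c)\<^sup>* J u(c) - v(0)\<^sup>* J u(0)\<close> is \<open>\<lambda> - cnj \<mu>\<close> times the integral of \<open>v\<^sup>* w u\<close> over \<open>(0,c)\<close>
  (lemma \<open>lagrange\<close>).  For \<open>u = \<phi> + m \<psi>\<close> it turns membership of \<open>m\<close> in the Weyl disk or
  half-plane at \<open>c\<close> into the inequality \<open>\<parallel>u\<parallel>\<^sub>c\<^sup>2 \<le> Im m / Im \<lambda>\<close> (\<open>disk_at_point\<close>,
  \<open>half_plane_at_point\<close>).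

  When definiteness fails there is a nontrivial solution \<open>p\<close> of norm \<open>0\<close>.  Since \<open>w p = 0\<close>, it
  solves the equation for every parameter and is orthogonal to every solution.  Modulo \<open>p\<close> the
  solution space is at most one-dimensional, so the index is \<open>1\<close> or \<open>0\<close> according to whether a
  generator has finite or infinite norm (\<open>dimension_from_generator\<close>).

  If \<open>\<psi>\<close> has norm \<open>0\<close>, then \<open>\<phi>\<close> is a generator (if \<open>\<phi>\<close> were null as well, \<open>w\<close> would vanish), and
  the half-planes are the sets \<open>\<parallel>\<phi>\<parallel>\<^sub>c\<^sup>2 \<le> Im m / Im \<lambda>\<close>, so their intersection is a half-plane if
  \<open>\<parallel>\<phi>\<parallel>\<close> is finite and empty otherwise.

  If \<open>\<psi>\<close> has positive norm, it is a generator, and \<open>p\<close> can be normalised to \<open>\<phi> + m\<^sub>0 \<psi>\<close>.  Then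
  \<open>\<parallel>\<phi> + m \<psi>\<parallel>\<^sub>c = \<bar>m - m\<^sub>0\<bar> \<parallel>\<psi>\<parallel>\<^sub>c\<close>, so the disk at \<open>c\<close> is
  \<open>\<bar>m - m\<^sub>0\<bar>\<^sup>2 \<parallel>\<psi>\<parallel>\<^sub>c\<^sup>2 \<le> Im m / Im \<lambda>\<close>.  The Lagrange identity for the pair \<open>p, \<psi>\<close> also yields
  \<open>\<bar>det(p,\<psi>)(c)\<bar>\<^sup>2 = 1 + 4 Im m\<^sub>0 Im \<lambda> \<parallel>\<psi>\<parallel>\<^sub>c\<^sup>2\<close> (\<open>wronskian_growth\<close>).  If \<open>\<parallel>\<psi>\<parallel> = \<infinity>\<close>, no point
  except \<open>m\<^sub>0\<close> can lie in all disks, and \<open>m\<^sub>0\<close> does because the right-hand side stays non-negative.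
  If \<open>\<parallel>\<psi>\<parallel>\<^sup>2 = N\<close> is finite, the limit is a disk of radius
  \<open>sqrt (1 + 4 Im m\<^sub>0 Im \<lambda> N) / (2 N \<bar>Im \<lambda>\<bar>)\<close>, and it must be shown that the root is not \<open>0\<close>.  This
  is where the equality of the indices enters: the index is \<open>1\<close> at \<open>cnj \<lambda>\<close> too, which gives a
  solution \<open>f\<close> there that is square integrable and not null.  By the Lagrange identity
  \<open>cnj (det(p,f)) det(p,\<psi>)\<close> is a nonzero constant while \<open>det(p,f)\<close> is bounded, so \<open>det(p,\<psi>)\<close>
  stays away from \<open>0\<close> (\<open>wronskian_bounded_below\<close>).

  To make sense of the equation, the coefficients on \<open>(0,c)\<close> are written with densities \<open>Q\<close> and
  \<open>W\<close> with respect to one finite measure \<open>M\<close>.  A solution then takes the form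
  \<open>u(x) = \<eta> + \<integral> k(x,y) G(y) dM(y)\<close> with \<open>J G = (\<lambda> W - Q) u\<close>, where the kernel \<open>k(x,y)\<close> is \<open>1\<close>,
  \<open>1/2\<close> or \<open>0\<close> for \<open>y < x\<close>, \<open>y = x\<close>, \<open>y > x\<close>; the value \<open>1/2\<close> expresses that \<open>u\<close> is balanced.
  Because \<open>k(x,y) + k(y,x) = 1\<close>, Fubini's theorem gives integration by parts without atomic
  correction terms, and with it the Lagrange identity.
\<close>

section \<open>The variations of a signed set function\<close>

definition upper_variation :: "(real set \<Rightarrow> real) \<Rightarrow> real set \<Rightarrow> ennreal" where
  "upper_variation \<nu> E = (SUP B \<in> {B \<in> sets borel. B \<subseteq> E}. ennreal (\<nu> B))"

text \<open>
  A real-valued countably additive set function.  Its values are finite, but nothing bounds them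
  at once; that bound is \<open>upper_variation_finite\<close> below.
\<close>
locale signed_measure_on =
  fixes S :: "real set" and \<nu> :: "real set \<Rightarrow> real"
  assumes S_borel: "S \<in> sets borel"
    and sums: "\<And>A :: nat \<Rightarrow> real set.
      (\<And>n. A n \<in> sets borel) \<Longrightarrow> (\<And>n. A n \<subseteq> S) \<Longrightarrow> disjoint_family A \<Longrightarrow>
      (\<lambda>n. \<nu> (A n)) sums \<nu> (\<Union>n. A n)"
begin

lemma empty: "\<nu> {} = 0"
proof -
  have "(\<lambda>n. \<nu> {}) sums \<nu> {}"
    using sums[of "\<lambda>n::nat. {}"] by (simp add: disjoint_family_on_def)
  then have "(\<lambda>n::nat. \<nu> {}) \<longlonglongrightarrow> 0"
    by (intro summable_LIMSEQ_zero sums_summable)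
  then show ?thesis
    by (simp add: LIMSEQ_const_iff)
qed

lemma additive:
  assumes "A \<in> sets borel" "B \<in> sets borel" "A \<subseteq> S" "B \<subseteq> S" "A \<inter> B = {}"
  shows "\<nu> (A \<union> B) = \<nu> A + \<nu> B"
proof -
  have "(\<lambda>n. \<nu> (binaryset A B n)) sums \<nu> (\<Union>n. binaryset A B n)"
    using assms by (intro sums) (auto simp: binaryset_def disjoint_family_on_def)
  moreover have "(\<lambda>n. \<nu> (binaryset A B n)) sums (\<nu> A + \<nu> B)"
    by (rule binaryset_sums) (rule empty)
  ultimately show ?thesis
    using sums_unique2 by (simp add: UN_binaryset_eq) blast
qed

lemma upper_variation_mono: "E \<subseteq> F \<Longrightarrow> upper_variation \<nu> E \<le> upper_variation \<nu> F"
  unfolding upper_variation_def by (rule SUP_subset_mono) auto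

lemma upper_variation_upper: "B \<in> sets borel \<Longrightarrow> B \<subseteq> E \<Longrightarrow> ennreal (\<nu> B) \<le> upper_variation \<nu> E"
  unfolding upper_variation_def by (rule SUP_upper) auto

lemma upper_variation_empty: "upper_variation \<nu> {} = 0"
  unfolding upper_variation_def
  by (rule antisym, rule SUP_least) (auto simp: empty)

text \<open>
  A subset \<open>B\<close> of the union is cut into the pieces \<open>B \<inter> A n\<close>; truncating the negative values of
  \<open>\<nu>\<close> on the pieces to \<open>0\<close>, as \<open>ennreal\<close> does, only increases the sum.
\<close>
lemma upper_variation_countably_subadditive:
  fixes A :: "nat \<Rightarrow> real set"
  assumes "\<And>n. A n \<in> sets borel" "\<And>n. A n \<subseteq> S" "disjoint_family A"
  shows "upper_variation \<nu> (\<Union>n. A n) \<le> (\<Sum>n. upper_variation \<nu> (A n))"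
  unfolding upper_variation_def[of \<nu> "\<Union>n. A n"]
proof (rule SUP_least, clarify)
  fix B :: "real set" assume B: "B \<in> sets borel" "B \<subseteq> (\<Union>n. A n)"
  have "(\<lambda>n. \<nu> (B \<inter> A n)) sums \<nu> (\<Union>n. B \<inter> A n)"
    using assms B by (intro sums) (auto simp: disjoint_family_on_def, blast)
  also have "(\<Union>n. B \<inter> A n) = B"
    using B by auto
  finally have "(\<lambda>N. \<Sum>n<N. \<nu> (B \<inter> A n)) \<longlonglongrightarrow> \<nu> B"
    by (simp add: sums_def)
  then have "(\<lambda>N. ennreal (\<Sum>n<N. \<nu> (B \<inter> A n))) \<longlonglongrightarrow> ennreal (\<nu> B)"
    by (rule tendsto_ennrealI)
  moreover have "ennreal (\<Sum>n<N. \<nu> (B \<inter> A n)) \<le> (\<Sum>n. upper_variation \<nu> (A n))" for N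
  proof -
    have "ennreal (\<Sum>n<N. \<nu> (B \<inter> A n)) \<le> ennreal (\<Sum>n<N. max 0 (\<nu> (B \<inter> A n)))"
      by (intro ennreal_leI sum_mono) auto
    also have "\<dots> = (\<Sum>n<N. ennreal (max 0 (\<nu> (B \<inter> A n))))"
      by (simp add: sum_ennreal)
    also have "\<dots> = (\<Sum>n<N. ennreal (\<nu> (B \<inter> A n)))"
      by (intro sum.cong) (auto simp: max_def ennreal_neg)
    also have "\<dots> \<le> (\<Sum>n<N. upper_variation \<nu> (A n))"
      using assms B by (intro sum_mono upper_variation_upper) auto
    also have "\<dots> \<le> (\<Sum>n. upper_variation \<nu> (A n))"
      by (intro sum_le_suminf) auto
    finally show ?thesis .
  qed
  ultimately show "ennreal (\<nu> B) \<le> (\<Sum>n. upper_variation \<nu> (A n))"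
    by (intro LIMSEQ_le_const2) auto
qed

text \<open>
  Nearly optimal subsets \<open>X\<close> of \<open>A\<close> and \<open>Y\<close> of \<open>B\<close> combine to a subset of \<open>A \<union> B\<close>; one of negative
  measure is dropped, as \<open>ennreal\<close> counts it as \<open>0\<close>.
\<close>
lemma upper_variation_superadditive:
  assumes "A \<in> sets borel" "B \<in> sets borel" "A \<subseteq> S" "B \<subseteq> S" "A \<inter> B = {}"
  shows "upper_variation \<nu> A + upper_variation \<nu> B \<le> upper_variation \<nu> (A \<union> B)"
proof -
  let ?I = "\<lambda>E. {B \<in> sets borel. B \<subseteq> E} :: real set set"
  have le: "ennreal (\<nu> X) + ennreal (\<nu> Y) \<le> upper_variation \<nu> (A \<union> B)"
    if "X \<in> ?I A" "Y \<in> ?I B" for X Y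
  proof -
    have XY: "X \<in> sets borel" "Y \<in> sets borel" "X \<subseteq> A" "Y \<subseteq> B"
      using that by auto
    consider "\<nu> X < 0" | "\<nu> Y < 0" | "\<nu> X \<ge> 0" "\<nu> Y \<ge> 0" by linarith
    then show ?thesis
    proof cases
      case 1
      then show ?thesis
        using upper_variation_upper[of Y "A \<union> B"] XY by (auto simp: ennreal_neg)
    next
      case 2
      then show ?thesis
        using upper_variation_upper[of X "A \<union> B"] XY by (auto simp: ennreal_neg)
    next
      case 3
      have "\<nu> (X \<union> Y) = \<nu> X + \<nu> Y"
        using XY assms by (intro additive) auto
      then show ?thesis
        using 3 upper_variation_upper[of "X \<union> Y" "A \<union> B"] XY by (auto simp: ennreal_plus)
    qed
  qed
  have ne: "?I E \<noteq> {}" for E by auto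
  have "upper_variation \<nu> A + upper_variation \<nu> B
      = (SUP X \<in> ?I A. ennreal (\<nu> X) + upper_variation \<nu> B)"
    unfolding upper_variation_def[of \<nu> A] by (rule ennreal_SUP_add_left[symmetric, OF ne])
  also have "\<dots> \<le> upper_variation \<nu> (A \<union> B)"
  proof (rule SUP_least)
    fix X assume X: "X \<in> ?I A"
    have "ennreal (\<nu> X) + upper_variation \<nu> B = (SUP Y \<in> ?I B. ennreal (\<nu> X) + ennreal (\<nu> Y))"
      unfolding upper_variation_def[of \<nu> B] by (rule ennreal_SUP_add_right[OF ne])
    also have "\<dots> \<le> upper_variation \<nu> (A \<union> B)"
      using le[OF X] by (intro SUP_least) auto
    finally show "ennreal (\<nu> X) + upper_variation \<nu> B \<le> upper_variation \<nu> (A \<union> B)" .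
  qed
  finally show ?thesis .
qed

lemma upper_variation_countably_additive:
  fixes A :: "nat \<Rightarrow> real set"
  assumes "\<And>n. A n \<in> sets borel" "\<And>n. A n \<subseteq> S" "disjoint_family A"
  shows "(\<Sum>n. upper_variation \<nu> (A n)) = upper_variation \<nu> (\<Union>n. A n)"
proof (rule antisym)
  have fin: "(\<Sum>n<N. upper_variation \<nu> (A n)) \<le> upper_variation \<nu> (\<Union>n<N. A n)" for N
  proof (induction N)
    case 0
    then show ?case by simp
  next
    case (Suc N)
    have "(\<Sum>n<Suc N. upper_variation \<nu> (A n)) \<le> upper_variation \<nu> (\<Union>n<N. A n) + upper_variation \<nu> (A N)"
      using Suc by (simp add: add_right_mono)
    also have "\<dots> \<le> upper_variation \<nu> ((\<Union>n<N. A n) \<union> A N)"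
    proof (intro upper_variation_superadditive)
      show "(\<Union>n<N. A n) \<inter> A N = {}"
      proof -
        have "A n \<inter> A N = {}" if "n < N" for n
          using assms(3) that by (intro disjoint_family_onD) auto
        then show ?thesis by blast
      qed
    qed (use assms in auto)
    also have "(\<Union>n<N. A n) \<union> A N = (\<Union>n<Suc N. A n)"
      by (auto simp: lessThan_Suc)
    finally show ?case .
  qed
  show "(\<Sum>n. upper_variation \<nu> (A n)) \<le> upper_variation \<nu> (\<Union>n. A n)"
  proof (rule suminf_le_const[OF summableI])
    fix N
    show "(\<Sum>n<N. upper_variation \<nu> (A n)) \<le> upper_variation \<nu> (\<Union>n. A n)"
      using fin[of N] upper_variation_mono[of "\<Union>n<N. A n" "\<Union>n. A n"] by (auto intro: order_trans)
  qed
qed (intro upper_variation_countably_subadditive assms)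

text \<open>
  A subset \<open>B\<close> with \<open>\<nu> B > \<bar>\<nu> E\<bar> + 1\<close> forces \<open>\<nu> (E - B) < -1\<close>, so \<open>\<bar>\<nu>\<bar>\<close> is at least \<open>1\<close> on both
  parts; one of them still has infinite variation and is kept.
\<close>
lemma upper_variation_halving:
  assumes E: "E \<in> sets borel" "E \<subseteq> S" "upper_variation \<nu> E = \<infinity>"
  shows "\<exists>F \<in> sets borel. F \<subseteq> E \<and> upper_variation \<nu> F = \<infinity> \<and> 1 \<le> \<bar>\<nu> (E - F)\<bar>"
proof -
  have "ennreal (\<bar>\<nu> E\<bar> + 1) < upper_variation \<nu> E"
    using E by simp
  then obtain B where B: "B \<in> sets borel" "B \<subseteq> E" "ennreal (\<bar>\<nu> E\<bar> + 1) < ennreal (\<nu> B)"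
    unfolding upper_variation_def by (auto simp: less_SUP_iff)
  have nB: "\<nu> B > \<bar>\<nu> E\<bar> + 1"
    using B(3) by (smt (verit) ennreal_leI linorder_not_le)
  have "\<nu> (B \<union> (E - B)) = \<nu> B + \<nu> (E - B)"
    using B E by (intro additive) auto
  then have nE: "\<nu> E = \<nu> B + \<nu> (E - B)"
    using B(2) by (simp add: Un_absorb1)
  have "upper_variation \<nu> E \<le> upper_variation \<nu> B + upper_variation \<nu> (E - B)"
  proof -
    have "upper_variation \<nu> (\<Union>n. binaryset B (E - B) n) \<le> (\<Sum>n. upper_variation \<nu> (binaryset B (E - B) n))"
      using B E
      by (intro upper_variation_countably_subadditive) (auto simp: binaryset_def disjoint_family_on_def)
    moreover have "(\<lambda>n. upper_variation \<nu> (binaryset B (E - B) n)) sums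
        (upper_variation \<nu> B + upper_variation \<nu> (E - B))"
      by (rule binaryset_sums) (rule upper_variation_empty)
    ultimately show ?thesis
      using B(2) by (simp add: UN_binaryset_eq sums_iff Un_absorb1)
  qed
  then consider "upper_variation \<nu> B = \<infinity>" | "upper_variation \<nu> (E - B) = \<infinity>"
    using E(3) by (metis ennreal_add_eq_top infinity_ennreal_def top.extremum_uniqueI)
  then show ?thesis
  proof cases
    case 1
    then show ?thesis
      using B nB nE by (intro bexI[of _ B]) auto
  next
    case 2
    have "E - (E - B) = B" using B(2) by auto
    then show ?thesis
      using 2 B E nB by (intro bexI[of _ "E - B"]) auto
  qed
qed

text \<open>
  Otherwise repeated halving produces disjoint sets on each of which \<open>\<bar>\<nu>\<bar> \<ge> 1\<close>, and the values of \<open>\<nu>\<close>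
  on disjoint sets must tend to \<open>0\<close>.
\<close>
lemma upper_variation_finite: "upper_variation \<nu> S < \<infinity>"
proof (rule ccontr)
  assume "\<not> upper_variation \<nu> S < \<infinity>"
  then have top: "upper_variation \<nu> S = \<infinity>"
    by (metis infinity_ennreal_def less_top)
  let ?P = "\<lambda>E. E \<in> sets borel \<and> E \<subseteq> S \<and> upper_variation \<nu> E = \<infinity>"
  have "\<exists>F. \<forall>n. ?P (F n) \<and> (F (Suc n) \<subseteq> F n \<and> 1 \<le> \<bar>\<nu> (F n - F (Suc n))\<bar>)"
  proof (rule dependent_nat_choice)
    show "\<exists>E. ?P E" using top S_borel by blast
  next
    fix E and n :: nat assume "?P E"
    then show "\<exists>F. ?P F \<and> (F \<subseteq> E \<and> 1 \<le> \<bar>\<nu> (E - F)\<bar>)"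
      using upper_variation_halving[of E] by blast
  qed
  then obtain F where F: "\<And>n. ?P (F n)" "\<And>n. F (Suc n) \<subseteq> F n"
      "\<And>n. 1 \<le> \<bar>\<nu> (F n - F (Suc n))\<bar>" by blast
  have anti: "F n \<subseteq> F m" if "m \<le> n" for m n
    using lift_Suc_antimono_le[of F m n] F(2) that by blast
  have "(\<lambda>n. \<nu> (F n - F (Suc n))) sums \<nu> (\<Union>n. F n - F (Suc n))"
  proof (rule sums)
    show "disjoint_family (\<lambda>n. F n - F (Suc n))"
      unfolding disjoint_family_on_def
    proof (intro ballI impI)
      fix m n :: nat assume "m \<noteq> n"
      then consider "Suc m \<le> n" | "Suc n \<le> m" by linarith
      then show "(F m - F (Suc m)) \<inter> (F n - F (Suc n)) = {}"
        by cases (use anti in blast)+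
    qed
  qed (use F(1) in auto)
  then have "(\<lambda>n. \<nu> (F n - F (Suc n))) \<longlonglongrightarrow> 0"
    by (intro summable_LIMSEQ_zero sums_summable)
  then have "\<forall>\<^sub>F n in sequentially. \<bar>\<nu> (F n - F (Suc n))\<bar> < 1"
    by (auto simp: tendsto_iff dist_real_def)
  then obtain n where "\<bar>\<nu> (F n - F (Suc n))\<bar> < 1"
    using eventually_happens'[OF sequentially_bot] by blast
  then show False
    using F(3)[of n] by linarith
qed

definition variation_measure :: "real measure" where
  "variation_measure = measure_of UNIV (sets borel) (\<lambda>E. upper_variation \<nu> (E \<inter> S))"

lemma sets_variation_measure [measurable_cong, simp]: "sets variation_measure = sets borel"
  by (metis variation_measure_def sets.sets_measure_of_eq space_borel)

lemma emeasure_variation_measure: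
  "E \<in> sets borel \<Longrightarrow> emeasure variation_measure E = upper_variation \<nu> (E \<inter> S)"
proof (rule emeasure_measure_of[OF variation_measure_def])
  show "positive (sets variation_measure) (\<lambda>E. upper_variation \<nu> (E \<inter> S))"
    by (simp add: positive_def upper_variation_empty)
  show "countably_additive (sets variation_measure) (\<lambda>E. upper_variation \<nu> (E \<inter> S))"
  proof (rule countably_additiveI)
    fix A :: "nat \<Rightarrow> real set"
    assume A: "range A \<subseteq> sets variation_measure" "disjoint_family A"
    have "(\<Sum>n. upper_variation \<nu> (A n \<inter> S)) = upper_variation \<nu> (\<Union>n. A n \<inter> S)"
      using A S_borel
      by (intro upper_variation_countably_additive) (auto simp: disjoint_family_on_def)
    then show "(\<Sum>n. upper_variation \<nu> (A n \<inter> S)) = upper_variation \<nu> ((\<Union>n. A n) \<inter> S)"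
      by simp
  qed
qed auto

lemma finite_variation_measure: "finite_measure variation_measure"
proof (rule finite_measureI)
  have "space variation_measure = UNIV"
    by (simp add: sets_eq_imp_space_eq[OF sets_variation_measure])
  then show "emeasure variation_measure (space variation_measure) \<noteq> \<infinity>"
    using upper_variation_finite by (simp add: emeasure_variation_measure)
qed

text \<open>
  The integral over \<open>E\<close> is taken against a measure constructed from \<open>E\<close>.  All these measures are
  restrictions of one, because the upper variation of a set depends only on its own subsets.
\<close>
lemma pos_variation_eq:
  assumes "E \<in> sets borel" "E \<subseteq> S"
  shows "pos_variation E \<nu> = restrict_space variation_measure E"
proof -
  let ?R = "restrict_space variation_measure E"
  have "space variation_measure = UNIV"
    by (simp add: sets_eq_imp_space_eq[OF sets_variation_measure])
  then have sp: "space ?R = E"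
    by (simp add: space_restrict_space)
  have se: "sets ?R = sets (restrict_space borel E)"
    by (simp add: sets_restrict_space)
  have "pos_variation E \<nu> = measure_of E (sets (restrict_space borel E)) (emeasure ?R)"
    unfolding pos_variation_def
  proof (rule measure_of_eq)
    show "sets (restrict_space borel E) \<subseteq> Pow E"
      by (auto simp: sets_restrict_space)
    fix A assume "A \<in> sigma_sets E (sets (restrict_space borel E))"
    then have "A \<in> sets (restrict_space borel E)"
      using sets.sigma_sets_eq[of ?R] unfolding sp se by blast
    then have A: "A \<in> sets borel" "A \<subseteq> E"
      using assms(1) unfolding sets_restrict_space by (auto intro: sets.Int)
    have "emeasure ?R A = emeasure variation_measure A"
      using A assms by (intro emeasure_restrict_space) auto
    also have "\<dots> = upper_variation \<nu> A"
      using A assms by (subst emeasure_variation_measure) (auto simp: Int_absorb2)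
    finally show "(SUP B\<in>{B \<in> sets borel. B \<subseteq> A}. ennreal (\<nu> B)) = emeasure ?R A"
      by (simp add: upper_variation_def)
  qed
  then show ?thesis
    using measure_of_of_measure[of ?R] by (simp only: sp se)
qed

lemma minus: "signed_measure_on S (\<lambda>E. - \<nu> E)"
  using S_borel sums by unfold_locales (auto intro: sums_minus)

end

text \<open>
  By additivity \<open>\<nu> B = \<nu> E - \<nu> (E - B)\<close>.  Taking the supremum over \<open>B\<close> gives the identity,
  since the upper variation is finite and can be subtracted.
\<close>
lemma (in signed_measure_on) jordan_decomposition:
  assumes E: "E \<in> sets borel" "E \<subseteq> S"
  shows "measure (signed_measure_on.variation_measure S \<nu>) E
    - measure (signed_measure_on.variation_measure S (\<lambda>E. - \<nu> E)) E = \<nu> E"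
proof -
  interpret n: signed_measure_on S "\<lambda>E. - \<nu> E" by (rule minus)
  interpret P: finite_measure variation_measure by (rule finite_variation_measure)
  interpret N: finite_measure n.variation_measure by (rule n.finite_variation_measure)
  have P: "ennreal (measure variation_measure E) = upper_variation \<nu> E"
    using E by (simp add: P.emeasure_eq_measure[symmetric] emeasure_variation_measure Int_absorb2)
  have N: "ennreal (measure n.variation_measure E) = upper_variation (\<lambda>E. - \<nu> E) E"
    using E by (simp add: N.emeasure_eq_measure[symmetric] n.emeasure_variation_measure Int_absorb2)
  have split: "\<nu> E = \<nu> B + \<nu> (E - B)" if "B \<in> sets borel" "B \<subseteq> E" for B
    using additive[of B "E - B"] that E by (auto simp: Un_absorb1)
  have Pb: "\<nu> B \<le> measure variation_measure E" if "B \<in> sets borel" "B \<subseteq> E" for B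
    using upper_variation_upper[OF that] unfolding P[symmetric] by (simp add: ennreal_le_iff)
  have Nb: "- \<nu> B \<le> measure n.variation_measure E" if "B \<in> sets borel" "B \<subseteq> E" for B
    using n.upper_variation_upper[OF that] unfolding N[symmetric] by (simp add: ennreal_le_iff)
  have "upper_variation \<nu> E \<le> ennreal (\<nu> E + measure n.variation_measure E)"
    unfolding upper_variation_def
  proof (rule SUP_least, rule ennreal_leI)
    fix B assume "B \<in> {B \<in> sets borel. B \<subseteq> E}"
    then show "\<nu> B \<le> \<nu> E + measure n.variation_measure E"
      using split[of B] Nb[of "E - B"] E by auto
  qed
  then have 1: "measure variation_measure E \<le> \<nu> E + measure n.variation_measure E"
    unfolding P[symmetric] using Nb[of E] E by (subst (asm) ennreal_le_iff) auto
  have "upper_variation (\<lambda>E. - \<nu> E) E \<le> ennreal (measure variation_measure E - \<nu> E)"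
    unfolding upper_variation_def
  proof (rule SUP_least, rule ennreal_leI)
    fix B assume "B \<in> {B \<in> sets borel. B \<subseteq> E}"
    then show "- \<nu> B \<le> measure variation_measure E - \<nu> E"
      using split[of B] Pb[of "E - B"] E by auto
  qed
  then have 2: "measure n.variation_measure E \<le> measure variation_measure E - \<nu> E"
    unfolding N[symmetric] using Pb[of E] E by (subst (asm) ennreal_le_iff) auto
  show ?thesis using 1 2 by linarith
qed

section \<open>Densities of complex measures\<close>

lemma dominating_measure_exists:
  fixes P :: "'i \<Rightarrow> real measure"
  assumes I: "finite I" and P: "\<And>i. i \<in> I \<Longrightarrow> finite_measure (P i)"
    and sets_P: "\<And>i. i \<in> I \<Longrightarrow> sets (P i) = sets borel"
  shows "\<exists>M. finite_measure M \<and> sets M = sets borel \<and> (\<forall>i\<in>I. absolutely_continuous M (P i))"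
proof -
  define M where "M = measure_of UNIV (sets borel) (\<lambda>E. \<Sum>i\<in>I. emeasure (P i) E)"
  have sets_M: "sets M = sets borel"
    unfolding M_def by (metis sets.sets_measure_of_eq space_borel)
  have emeasure_M: "emeasure M E = (\<Sum>i\<in>I. emeasure (P i) E)" if "E \<in> sets borel" for E
  proof (rule emeasure_measure_of[OF M_def])
    show "countably_additive (sets M) (\<lambda>E. \<Sum>i\<in>I. emeasure (P i) E)"
    proof (rule countably_additiveI)
      fix A :: "nat \<Rightarrow> real set"
      assume A: "range A \<subseteq> sets M" "disjoint_family A"
      have "(\<Sum>n. \<Sum>i\<in>I. emeasure (P i) (A n)) = (\<Sum>i\<in>I. \<Sum>n. emeasure (P i) (A n))"
        by (rule suminf_sum) auto
      also have "\<dots> = (\<Sum>i\<in>I. emeasure (P i) (\<Union>n. A n))"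
        using A by (intro sum.cong refl suminf_emeasure) (auto simp: sets_P sets_M)
      finally show "(\<Sum>n. \<Sum>i\<in>I. emeasure (P i) (A n)) = (\<Sum>i\<in>I. emeasure (P i) (\<Union>n. A n))" .
    qed
  qed (use that in \<open>auto simp: positive_def sets_M\<close>)
  have "finite_measure M"
  proof (rule finite_measureI)
    have "emeasure (P i) UNIV < top" if "i \<in> I" for i
      using finite_measure.emeasure_finite[OF P[OF that]] by (simp add: less_top)
    then show "emeasure M (space M) \<noteq> \<infinity>"
      using I by (simp add: sets_eq_imp_space_eq[OF sets_M] emeasure_M less_top)
  qed
  moreover have "absolutely_continuous M (P i)" if "i \<in> I" for i
    using that I by (auto simp: absolutely_continuous_def null_sets_def sets_M sets_P emeasure_M)
  ultimately show ?thesis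
    using sets_M by blast
qed

lemma radon_nikodym_integral:
  fixes M P :: "real measure"
  assumes M: "finite_measure M" "sets M = sets borel" and P: "finite_measure P" "sets P = sets borel"
    and ac: "absolutely_continuous M P"
  obtains D :: "real \<Rightarrow> real" where "integrable M D"
    and "\<And>E. E \<in> sets borel \<Longrightarrow> measure P E = (\<integral>x. indicator E x * D x \<partial>M)"
    and "\<And>E (f :: real \<Rightarrow> complex). E \<in> sets borel \<Longrightarrow>
      (\<lambda>x. indicator E x *\<^sub>R f x) \<in> borel_measurable borel \<Longrightarrow>
      integral\<^sup>L (restrict_space P E) f = (\<integral>x. indicator E x *\<^sub>R (D x *\<^sub>R f x) \<partial>M)"
proof -
  interpret M: finite_measure M by fact
  interpret P: finite_measure P by fact
  have spM: "space M = UNIV" and spP: "space P = UNIV"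
    using sets_eq_imp_space_eq[OF M(2)] sets_eq_imp_space_eq[OF P(2)] by auto
  note [measurable_cong] = M(2) P(2)
  obtain D where D: "D \<in> borel_measurable M" "AE x in M. RN_deriv M P x = ennreal (D x)" "\<And>x. 0 \<le> D x"
    using M.real_RN_deriv[OF P(1) ac] P(2) M(2) by metis
  note [measurable] = D(1)
  have dens: "P = density M (\<lambda>x. ennreal (D x))"
  proof -
    have "P = density M (RN_deriv M P)"
      using M.density_RN_deriv[OF ac] P(2) M(2) by simp
    also have "\<dots> = density M (\<lambda>x. ennreal (D x))"
      using D(2) by (intro density_cong) auto
    finally show ?thesis .
  qed
  have int: "(\<integral>x. f x \<partial>P) = (\<integral>x. D x *\<^sub>R f x \<partial>M)"
    if "f \<in> borel_measurable borel" for f :: "real \<Rightarrow> 'b::{banach, second_countable_topology}"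
    unfolding dens using that D by (intro integral_density) (auto simp: measurable_cong_sets[OF M(2) refl])
  have 1: "integrable M D"
  proof -
    have "integrable P (\<lambda>x. 1 :: real)" by simp
    then have "integrable M (\<lambda>x. D x *\<^sub>R (1::real))"
      unfolding dens using D by (subst (asm) integrable_density) auto
    then show ?thesis by simp
  qed
  have 2: "measure P E = (\<integral>x. indicator E x * D x \<partial>M)" if "E \<in> sets borel" for E
  proof -
    have "measure P E = (\<integral>x. indicator E x \<partial>P)"
      using that by (simp add: spP)
    also have "\<dots> = (\<integral>x. D x *\<^sub>R indicator E x \<partial>M)"
      using that by (intro int) auto
    finally show ?thesis by (simp add: mult.commute)
  qed
  have 3: "integral\<^sup>L (restrict_space P E) f = (\<integral>x. indicator E x *\<^sub>R (D x *\<^sub>R f x) \<partial>M)"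
    if "E \<in> sets borel" "(\<lambda>x. indicator E x *\<^sub>R f x) \<in> borel_measurable borel" for E and f :: "real \<Rightarrow> complex"
  proof -
    have "integral\<^sup>L (restrict_space P E) f = (\<integral>x. indicator E x *\<^sub>R f x \<partial>P)"
      using that by (intro integral_restrict_space) (auto simp: P(2) spP)
    also have "\<dots> = (\<integral>x. D x *\<^sub>R (indicator E x *\<^sub>R f x) \<partial>M)"
      by (rule int) fact
    finally show ?thesis by (simp add: mult.commute)
  qed
  show ?thesis using that 1 2 3 by blast
qed

text \<open>
  The equation only uses two functionals of a complex measure: its values and the integrals of
  bounded functions.  Both are recorded as integrals of a density \<open>h\<close> against \<open>M\<close>.  The density is
  extended by \<open>0\<close> outside \<open>S\<close>, so that no integral needs to mention \<open>S\<close>.  Integrands are constrained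
  on \<open>E\<close> only, because solutions are arbitrary outside the interval.
\<close>
definition has_density ::
    "real measure \<Rightarrow> real set \<Rightarrow> (real set \<Rightarrow> complex) \<Rightarrow> (real \<Rightarrow> complex) \<Rightarrow> bool" where
  "has_density M S \<mu> h \<longleftrightarrow>
     integrable M h \<and> (\<forall>x. x \<notin> S \<longrightarrow> h x = 0) \<and>
     (\<forall>E\<in>sets borel. E \<subseteq> S \<longrightarrow> \<mu> E = (\<integral>x. indicator E x *\<^sub>R h x \<partial>M)) \<and>
     (\<forall>E\<in>sets borel. \<forall>f B. E \<subseteq> S \<and> (\<lambda>x. indicator E x *\<^sub>R f x) \<in> borel_measurable borel \<and>
        (\<forall>x\<in>E. norm (f x) \<le> B) \<longrightarrow>
        complex_measure_integral E \<mu> f = (\<integral>x. indicator E x *\<^sub>R (h x * f x) \<partial>M))"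

lemma integrable_mult_bounded_on:
  fixes h f :: "real \<Rightarrow> complex"
  assumes "integrable M h" "sets M = sets borel"
    and "(\<lambda>x. indicator E x *\<^sub>R f x) \<in> borel_measurable borel" "\<And>x. x \<in> E \<Longrightarrow> norm (f x) \<le> B"
  shows "integrable M (\<lambda>x. indicator E x *\<^sub>R (h x * f x))"
proof -
  have "integrable M (\<lambda>x. h x * (indicator E x *\<^sub>R f x))"
  proof (rule Bochner_Integration.integrable_bound)
    show "integrable M (\<lambda>x. \<bar>B\<bar> * norm (h x))"
      using assms by (intro integrable_mult_right integrable_norm) auto
    show "(\<lambda>x. h x * (indicator E x *\<^sub>R f x)) \<in> borel_measurable M"
      using assms by (intro borel_measurable_times) (auto simp: measurable_cong_sets[OF assms(2) refl])
    show "AE x in M. norm (h x * (indicator E x *\<^sub>R f x)) \<le> norm (\<bar>B\<bar> * norm (h x))"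
    proof (rule AE_I2)
      fix x
      have "norm (indicator E x *\<^sub>R f x) \<le> \<bar>B\<bar>"
        using assms(4)[of x] by (auto simp: indicator_def)
      then have "norm (indicator E x *\<^sub>R f x) * norm (h x) \<le> \<bar>B\<bar> * norm (h x)"
        by (rule mult_right_mono) simp
      then show "norm (h x * (indicator E x *\<^sub>R f x)) \<le> norm (\<bar>B\<bar> * norm (h x))"
        by (simp add: norm_mult abs_mult ac_simps)
    qed
  qed
  then show ?thesis by simp
qed

lemma signed_measure_onI:
  assumes "complex_measure_on S \<mu>" "S \<in> sets borel"
  shows "signed_measure_on S (\<lambda>E. Re (s * \<mu> E))"
proof
  fix A :: "nat \<Rightarrow> real set"
  assume "\<And>n. A n \<in> sets borel" "\<And>n. A n \<subseteq> S" "disjoint_family A"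
  then have "(\<lambda>n. \<mu> (A n)) sums \<mu> (\<Union>n. A n)"
    using assms(1) by (simp add: complex_measure_on_def)
  then show "(\<lambda>n. Re (s * \<mu> (A n))) sums Re (s * \<mu> (\<Union>n. A n))"
    by (intro sums_Re sums_mult)
qed fact

text \<open>
  The four set functions \<open>Re (s * \<mu>)\<close> with \<open>s\<close> in \<open>{1, -1, -\<i>, \<i>}\<close> have as upper variations the
  positive and negative parts of the real and imaginary parts of \<open>\<mu>\<close>.  These parts, for all
  \<open>\<mu>\<close> of a finite family, are dominated by their sum, and their Radon-Nikodym densities are
  combined.
\<close>
lemma has_density_exists:
  fixes \<mu> :: "'i \<Rightarrow> real set \<Rightarrow> complex"
  assumes I: "finite I" and S: "S \<in> sets borel" and \<mu>: "\<And>i. i \<in> I \<Longrightarrow> complex_measure_on S (\<mu> i)"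
  shows "\<exists>M h. finite_measure M \<and> sets M = sets borel \<and> (\<forall>i\<in>I. has_density M S (\<mu> i) (h i))"
proof -
  define \<nu> where "\<nu> i s E = Re (s * \<mu> i E)" for i s E
  define P where "P i s = signed_measure_on.variation_measure S (\<nu> i s)" for i s
  let ?U = "{1, -1, -\<i>, \<i>} :: complex set"
  have sgn: "signed_measure_on S (\<nu> i s)" if "i \<in> I" for i s
    using signed_measure_onI[OF \<mu>[OF that] S] unfolding \<nu>_def .
  have finP: "finite_measure (P i s)" and setsP: "sets (P i s) = sets borel" if "i \<in> I" for i s
    using signed_measure_on.finite_variation_measure[OF sgn[OF that]]
      signed_measure_on.sets_variation_measure[OF sgn[OF that]] unfolding P_def by blast+
  have "\<exists>M. finite_measure M \<and> sets M = sets borel \<and>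
      (\<forall>p\<in>I \<times> ?U. absolutely_continuous M (case p of (i, s) \<Rightarrow> P i s))"
    using I finP setsP by (intro dominating_measure_exists) auto
  then obtain M where M: "finite_measure M" "sets M = sets borel"
    and ac: "\<And>i s. i \<in> I \<Longrightarrow> s \<in> ?U \<Longrightarrow> absolutely_continuous M (P i s)"
    by (metis (mono_tags, lifting) SigmaI case_prod_conv)
  have "\<exists>h. has_density M S (\<mu> i) h" if i: "i \<in> I" for i
  proof -
    let ?Q = "\<lambda>s D. integrable M D \<and>
      (\<forall>E. E \<in> sets borel \<longrightarrow> measure (P i s) E = (\<integral>x. indicator E x * D x \<partial>M)) \<and>
      (\<forall>E (f :: real \<Rightarrow> complex). E \<in> sets borel \<and> (\<lambda>x. indicator E x *\<^sub>R f x) \<in> borel_measurable borel \<longrightarrow>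
        integral\<^sup>L (restrict_space (P i s) E) f = (\<integral>x. indicator E x *\<^sub>R (D x *\<^sub>R f x) \<partial>M))"
    have "\<forall>s\<in>?U. \<exists>D :: real \<Rightarrow> real. ?Q s D"
    proof
      fix s assume s: "s \<in> ?U"
      show "\<exists>D :: real \<Rightarrow> real. ?Q s D"
        by (rule radon_nikodym_integral[OF M finP[OF i, of s] setsP[OF i, of s] ac[OF i s]]) blast
    qed
    then obtain D :: "complex \<Rightarrow> real \<Rightarrow> real" where "\<forall>s\<in>?U. ?Q s (D s)"
      by (rule bchoice[THEN exE])
    then have D: "?Q s (D s)" if "s \<in> ?U" for s
      using that by (rule bspec)
    define h where "h x = indicator S x *\<^sub>R
      (complex_of_real (D 1 x - D (-1) x) + \<i> * complex_of_real (D (-\<i>) x - D \<i> x))" for x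
    have intD: "integrable M (D s)" if "s \<in> ?U" for s
      using D[OF that] by blast
    have Sm: "S \<in> sets M"
      using S M by simp
    have inth: "integrable M h"
      unfolding h_def using intD Sm by (intro integrable_mult_indicator) auto
    have measP: "Re (s * \<mu> i E) = measure (P i s) E - measure (P i (-s)) E"
      if "E \<in> sets borel" "E \<subseteq> S" for s E
      using signed_measure_on.jordan_decomposition[OF sgn[OF i], of E s] that
      unfolding P_def \<nu>_def by simp
    have dE: "h x = complex_of_real (D 1 x - D (-1) x) + \<i> * complex_of_real (D (-\<i>) x - D \<i> x)"
      if "E \<subseteq> S" "x \<in> E" for E x
      using that by (auto simp: h_def)
    have 1: "\<mu> i E = (\<integral>x. indicator E x *\<^sub>R h x \<partial>M)" if E: "E \<in> sets borel" "E \<subseteq> S" for E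
    proof -
      have ii: "integrable M (\<lambda>x. indicator E x * D s x)" if "s \<in> ?U" for s
        using integrable_mult_indicator[OF _ intD[OF that], of E] E M(2) by simp
      have "(\<integral>x. indicator E x *\<^sub>R h x \<partial>M)
          = (\<integral>x. complex_of_real (indicator E x * D 1 x - indicator E x * D (-1) x)
              + \<i> * complex_of_real (indicator E x * D (-\<i>) x - indicator E x * D \<i> x) \<partial>M)"
        using dE[OF E(2)] by (intro Bochner_Integration.integral_cong refl) (auto simp: indicator_def)
      also have "\<dots> = complex_of_real (measure (P i 1) E - measure (P i (-1)) E)
          + \<i> * complex_of_real (measure (P i (-\<i>)) E - measure (P i \<i>) E)"
        using D E ii by (simp flip: of_real_diff)
      also have "\<dots> = complex_of_real (Re (\<mu> i E)) + \<i> * complex_of_real (Im (\<mu> i E))"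
        using measP[OF E, of 1] measP[OF E, of "-\<i>"] by simp
      finally show ?thesis by (simp add: complex_eq)
    qed
    have 2: "complex_measure_integral E (\<mu> i) f = (\<integral>x. indicator E x *\<^sub>R (h x * f x) \<partial>M)"
      if E: "E \<in> sets borel" "E \<subseteq> S" and f: "(\<lambda>x. indicator E x *\<^sub>R f x) \<in> borel_measurable borel"
        "\<forall>x\<in>E. norm (f x) \<le> B" for E f B
    proof -
      have ii: "integrable M (\<lambda>x. indicator E x *\<^sub>R (complex_of_real (D s x) * f x))" if "s \<in> ?U" for s
        using intD[OF that] f M(2) by (intro integrable_mult_bounded_on[where B = B]) auto
      have pv: "integral\<^sup>L (pos_variation E (\<nu> i s)) f = (\<integral>x. indicator E x *\<^sub>R (complex_of_real (D s x) * f x) \<partial>M)"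
        if "s \<in> ?U" for s
        using D[OF that] E f signed_measure_on.pos_variation_eq[OF sgn[OF i] E]
        unfolding P_def by (simp add: scaleR_conv_of_real)
      have "(\<integral>x. indicator E x *\<^sub>R (h x * f x) \<partial>M)
          = (\<integral>x. (indicator E x *\<^sub>R (complex_of_real (D 1 x) * f x) - indicator E x *\<^sub>R (complex_of_real (D (-1) x) * f x))
              + \<i> * (indicator E x *\<^sub>R (complex_of_real (D (-\<i>) x) * f x) - indicator E x *\<^sub>R (complex_of_real (D \<i> x) * f x)) \<partial>M)"
        by (intro Bochner_Integration.integral_cong refl)
          (auto simp: indicator_def dE[OF E(2)] algebra_simps)
      also have "\<dots> = (integral\<^sup>L (pos_variation E (\<nu> i 1)) f - integral\<^sup>L (pos_variation E (\<nu> i (-1))) f)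
              + \<i> * (integral\<^sup>L (pos_variation E (\<nu> i (-\<i>))) f - integral\<^sup>L (pos_variation E (\<nu> i \<i>)) f)"
        using ii by (simp add: pv del: scaleR_conv_of_real)
      also have "\<dots> = complex_measure_integral E (\<mu> i) f"
        by (simp add: complex_measure_integral_def signed_integral_def \<nu>_def[abs_def])
      finally show ?thesis ..
    qed
    have "has_density M S (\<mu> i) h"
      unfolding has_density_def using inth 1 2 by (auto simp: h_def)
    then show "\<exists>h. has_density M S (\<mu> i) h" by (intro exI[of _ h])
  qed
  then obtain h where "\<And>i. i \<in> I \<Longrightarrow> has_density M S (\<mu> i) (h i)"
    by metis
  then show ?thesis using M by blast
qed

lemma
  assumes "has_density M S \<mu> h"
  shows has_density_integrable: "integrable M h"
    and has_density_outside: "x \<notin> S \<Longrightarrow> h x = 0"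
    and has_density_measure: "E \<in> sets borel \<Longrightarrow> E \<subseteq> S \<Longrightarrow> \<mu> E = (\<integral>x. indicator E x *\<^sub>R h x \<partial>M)"
    and has_density_integral: "E \<in> sets borel \<Longrightarrow> E \<subseteq> S \<Longrightarrow>
      (\<lambda>x. indicator E x *\<^sub>R f x) \<in> borel_measurable borel \<Longrightarrow> (\<And>x. x \<in> E \<Longrightarrow> norm (f x) \<le> B) \<Longrightarrow>
      complex_measure_integral E \<mu> f = (\<integral>x. indicator E x *\<^sub>R (h x * f x) \<partial>M)"
  using assms unfolding has_density_def by blast+

text \<open>
  Densities may be set to \<open>0\<close> on a null set.  This turns properties that hold almost everywhere
  into properties that hold everywhere.
\<close>
lemma has_density_off_null_set:
  assumes h: "has_density M S \<mu> h" and M: "sets M = sets borel" and N: "N \<in> null_sets M"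
  shows "has_density M S \<mu> (\<lambda>x. if x \<in> N then 0 else h x)"
proof -
  have [measurable]: "h \<in> borel_measurable M" "N \<in> sets M"
    using h N by (auto simp: has_density_def)
  have ae: "AE x in M. (if x \<in> N then 0 else h x) = h x"
    by (rule AE_mp[OF AE_not_in[OF N]]) auto
  have int: "integrable M (\<lambda>x. if x \<in> N then 0 else h x)"
    using h by (subst integrable_cong_AE[OF _ _ ae]) (auto simp: has_density_def)
  have "(\<integral>x. indicator E x *\<^sub>R (if x \<in> N then 0 else h x) \<partial>M) = (\<integral>x. indicator E x *\<^sub>R h x \<partial>M)"
    if "E \<in> sets borel" for E
  proof -
    have [measurable]: "E \<in> sets M" using that M by simp
    show ?thesis using ae by (intro integral_cong_AE) auto
  qed
  moreover have "(\<integral>x. indicator E x *\<^sub>R ((if x \<in> N then 0 else h x) * f x) \<partial>M) = (\<integral>x. indicator E x *\<^sub>R (h x * f x) \<partial>M)"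
    if f: "(\<lambda>x. indicator E x *\<^sub>R f x) \<in> borel_measurable borel" for E and f :: "real \<Rightarrow> complex"
  proof -
    have [measurable]: "(\<lambda>x. indicator E x *\<^sub>R f x) \<in> borel_measurable M"
      using f by (simp add: measurable_cong_sets[OF M refl])
    have "(\<integral>x. (if x \<in> N then 0 else h x) * (indicator E x *\<^sub>R f x) \<partial>M) = (\<integral>x. h x * (indicator E x *\<^sub>R f x) \<partial>M)"
    proof (rule integral_cong_AE)
      show "AE x in M. (if x \<in> N then 0 else h x) * (indicator E x *\<^sub>R f x) = h x * (indicator E x *\<^sub>R f x)"
        using ae by auto
    qed measurable
    then show ?thesis by simp
  qed
  ultimately show ?thesis
    using h int unfolding has_density_def by auto
qed

section \<open>Balanced primitives and integration by parts\<close>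

text \<open>
  The Heaviside function with the value \<open>1/2\<close> at the jump.  This value makes primitives balanced,
  and gives the symmetry on which integration by parts depends.
\<close>
definition halfstep :: "real \<Rightarrow> real \<Rightarrow> real" where
  "halfstep x y = (if y < x then 1 else if y = x then 1/2 else 0)"

lemma halfstep_symmetry: "halfstep x y + halfstep y x = 1"
  by (simp add: halfstep_def)

lemma halfstep_bounds: "0 \<le> halfstep x y" "halfstep x y \<le> 1" "\<bar>halfstep x y\<bar> \<le> 1"
  by (simp_all add: halfstep_def)

lemma halfstep_measurable [measurable]:
  assumes [measurable]: "f \<in> borel_measurable N" "g \<in> borel_measurable N"
  shows "(\<lambda>p. halfstep (f p) (g p)) \<in> borel_measurable N"
  unfolding halfstep_def by measurable

definition primitive :: "real measure \<Rightarrow> (real \<Rightarrow> complex) \<Rightarrow> real \<Rightarrow> complex" where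
  "primitive M g x = (\<integral>y. halfstep x y *\<^sub>R g y \<partial>M)"

locale finite_borel_measure = finite_measure M for M :: "real measure" +
  assumes sets_borel [measurable_cong]: "sets M = sets borel"
begin

lemma space_UNIV: "space M = UNIV"
  using sets_eq_imp_space_eq[OF sets_borel] by simp

lemma integrable_weighted:
  fixes g :: "real \<Rightarrow> complex" and a :: "real \<Rightarrow> real"
  assumes "integrable M g" "a \<in> borel_measurable borel" "\<And>y. \<bar>a y\<bar> \<le> 1"
  shows "integrable M (\<lambda>y. a y *\<^sub>R g y)"
proof (rule Bochner_Integration.integrable_bound[OF assms(1)])
  show "AE y in M. norm (a y *\<^sub>R g y) \<le> norm (g y)"
    using assms(3) by (intro AE_I2) (simp add: mult_left_le_one_le)
qed (use assms in measurable)

lemma integrable_halfstep: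
  fixes g :: "real \<Rightarrow> complex"
  shows "integrable M g \<Longrightarrow> integrable M (\<lambda>y. halfstep x y *\<^sub>R g y)"
  by (rule integrable_weighted) (auto simp: halfstep_bounds)

lemma norm_primitive_le:
  assumes "integrable M g"
  shows "norm (primitive M g x) \<le> (\<integral>y. norm (g y) \<partial>M)"
proof -
  have "norm (primitive M g x) \<le> (\<integral>y. norm (halfstep x y *\<^sub>R g y) \<partial>M)"
    unfolding primitive_def by (rule integral_norm_bound)
  also have "\<dots> \<le> (\<integral>y. norm (g y) \<partial>M)"
    using assms integrable_halfstep[OF assms, of x]
    by (intro integral_mono integrable_norm) (auto simp: halfstep_bounds mult_left_le_one_le)
  finally show ?thesis .
qed

lemma primitive_measurable:
  assumes [measurable]: "integrable M g"
  shows "primitive M g \<in> borel_measurable borel"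
proof -
  have "(\<lambda>p. halfstep (fst p) (snd p) *\<^sub>R g (snd p)) \<in> borel_measurable (borel \<Otimes>\<^sub>M M)"
    by measurable
  then have "(\<lambda>x. \<integral>y. halfstep x y *\<^sub>R g y \<partial>M) \<in> borel_measurable borel"
    by (intro borel_measurable_lebesgue_integral) (simp add: case_prod_beta')
  then show ?thesis
    by (simp add: primitive_def[abs_def])
qed

text \<open>
  The product of the two integrals is a double integral of \<open>g y * h x\<close>; multiplying by
  \<open>1 = halfstep x y + halfstep y x\<close> splits it into two terms, which are the two integrals on the
  right after an exchange of the order of integration.
\<close>
lemma integral_by_parts:
  assumes g: "integrable M g" and h: "integrable M h"
  shows "(\<eta> + (\<integral>y. g y \<partial>M)) * (\<zeta> + (\<integral>y. h y \<partial>M)) =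
    \<eta> * \<zeta> + (\<integral>x. (\<eta> + primitive M g x) * h x \<partial>M) + (\<integral>x. g x * (\<zeta> + primitive M h x) \<partial>M)"
proof -
  have [measurable]: "g \<in> borel_measurable M" "h \<in> borel_measurable M"
    using g h by auto
  interpret pair_sigma_finite M M ..
  let ?F = "\<lambda>x y. halfstep y x *\<^sub>R (g y * h x)"
  have "integrable (M \<Otimes>\<^sub>M M) (\<lambda>p. halfstep (snd p) (fst p) *\<^sub>R (g (snd p) * h (fst p)))"
  proof (rule Bochner_Integration.integrable_bound)
    show "integrable (M \<Otimes>\<^sub>M M) (\<lambda>p. g (snd p) * h (fst p))"
    proof (rule Fubini_integrable)
      show "integrable M (\<lambda>x. \<integral>y. norm (g (snd (x, y)) * h (fst (x, y))) \<partial>M)"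
        using h by (simp add: norm_mult)
      show "AE x in M. integrable M (\<lambda>y. g (snd (x, y)) * h (fst (x, y)))"
        using g by simp
    qed measurable
    show "AE p in M \<Otimes>\<^sub>M M. norm (halfstep (snd p) (fst p) *\<^sub>R (g (snd p) * h (fst p)))
        \<le> norm (g (snd p) * h (fst p))"
      by (auto simp: halfstep_bounds mult_left_le_one_le)
  qed measurable
  then have int: "integrable (M \<Otimes>\<^sub>M M) (\<lambda>(x, y). ?F x y)"
    by (simp add: case_prod_beta')
  have bdd: "integrable M (\<lambda>x. primitive M a x * e x)" if "integrable M a" "integrable M e" for a e
  proof (rule Bochner_Integration.integrable_bound)
    show "integrable M (\<lambda>x. (\<integral>y. norm (a y) \<partial>M) * norm (e x))"
      using that by (intro integrable_mult_right integrable_norm)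
    show "(\<lambda>x. primitive M a x * e x) \<in> borel_measurable M"
      using primitive_measurable[OF that(1)] that by measurable
    show "AE x in M. norm (primitive M a x * e x) \<le> norm ((\<integral>y. norm (a y) \<partial>M) * norm (e x))"
      using norm_primitive_le[OF that(1)]
      by (auto simp: norm_mult abs_mult intro!: mult_right_mono order_trans[OF _ abs_ge_self])
  qed
  have "(\<integral>y. g y \<partial>M) * (\<integral>x. h x \<partial>M) = (\<integral>x. (\<integral>y. g y \<partial>M) * h x \<partial>M)"
    by simp
  also have "\<dots> = (\<integral>x. primitive M g x * h x + (\<integral>y. ?F x y \<partial>M) \<partial>M)"
  proof (rule Bochner_Integration.integral_cong[OF refl])
    fix x
    have "(\<integral>y. g y \<partial>M) * h x = (\<integral>y. (halfstep x y *\<^sub>R g y) + (halfstep y x *\<^sub>R g y) \<partial>M) * h x"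
      by (simp add: halfstep_symmetry flip: scaleR_left.add)
    also have "\<dots> = primitive M g x * h x + (\<integral>y. halfstep y x *\<^sub>R g y \<partial>M) * h x"
    proof -
      have "integrable M (\<lambda>y. halfstep y x *\<^sub>R g y)"
        by (rule integrable_weighted[OF g]) (auto simp: halfstep_bounds)
      then show ?thesis
        using integrable_halfstep[OF g, of x] by (simp add: primitive_def distrib_right)
    qed
    also have "(\<integral>y. halfstep y x *\<^sub>R g y \<partial>M) * h x = (\<integral>y. ?F x y \<partial>M)"
      by (simp flip: integral_mult_left_zero)
    finally show "(\<integral>y. g y \<partial>M) * h x = primitive M g x * h x + (\<integral>y. ?F x y \<partial>M)" .
  qed
  also have "\<dots> = (\<integral>x. primitive M g x * h x \<partial>M) + (\<integral>x. (\<integral>y. ?F x y \<partial>M) \<partial>M)"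
    using integrable_fst[OF int] bdd[OF g h] by simp
  also have "(\<integral>x. (\<integral>y. ?F x y \<partial>M) \<partial>M) = (\<integral>y. (\<integral>x. ?F x y \<partial>M) \<partial>M)"
    using Fubini_integral[OF int] by simp
  also have "\<dots> = (\<integral>y. g y * primitive M h y \<partial>M)"
    by (simp add: primitive_def flip: integral_mult_right_zero)
  finally have "(\<integral>y. g y \<partial>M) * (\<integral>x. h x \<partial>M) =
      (\<integral>x. primitive M g x * h x \<partial>M) + (\<integral>y. g y * primitive M h y \<partial>M)" .
  moreover have "(\<integral>x. (\<eta> + primitive M g x) * h x \<partial>M) = \<eta> * (\<integral>x. h x \<partial>M) + (\<integral>x. primitive M g x * h x \<partial>M)"
    using h bdd[OF g h] by (simp add: distrib_right)
  moreover have "(\<integral>x. g x * (\<zeta> + primitive M h x) \<partial>M) = (\<integral>x. g x \<partial>M) * \<zeta> + (\<integral>x. g x * primitive M h x \<partial>M)"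
    using g bdd[OF h g] by (simp add: distrib_left mult.commute)
  ultimately show ?thesis
    by (simp add: algebra_simps)
qed

lemma tendsto_integral_weights:
  fixes a :: "real \<Rightarrow> real \<Rightarrow> real" and g :: "real \<Rightarrow> complex"
  assumes g: "integrable M g"
    and a: "\<And>x. a x \<in> borel_measurable borel" "\<And>x y. \<bar>a x y\<bar> \<le> 1"
    and l: "l \<in> borel_measurable borel"
    and lim: "\<And>y. ((\<lambda>x. a x y) \<longlongrightarrow> l y) (at z within T)"
  shows "((\<lambda>x. \<integral>y. a x y *\<^sub>R g y \<partial>M) \<longlongrightarrow> (\<integral>y. l y *\<^sub>R g y \<partial>M)) (at z within T)"
  unfolding tendsto_at_iff_sequentially
proof (intro allI impI)
  fix X assume X: "\<forall>i. X i \<in> T - {z}" "X \<longlonglongrightarrow> z"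
  have "(\<lambda>i. \<integral>y. a (X i) y *\<^sub>R g y \<partial>M) \<longlonglongrightarrow> (\<integral>y. l y *\<^sub>R g y \<partial>M)"
  proof (rule integral_dominated_convergence)
    show "integrable M (\<lambda>y. norm (g y))" using g by simp
    have "(\<lambda>i. a (X i) y) \<longlonglongrightarrow> l y" for y
      using lim[of y] X unfolding tendsto_at_iff_sequentially by (auto simp: o_def)
    then show "AE y in M. (\<lambda>i. a (X i) y *\<^sub>R g y) \<longlonglongrightarrow> l y *\<^sub>R g y"
      by (auto intro!: tendsto_intros)
    show "AE y in M. norm (a (X i) y *\<^sub>R g y) \<le> norm (g y)" for i
      using a(2) by (intro AE_I2) (simp add: mult_left_le_one_le)
  qed (use g a(1) l in measurable)
  then show "((\<lambda>x. \<integral>y. a x y *\<^sub>R g y \<partial>M) \<circ> X) \<longlonglongrightarrow> (\<integral>y. l y *\<^sub>R g y \<partial>M)"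
    by (simp add: o_def)
qed

lemma halfstep_tendsto_right: "((\<lambda>x. halfstep x y) \<longlongrightarrow> indicator {..z} y) (at_right z)"
proof (rule tendsto_eventually)
  show "\<forall>\<^sub>F x in at_right z. halfstep x y = indicator {..z} y"
  proof (cases "y \<le> z")
    case True
    then show ?thesis
      by (auto simp: eventually_at_right_field halfstep_def intro!: exI[of _ "z + 1"])
  next
    case False
    then show ?thesis
      by (auto simp: eventually_at_right_field halfstep_def intro!: exI[of _ y])
  qed
qed

lemma halfstep_tendsto_left: "((\<lambda>x. halfstep x y) \<longlongrightarrow> indicator {..<z} y) (at_left z)"
proof (rule tendsto_eventually)
  show "\<forall>\<^sub>F x in at_left z. halfstep x y = indicator {..<z} y"
  proof (cases "y < z")
    case True
    then show ?thesis
      by (auto simp: eventually_at_left_field halfstep_def intro!: exI[of _ y])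
  next
    case False
    then show ?thesis
      by (auto simp: eventually_at_left_field halfstep_def intro!: exI[of _ "z - 1"])
  qed
qed

lemma primitive_tendsto:
  assumes "integrable M g"
  shows "(primitive M g \<longlongrightarrow> (\<integral>y. indicator {..z} y *\<^sub>R g y \<partial>M)) (at_right z)"
    and "(primitive M g \<longlongrightarrow> (\<integral>y. indicator {..<z} y *\<^sub>R g y \<partial>M)) (at_left z)"
  unfolding primitive_def[abs_def]
  by (rule tendsto_integral_weights[OF assms];
      auto simp: halfstep_bounds
        intro: halfstep_tendsto_right halfstep_tendsto_left)+

lemma primitive_average:
  assumes "integrable M g"
  shows "primitive M g x =
    (1/2) *\<^sub>R ((\<integral>y. indicator {..<x} y *\<^sub>R g y \<partial>M) + (\<integral>y. indicator {..x} y *\<^sub>R g y \<partial>M))"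
proof -
  have "integrable M (\<lambda>y. indicator A y *\<^sub>R g y)" if "A \<in> sets borel" for A
    using assms that by (intro integrable_mult_indicator) (simp_all add: sets_borel)
  then have "(\<integral>y. indicator {..<x} y *\<^sub>R g y \<partial>M) + (\<integral>y. indicator {..x} y *\<^sub>R g y \<partial>M)
      = (\<integral>y. indicator {..<x} y *\<^sub>R g y + indicator {..x} y *\<^sub>R g y \<partial>M)"
    by simp
  also have "\<dots> = (\<integral>y. 2 *\<^sub>R (halfstep x y *\<^sub>R g y) \<partial>M)"
    by (intro Bochner_Integration.integral_cong) (auto simp: halfstep_def indicator_def scaleR_2)
  also have "\<dots> = 2 *\<^sub>R primitive M g x"
    unfolding primitive_def by (rule integral_scaleR_right)
  finally show ?thesis by simp
qed

end

section \<open>Hermitian and non-negative densities of the coefficients\<close>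

lemma hermitian_iff: "hermitian A \<longleftrightarrow> (\<forall>i j. A $ i $ j = cnj (A $ j $ i))"
  unfolding hermitian_def conj_transpose_def vec_eq_iff vec_lambda_beta by metis

definition sesquilinear_form :: "complex^2^2 \<Rightarrow> complex^2 \<Rightarrow> complex^2 \<Rightarrow> complex" where
  "sesquilinear_form A x y = (\<Sum>i\<in>UNIV. \<Sum>j\<in>UNIV. cnj (x $ i) * A $ i $ j * y $ j)"

abbreviation quadratic_form :: "complex^2^2 \<Rightarrow> complex^2 \<Rightarrow> complex" where
  "quadratic_form A v \<equiv> sesquilinear_form A v v"

lemma nonneg_matrix_iff: "nonneg_matrix A \<longleftrightarrow> hermitian A \<and> (\<forall>v. 0 \<le> Re (quadratic_form A v))"
  by (simp add: nonneg_matrix_def sesquilinear_form_def matrix_vector_mult_def sum_distrib_left mult.assoc)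

text \<open>
  The data of the equation on an initial interval \<open>(0,c)\<close>: one finite measure and densities that
  are Hermitian, respectively non-negative, at every point.
\<close>
locale hermitian_system = finite_borel_measure M for M :: "real measure" +
  fixes b :: ereal and c :: real and q w :: "real set \<Rightarrow> complex^2^2"
    and Q W :: "real \<Rightarrow> complex^2^2"
  assumes c_in: "c \<in> ivl b"
    and density_q: "\<And>i j. has_density M {0<..<c} (\<lambda>E. q E $ i $ j) (\<lambda>x. Q x $ i $ j)"
    and density_w: "\<And>i j. has_density M {0<..<c} (\<lambda>E. w E $ i $ j) (\<lambda>x. W x $ i $ j)"
    and hermitian_Q: "\<And>x. hermitian (Q x)"
    and nonneg_W: "\<And>x. nonneg_matrix (W x)"

lemma local_borel_initial:
  assumes "c \<in> ivl b" "0 < s" "E \<in> sets borel" "E \<subseteq> {s..c}"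
  shows "E \<in> local_borel b"
  unfolding local_borel_def
proof (intro CollectI conjI exI[of _ "{s..c}"])
  have "ereal x < b" if "x \<le> c" for x
    using assms(1) that le_less_trans[of "ereal x" "ereal c" b] by (auto simp: ivl_def)
  then show "{s..c} \<subseteq> ivl b"
    using assms(2) by (auto simp: ivl_def)
qed (use assms in auto)

text \<open>
  The coefficients are known to be Hermitian and non-negative only on compact subsets of \<open>(0,b)\<close>;
  the regular endpoint \<open>0\<close> is reached by exhaustion.
\<close>
lemma AE_from_compact_parts:
  assumes "\<And>n :: nat. AE x in M. x \<in> {inverse (real (Suc n))..<c} \<longrightarrow> P x"
  shows "AE x in M. x \<in> {0<..<c} \<longrightarrow> P x"
proof -
  have "AE x in M. \<forall>n :: nat. x \<in> {inverse (real (Suc n))..<c} \<longrightarrow> P x"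
    by (rule AE_all_countable[THEN iffD2]) (intro allI assms)
  then show ?thesis
  proof eventually_elim
    case (elim x)
    then show ?case
      using reals_Archimedean[of x] by (metis atLeastLessThan_iff greaterThanLessThan_iff less_imp_le)
  qed
qed

context finite_borel_measure
begin

lemma AE_hermitian_density:
  fixes Q :: "real \<Rightarrow> complex^2^2"
  assumes c: "c \<in> ivl b" and herm: "hermitian_measure b q"
    and dens: "\<And>i j. has_density M {0<..<c} (\<lambda>E. q E $ i $ j) (\<lambda>x. Q x $ i $ j)"
  shows "AE x in M. hermitian (Q x)"
proof -
  have int: "integrable M (\<lambda>x. Q x $ i $ j)" for i j
    using has_density_integrable[OF dens] .
  have "AE x in M. x \<in> {0<..<c} \<longrightarrow> Q x $ i $ j = cnj (Q x $ j $ i)" for i j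
  proof (rule AE_from_compact_parts)
    fix n :: nat
    let ?E = "{inverse (real (Suc n))..<c}"
    let ?f = "\<lambda>x. indicator ?E x *\<^sub>R (Q x $ i $ j - cnj (Q x $ j $ i))"
    have "AE x in M. ?f x = 0"
    proof (rule density_zero)
      show "integrable M ?f"
        using int by (intro integrable_mult_indicator) (auto simp: sets_borel)
      fix A assume A: "A \<in> sets M"
      let ?B = "A \<inter> ?E"
      have B: "?B \<in> sets borel" "?B \<subseteq> {0<..<c}"
        using A by (auto simp: sets_borel less_le_trans[OF positive_imp_inverse_positive[of "real (Suc n)"]])
      have intB: "integrable M (\<lambda>x. indicator ?B x *\<^sub>R Q x $ i $ j)" for i j
        using int B by (intro integrable_mult_indicator) (auto simp: sets_borel)
      have "q ?B \<in> Collect hermitian"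
      proof -
        have "?B \<in> local_borel b"
          by (rule local_borel_initial[OF c _ B(1), of "inverse (real (Suc n))"]) auto
        then show ?thesis
          using herm by (auto simp only: hermitian_measure_def)
      qed
      then have "q ?B $ i $ j = cnj (q ?B $ j $ i)"
        using hermitian_iff by blast
      then have eq: "(\<integral>x. indicator ?B x *\<^sub>R Q x $ i $ j \<partial>M) = cnj (\<integral>x. indicator ?B x *\<^sub>R Q x $ j $ i \<partial>M)"
        unfolding has_density_measure[OF dens B] .
      have "set_lebesgue_integral M A ?f
          = (\<integral>x. indicator ?B x *\<^sub>R Q x $ i $ j - cnj (indicator ?B x *\<^sub>R Q x $ j $ i) \<partial>M)"
        unfolding set_lebesgue_integral_def
        by (intro Bochner_Integration.integral_cong) (auto simp: indicator_def)
      also have "\<dots> = (\<integral>x. indicator ?B x *\<^sub>R Q x $ i $ j \<partial>M) - (\<integral>x. cnj (indicator ?B x *\<^sub>R Q x $ j $ i) \<partial>M)"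
        using intB by (intro Bochner_Integration.integral_diff) (simp_all del: complex_cnj_scaleR)
      also have "\<dots> = 0"
        using eq by (simp del: complex_cnj_scaleR)
      finally show "set_lebesgue_integral M A ?f = 0" .
    qed
    then show "AE x in M. x \<in> ?E \<longrightarrow> Q x $ i $ j = cnj (Q x $ j $ i)"
      by eventually_elim auto
  qed
  then have "AE x in M. \<forall>i j. x \<in> {0<..<c} \<longrightarrow> Q x $ i $ j = cnj (Q x $ j $ i)"
    unfolding AE_all_countable by blast
  then show ?thesis
  proof eventually_elim
    case (elim x)
    then show ?case
      unfolding hermitian_iff using has_density_outside[OF dens, of x] by (metis complex_cnj_zero)
  qed
qed

text \<open>
  For a fixed vector \<open>v\<close> the form \<open>v\<^sup>* W v\<close> is non-negative almost everywhere.  The exceptional sets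
  of countably many dense \<open>v\<close> are removed together, and continuity in \<open>v\<close> gives the rest.
\<close>
lemma AE_nonneg_density:
  fixes W :: "real \<Rightarrow> complex^2^2"
  assumes c: "c \<in> ivl b" and nonneg: "nonneg_measure b w"
    and dens: "\<And>i j. has_density M {0<..<c} (\<lambda>E. w E $ i $ j) (\<lambda>x. W x $ i $ j)"
  shows "AE x in M. nonneg_matrix (W x)"
proof -
  have int: "integrable M (\<lambda>x. W x $ i $ j)" for i j
    using has_density_integrable[OF dens] .
  have "AE x in M. x \<in> {0<..<c} \<longrightarrow> 0 \<le> Re (quadratic_form (W x) v)" for v
  proof (rule AE_from_compact_parts)
    fix n :: nat
    let ?E = "{inverse (real (Suc n))..<c}"
    let ?f = "\<lambda>x. indicator ?E x *\<^sub>R Re (quadratic_form (W x) v)"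
    have intq: "integrable M (\<lambda>x. quadratic_form (W x) v)"
      unfolding sesquilinear_form_def using int by simp
    have "AE x in M. 0 \<le> ?f x"
    proof (rule density_nonneg)
      show "integrable M ?f"
        using intq by (intro integrable_mult_indicator) (auto simp: sets_borel)
      fix A assume A: "A \<in> sets M"
      let ?B = "A \<inter> ?E"
      have B: "?B \<in> sets borel" "?B \<subseteq> {0<..<c}"
        using A by (auto simp: sets_borel less_le_trans[OF positive_imp_inverse_positive[of "real (Suc n)"]])
      have intB: "integrable M (\<lambda>x. indicator ?B x *\<^sub>R W x $ i $ j)" for i j
        using int B by (intro integrable_mult_indicator) (auto simp: sets_borel)
      have "w ?B \<in> Collect nonneg_matrix"
      proof -
        have "?B \<in> local_borel b"
          by (rule local_borel_initial[OF c _ B(1), of "inverse (real (Suc n))"]) auto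
        then show ?thesis
          using nonneg by (auto simp only: nonneg_measure_def)
      qed
      then have "0 \<le> Re (quadratic_form (w ?B) v)"
        by (auto simp: nonneg_matrix_iff)
      also have "quadratic_form (w ?B) v = (\<Sum>i\<in>UNIV. \<Sum>j\<in>UNIV.
          \<integral>x. cnj (v $ i) * (indicator ?B x *\<^sub>R W x $ i $ j) * v $ j \<partial>M)"
        unfolding sesquilinear_form_def has_density_measure[OF dens B]
        by (simp del: mult_scaleR_right mult_scaleR_left)
      also have "\<dots> = (\<integral>x. (\<Sum>i\<in>UNIV. \<Sum>j\<in>UNIV.
          cnj (v $ i) * (indicator ?B x *\<^sub>R W x $ i $ j) * v $ j) \<partial>M)"
        using intB by (simp del: mult_scaleR_right mult_scaleR_left)
      also have "\<dots> = (\<integral>x. indicator ?B x *\<^sub>R quadratic_form (W x) v \<partial>M)"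
        by (simp add: sesquilinear_form_def scaleR_sum_right)
      also have "Re \<dots> = (\<integral>x. Re (indicator ?B x *\<^sub>R quadratic_form (W x) v) \<partial>M)"
        using intq B by (intro integral_Re[symmetric] integrable_mult_indicator) (auto simp: sets_borel)
      also have "\<dots> = set_lebesgue_integral M A ?f"
        unfolding set_lebesgue_integral_def
        by (intro Bochner_Integration.integral_cong) (auto simp: indicator_def)
      finally show "0 \<le> set_lebesgue_integral M A ?f" .
    qed
    then show "AE x in M. x \<in> ?E \<longrightarrow> 0 \<le> Re (quadratic_form (W x) v)"
      by eventually_elim (auto simp: indicator_def split: if_splits)
  qed
  moreover obtain D :: "(complex^2) set" where D: "countable D"
      "\<And>X. open X \<Longrightarrow> X \<noteq> {} \<Longrightarrow> \<exists>d\<in>D. d \<in> X"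
    using countable_dense_exists by blast
  ultimately have "AE x in M. \<forall>v\<in>D. x \<in> {0<..<c} \<longrightarrow> 0 \<le> Re (quadratic_form (W x) v)"
    by (subst AE_ball_countable) auto
  moreover have "AE x in M. hermitian (W x)"
  proof (rule AE_hermitian_density[OF c _ dens])
    show "hermitian_measure b w"
      using nonneg by (auto simp: nonneg_measure_def nonneg_matrix_def hermitian_measure_def)
  qed
  ultimately show ?thesis
  proof eventually_elim
    fix x assume x: "hermitian (W x)" "\<forall>v\<in>D. x \<in> {0<..<c} \<longrightarrow> 0 \<le> Re (quadratic_form (W x) v)"
    have "0 \<le> Re (quadratic_form (W x) v)" for v
    proof (cases "x \<in> {0<..<c}")
      case True
      have "open {v. Re (quadratic_form (W x) v) < 0}"
        unfolding sesquilinear_form_def by (intro open_Collect_less continuous_intros)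
      then have "{v. Re (quadratic_form (W x) v) < 0} = {}"
        using D(2)[of "{v. Re (quadratic_form (W x) v) < 0}"] x(2) True by (metis linorder_not_le mem_Collect_eq)
      then show ?thesis
        by (auto simp: not_less)
    next
      case False
      then show ?thesis
        using has_density_outside[OF dens, of x] by (simp add: sesquilinear_form_def)
    qed
    then show "nonneg_matrix (W x)"
      using x(1) by (simp add: nonneg_matrix_iff)
  qed
qed

end

lemma hermitian_system_exists:
  assumes c: "c \<in> ivl b" and q: "hermitian_measure b q" "regular_at_0 b q"
    and w: "nonneg_measure b w" "regular_at_0 b w"
  shows "\<exists>M Q W. hermitian_system M b c q w Q W"
proof -
  let ?S = "{0<..<c}"
  define \<mu> where "\<mu> = (\<lambda>(p, i, j) E. if p then q E $ i $ j else w E $ i $ j)"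
  have \<mu>: "\<mu> (True, i, j) = (\<lambda>E. q E $ i $ j)" "\<mu> (False, i, j) = (\<lambda>E. w E $ i $ j)" for i j
    by (auto simp: \<mu>_def)
  have "\<exists>M h. finite_measure M \<and> sets M = sets borel \<and> (\<forall>k\<in>UNIV. has_density M ?S (\<mu> k) (h k))"
  proof (rule has_density_exists)
    fix k :: "bool \<times> 2 \<times> 2"
    obtain p i j where "k = (p, i, j)" by (cases k)
    then show "complex_measure_on ?S (\<mu> k)"
      using q w c by (cases p) (auto simp: \<mu> regular_at_0_def)
  qed auto
  then obtain M h where M: "finite_measure M" "sets M = sets borel" and h: "\<And>k. has_density M ?S (\<mu> k) (h k)"
    by auto
  interpret finite_borel_measure M
    using M by (simp add: finite_borel_measure_def finite_borel_measure_axioms_def)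
  define Q W :: "real \<Rightarrow> complex^2^2" where "Q x = (\<chi> i j. h (True, i, j) x)" and "W x = (\<chi> i j. h (False, i, j) x)" for x
  have dQ: "has_density M ?S (\<lambda>E. q E $ i $ j) (\<lambda>x. Q x $ i $ j)" for i j
    using h[of "(True, i, j)"] by (simp add: Q_def \<mu>)
  have dW: "has_density M ?S (\<lambda>E. w E $ i $ j) (\<lambda>x. W x $ i $ j)" for i j
    using h[of "(False, i, j)"] by (simp add: W_def \<mu>)
  have "AE x in M. hermitian (Q x) \<and> nonneg_matrix (W x)"
    using AE_hermitian_density[OF c q(1) dQ] AE_nonneg_density[OF c w(1) dW] by eventually_elim simp
  then obtain N where N: "N \<in> null_sets M" "\<And>x. x \<notin> N \<Longrightarrow> hermitian (Q x) \<and> nonneg_matrix (W x)"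
    by (elim AE_E3) (auto simp: space_UNIV)
  have zero: "hermitian 0" "nonneg_matrix 0"
    by (simp_all add: nonneg_matrix_iff hermitian_iff sesquilinear_form_def)
  have if_nth: "(if P then 0 else A) $ i $ j = (if P then 0 else A $ i $ j)" for P and A :: "complex^2^2" and i j
    by simp
  have "hermitian_system M b c q w (\<lambda>x. if x \<in> N then 0 else Q x) (\<lambda>x. if x \<in> N then 0 else W x)"
  proof unfold_locales
    show "has_density M ?S (\<lambda>E. q E $ i $ j) (\<lambda>x. (if x \<in> N then 0 else Q x) $ i $ j)" for i j
      unfolding if_nth by (rule has_density_off_null_set[OF dQ M(2) N(1)])
    show "has_density M ?S (\<lambda>E. w E $ i $ j) (\<lambda>x. (if x \<in> N then 0 else W x) $ i $ j)" for i j
      unfolding if_nth by (rule has_density_off_null_set[OF dW M(2) N(1)])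
    show "hermitian (if x \<in> N then 0 else Q x)" "nonneg_matrix (if x \<in> N then 0 else W x)" for x
      using N(2)[of x] zero by simp_all
  qed (fact c)
  then show ?thesis by (intro exI)
qed

section \<open>Integral representation of solutions\<close>

text \<open>
  Boundedness and measurability on \<open>E\<close> alone, with arbitrary values elsewhere: these are the functions
  that can be integrated over \<open>E\<close> against the coefficients.
\<close>
definition tame_on :: "real set \<Rightarrow> (real \<Rightarrow> complex^2) \<Rightarrow> bool" where
  "tame_on E u \<longleftrightarrow> (\<forall>j. (\<lambda>x. indicator E x *\<^sub>R u x $ j) \<in> borel_measurable borel) \<and>
     (\<exists>B. \<forall>x\<in>E. norm (u x) \<le> B)"

lemma tame_on_subset:
  assumes "tame_on E u" "F \<subseteq> E" "F \<in> sets borel"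
  shows "tame_on F u"
  unfolding tame_on_def
proof (intro conjI allI)
  fix j
  have [measurable]: "(\<lambda>x. indicator E x *\<^sub>R u x $ j) \<in> borel_measurable borel" "F \<in> sets borel"
    using assms by (auto simp: tame_on_def)
  have "(\<lambda>x. indicator F x *\<^sub>R (indicator E x *\<^sub>R u x $ j)) \<in> borel_measurable borel"
    by measurable
  also have "(\<lambda>x. indicator F x *\<^sub>R (indicator E x *\<^sub>R u x $ j)) = (\<lambda>x. indicator F x *\<^sub>R u x $ j)"
    by (rule ext) (use assms(2) in \<open>auto simp: indicator_def\<close>)
  finally show "(\<lambda>x. indicator F x *\<^sub>R u x $ j) \<in> borel_measurable borel" .
qed (use assms in \<open>auto simp: tame_on_def\<close>)

lemma norm_vec2_le: "norm (v :: complex^2) \<le> norm (v $ 1) + norm (v $ 2)"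
  using L2_set_le_sum[of UNIV "\<lambda>i. norm (v $ i)"] by (simp add: norm_vec_def sum_2)

lemma tame_on_add:
  assumes "tame_on E u" "tame_on E v"
  shows "tame_on E (\<lambda>x. a *s u x + v x)"
  unfolding tame_on_def
proof (intro conjI allI)
  fix j
  have [measurable]: "(\<lambda>x. indicator E x *\<^sub>R u x $ j) \<in> borel_measurable borel"
      "(\<lambda>x. indicator E x *\<^sub>R v x $ j) \<in> borel_measurable borel"
    using assms by (auto simp: tame_on_def)
  have "(\<lambda>x. a * (indicator E x *\<^sub>R u x $ j) + indicator E x *\<^sub>R v x $ j) \<in> borel_measurable borel"
    by measurable
  then show "(\<lambda>x. indicator E x *\<^sub>R (a *s u x + v x) $ j) \<in> borel_measurable borel"
    by (simp add: scaleR_add_right)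
next
  obtain A where A: "\<And>x. x \<in> E \<Longrightarrow> norm (u x) \<le> A"
    using assms(1) by (auto simp: tame_on_def)
  obtain B where B: "\<And>x. x \<in> E \<Longrightarrow> norm (v x) \<le> B"
    using assms(2) by (auto simp: tame_on_def)
  have "norm (a *s u x + v x) \<le> 2 * (norm a * A + B)" if x: "x \<in> E" for x
  proof -
    have "norm ((a *s u x + v x) $ i) \<le> norm a * A + B" for i
    proof -
      have "norm ((a *s u x + v x) $ i) \<le> norm a * norm (u x $ i) + norm (v x $ i)"
        using norm_triangle_ineq[of "a * u x $ i" "v x $ i"] by (simp add: norm_mult)
      also have "\<dots> \<le> norm a * A + B"
        using A[OF x] B[OF x] by (intro add_mono mult_left_mono order_trans[OF Finite_Cartesian_Product.norm_nth_le]) auto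
      finally show ?thesis .
    qed
    then show ?thesis
      using norm_vec2_le[of "a *s u x + v x"] by (smt (verit))
  qed
  then show "\<exists>B. \<forall>x\<in>E. norm (a *s u x + v x) \<le> B" by blast
qed

text \<open>
  The derivative determines the jump \<open>u\<^sup>+(x) - u\<^sup>-(s)\<close> over \<open>[s,x]\<close> and the jump at \<open>x\<close>, hence both
  one-sided values at \<open>x\<close>.  Their mean is \<open>u(x)\<close>, and the mean of the integrals over \<open>(-\<infinity>,x)\<close> and
  \<open>(-\<infinity>,x]\<close> is the primitive.
\<close>
lemma (in finite_borel_measure) representation_from_derivative:
  assumes u: "is_derivative_measure b u \<nu>" "balanced b u" and st: "0 < s" "s \<le> x" "ereal x < b"
    and g: "integrable M g" "\<nu> {s..x} $ i = (\<integral>y. indicator {..x} y *\<^sub>R g y \<partial>M)"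
      "\<nu> {x} $ i = (\<integral>y. indicator {x} y *\<^sub>R g y \<partial>M)"
  shows "u x $ i = left_limit u s $ i + primitive M g x"
    and "left_limit u x $ i = left_limit u s $ i + (\<integral>y. indicator {..<x} y *\<^sub>R g y \<partial>M)"
proof -
  have jump: "\<nu> {s..x} = right_limit u x - left_limit u s" "\<nu> {x..x} = right_limit u x - left_limit u x"
    using u(1) st unfolding is_derivative_measure_def by (blast, metis order_refl order.strict_trans2)
  have int: "integrable M (\<lambda>y. indicator A y *\<^sub>R g y)" if "A \<in> sets borel" for A
    using g(1) that by (intro integrable_mult_indicator) (simp_all add: sets_borel)
  have "(\<integral>y. indicator {..x} y *\<^sub>R g y \<partial>M)
      = (\<integral>y. indicator {..<x} y *\<^sub>R g y + indicator {x} y *\<^sub>R g y \<partial>M)"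
    by (intro Bochner_Integration.integral_cong) (auto simp: indicator_def)
  also have "\<dots> = (\<integral>y. indicator {..<x} y *\<^sub>R g y \<partial>M) + (\<integral>y. indicator {x} y *\<^sub>R g y \<partial>M)"
    using int by (intro Bochner_Integration.integral_add) simp_all
  finally have split: "(\<integral>y. indicator {..x} y *\<^sub>R g y \<partial>M)
      = (\<integral>y. indicator {..<x} y *\<^sub>R g y \<partial>M) + (\<integral>y. indicator {x} y *\<^sub>R g y \<partial>M)" .
  have R: "right_limit u x $ i = left_limit u s $ i + (\<integral>y. indicator {..x} y *\<^sub>R g y \<partial>M)"
    using arg_cong[OF jump(1), of "\<lambda>v. v $ i"] g(2) by simp
  have "right_limit u x $ i - left_limit u x $ i = (\<integral>y. indicator {x} y *\<^sub>R g y \<partial>M)"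
    using jump(2) g(3) by simp
  then show L: "left_limit u x $ i = left_limit u s $ i + (\<integral>y. indicator {..<x} y *\<^sub>R g y \<partial>M)"
    using R split by (simp add: algebra_simps)
  have "x \<in> ivl b"
    using st by (simp add: ivl_def)
  then have "u x = (1/2) *\<^sub>R (left_limit u x + right_limit u x)"
    using u(2) by (simp add: balanced_def)
  then have "u x $ i = (1/2) *\<^sub>R (left_limit u x $ i + right_limit u x $ i)"
    by simp
  also have "\<dots> = (1/2) *\<^sub>R ((left_limit u s $ i + left_limit u s $ i) +
     ((\<integral>y. indicator {..<x} y *\<^sub>R g y \<partial>M) + (\<integral>y. indicator {..x} y *\<^sub>R g y \<partial>M)))"
    unfolding L R by (simp add: algebra_simps)
  also have "\<dots> = left_limit u s $ i + primitive M g x"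
    unfolding primitive_average[OF g(1)] scaleR_add_right
    by (simp flip: scaleR_add_right scaleR_2)
  finally show "u x $ i = left_limit u s $ i + primitive M g x" .
qed

text \<open>
  A density of the derivative measure itself represents \<open>u\<close> as a primitive, and primitives are
  bounded and measurable.  This must precede any use of the equation, whose integrals of \<open>q u\<close> and
  \<open>w u\<close> are meaningful only then.
\<close>
lemma balanced_tame_on_compact:
  assumes u: "is_derivative_measure b u \<nu>" "balanced b u" and st: "0 < s" "s \<le> t" "ereal t < b"
  shows "tame_on {s..t} u"
proof -
  have sub: "{s..t} \<subseteq> ivl b"
    using st le_less_trans[of _ "ereal t" b] by (auto simp: ivl_def)
  have "\<exists>M h. finite_measure M \<and> sets M = sets borel \<and> (\<forall>i\<in>UNIV. has_density M {s..t} (\<lambda>E. \<nu> E $ i) (h i))"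
    using u(1) sub by (intro has_density_exists) (auto simp: is_derivative_measure_def local_complex_measure_def)
  then obtain M h where M: "finite_measure M" "sets M = sets borel"
    and h: "\<And>i. has_density M {s..t} (\<lambda>E. \<nu> E $ i) (h i)" by auto
  interpret finite_borel_measure M
    using M by (simp add: finite_borel_measure_def finite_borel_measure_axioms_def)
  have rep: "u x $ i = left_limit u s $ i + primitive M (h i) x" if x: "x \<in> {s..t}" for x i
  proof (rule representation_from_derivative[OF u])
    show "ereal x < b"
      using x sub by (auto simp: ivl_def)
    show "integrable M (h i)"
      by (rule has_density_integrable[OF h])
    have "\<nu> {s..x} $ i = (\<integral>y. indicator {s..x} y *\<^sub>R h i y \<partial>M)"
      using x by (intro has_density_measure[OF h]) auto
    also have "\<dots> = (\<integral>y. indicator {..x} y *\<^sub>R h i y \<partial>M)"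
      using has_density_outside[OF h] by (intro Bochner_Integration.integral_cong) (auto simp: indicator_def)
    finally show "\<nu> {s..x} $ i = (\<integral>y. indicator {..x} y *\<^sub>R h i y \<partial>M)" .
    show "\<nu> {x} $ i = (\<integral>y. indicator {x} y *\<^sub>R h i y \<partial>M)"
      using x by (intro has_density_measure[OF h]) auto
  qed (use st x in auto)
  let ?B = "\<lambda>i. norm (left_limit u s $ i) + (\<integral>y. norm (h i y) \<partial>M)"
  show ?thesis
    unfolding tame_on_def
  proof (intro conjI allI)
    fix j
    have "primitive M (h j) \<in> borel_measurable borel"
      by (rule primitive_measurable) (rule has_density_integrable[OF h])
    then have "(\<lambda>x. indicator {s..t} x *\<^sub>R (left_limit u s $ j + primitive M (h j) x)) \<in> borel_measurable borel"
      by measurable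
    then show "(\<lambda>x. indicator {s..t} x *\<^sub>R u x $ j) \<in> borel_measurable borel"
      by (rule measurable_cong[THEN iffD1, rotated]) (auto simp: indicator_def rep)
  next
    have "norm (u x $ i) \<le> ?B i" if "x \<in> {s..t}" for x i
      unfolding rep[OF that]
      using norm_primitive_le[OF has_density_integrable[OF h]]
      by (intro order_trans[OF norm_triangle_ineq] add_left_mono)
    then have "norm (u x) \<le> ?B 1 + ?B 2" if "x \<in> {s..t}" for x
      using that by (intro order_trans[OF norm_vec2_le] add_mono)
    then show "\<exists>B. \<forall>x\<in>{s..t}. norm (u x) \<le> B" by blast
  qed
qed

context hermitian_system
begin

text \<open>
  The flux is \<open>(\<lambda> W - Q) u\<close>, the density of \<open>J u'\<close>; multiplying by \<open>J\<^sup>-\<^sup>1\<close> gives the drive, the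
  density of \<open>u'\<close>.  The function \<open>weight\<close> bounds all coefficients at once.
\<close>
definition flux :: "complex \<Rightarrow> (real \<Rightarrow> complex^2) \<Rightarrow> real \<Rightarrow> 2 \<Rightarrow> complex" where
  "flux lam u y i = (\<Sum>j\<in>UNIV. (lam * W y $ i $ j - Q y $ i $ j) * u y $ j)"

definition drive :: "complex \<Rightarrow> (real \<Rightarrow> complex^2) \<Rightarrow> 2 \<Rightarrow> real \<Rightarrow> complex" where
  "drive lam u i y = (if i = 1 then flux lam u y 2 else - flux lam u y 1)"

definition weight :: "real \<Rightarrow> real" where
  "weight y = (\<Sum>i\<in>UNIV. \<Sum>j\<in>UNIV. norm (Q y $ i $ j) + norm (W y $ i $ j))"

lemma integrable_Q: "integrable M (\<lambda>x. Q x $ i $ j)"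
  and integrable_W: "integrable M (\<lambda>x. W x $ i $ j)"
  by (rule has_density_integrable, rule density_q density_w)+

lemma Q_outside: "x \<notin> {0<..<c} \<Longrightarrow> Q x $ i $ j = 0"
  and W_outside: "x \<notin> {0<..<c} \<Longrightarrow> W x $ i $ j = 0"
  by (rule has_density_outside, rule density_q density_w, assumption)+

lemma weight_nonneg: "0 \<le> weight y"
  unfolding weight_def by (intro sum_nonneg) auto

lemma integrable_weight: "integrable M weight"
  unfolding weight_def[abs_def] using integrable_Q integrable_W by simp

lemma drive_outside: "x \<notin> {0<..<c} \<Longrightarrow> drive lam u i x = 0"
  by (simp add: drive_def flux_def Q_outside W_outside)

lemma norm_drive_le: "norm (drive lam u i y) \<le> (norm lam + 1) * weight y * norm (u y)"
proof -
  have "norm (flux lam u y i) \<le> (norm lam + 1) * weight y * norm (u y)" for i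
  proof -
    let ?k = "\<lambda>i j. norm (Q y $ i $ j) + norm (W y $ i $ j)"
    have "norm (flux lam u y i) \<le> (\<Sum>j\<in>UNIV. norm ((lam * W y $ i $ j - Q y $ i $ j) * u y $ j))"
      unfolding flux_def by (rule norm_sum)
    also have "\<dots> \<le> (\<Sum>j\<in>UNIV. (norm lam + 1) * ?k i j * norm (u y))"
    proof (rule sum_mono)
      fix j
      have "norm (lam * W y $ i $ j - Q y $ i $ j) \<le> norm lam * norm (W y $ i $ j) + norm (Q y $ i $ j)"
        using norm_triangle_ineq4[of "lam * W y $ i $ j" "Q y $ i $ j"] by (simp add: norm_mult)
      also have "\<dots> \<le> (norm lam + 1) * ?k i j"
        by (simp add: algebra_simps)
      finally show "norm ((lam * W y $ i $ j - Q y $ i $ j) * u y $ j) \<le> (norm lam + 1) * ?k i j * norm (u y)"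
        unfolding norm_mult by (intro mult_mono Finite_Cartesian_Product.norm_nth_le) auto
    qed
    also have "\<dots> = (norm lam + 1) * (\<Sum>j\<in>UNIV. ?k i j) * norm (u y)"
      by (simp add: sum_distrib_left sum_distrib_right)
    also have "\<dots> \<le> (norm lam + 1) * weight y * norm (u y)"
      unfolding weight_def
      by (intro mult_right_mono mult_left_mono member_le_sum[of i UNIV "\<lambda>i. \<Sum>j\<in>UNIV. ?k i j"] sum_nonneg) auto
    finally show ?thesis .
  qed
  then show ?thesis
    by (simp add: drive_def)
qed

lemma integrable_against_tame:
  assumes u: "tame_on E u"
  shows "integrable M (\<lambda>x. indicator E x *\<^sub>R (Q x $ i $ j * u x $ k))"
    and "integrable M (\<lambda>x. indicator E x *\<^sub>R (W x $ i $ j * u x $ k))"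
proof -
  obtain B where B: "\<And>x. x \<in> E \<Longrightarrow> norm (u x) \<le> B"
    using u by (auto simp: tame_on_def)
  then have B: "\<And>x. x \<in> E \<Longrightarrow> norm (u x $ k) \<le> B" for k
    using Finite_Cartesian_Product.norm_nth_le order_trans by blast
  show "integrable M (\<lambda>x. indicator E x *\<^sub>R (Q x $ i $ j * u x $ k))"
    using u B by (intro integrable_mult_bounded_on[OF integrable_Q sets_borel]) (auto simp: tame_on_def)
  show "integrable M (\<lambda>x. indicator E x *\<^sub>R (W x $ i $ j * u x $ k))"
    using u B by (intro integrable_mult_bounded_on[OF integrable_W sets_borel]) (auto simp: tame_on_def)
qed

lemma measure_times_density:
  assumes E: "E \<in> sets borel" "E \<subseteq> {0<..<c}" and u: "tame_on E u"
  shows "measure_times q u E $ i = (\<integral>x. indicator E x *\<^sub>R (\<Sum>j\<in>UNIV. Q x $ i $ j * u x $ j) \<partial>M)"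
    and "measure_times w u E $ i = (\<integral>x. indicator E x *\<^sub>R (\<Sum>j\<in>UNIV. W x $ i $ j * u x $ j) \<partial>M)"
proof -
  obtain B where B: "\<And>x. x \<in> E \<Longrightarrow> norm (u x) \<le> B"
    using u by (auto simp: tame_on_def)
  then have B: "\<And>x. x \<in> E \<Longrightarrow> norm (u x $ k) \<le> B" for k
    using Finite_Cartesian_Product.norm_nth_le order_trans by blast
  have m: "(\<lambda>x. indicator E x *\<^sub>R u x $ j) \<in> borel_measurable borel" for j
    using u by (simp add: tame_on_def)
  have "measure_times q u E $ i = (\<Sum>j\<in>UNIV. \<integral>x. indicator E x *\<^sub>R (Q x $ i $ j * u x $ j) \<partial>M)"
    unfolding measure_times_def vec_lambda_beta
    by (intro sum.cong refl has_density_integral[OF density_q E m B])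
  also have "\<dots> = (\<integral>x. (\<Sum>j\<in>UNIV. indicator E x *\<^sub>R (Q x $ i $ j * u x $ j)) \<partial>M)"
    by (rule Bochner_Integration.integral_sum[symmetric]) (rule integrable_against_tame[OF u])
  finally show "measure_times q u E $ i = (\<integral>x. indicator E x *\<^sub>R (\<Sum>j\<in>UNIV. Q x $ i $ j * u x $ j) \<partial>M)"
    by (simp only: scaleR_sum_right)
  have "measure_times w u E $ i = (\<Sum>j\<in>UNIV. \<integral>x. indicator E x *\<^sub>R (W x $ i $ j * u x $ j) \<partial>M)"
    unfolding measure_times_def vec_lambda_beta
    by (intro sum.cong refl has_density_integral[OF density_w E m B])
  also have "\<dots> = (\<integral>x. (\<Sum>j\<in>UNIV. indicator E x *\<^sub>R (W x $ i $ j * u x $ j)) \<partial>M)"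
    by (rule Bochner_Integration.integral_sum[symmetric]) (rule integrable_against_tame[OF u])
  finally show "measure_times w u E $ i = (\<integral>x. indicator E x *\<^sub>R (\<Sum>j\<in>UNIV. W x $ i $ j * u x $ j) \<partial>M)"
    by (simp only: scaleR_sum_right)
qed

lemma integrable_drive_on:
  assumes u: "tame_on E u"
  shows "integrable M (\<lambda>x. indicator E x *\<^sub>R drive lam u i x)"
proof -
  have "integrable M (\<lambda>x. indicator E x *\<^sub>R flux lam u x k)" for k
  proof -
    have "integrable M (\<lambda>x. \<Sum>j\<in>UNIV. lam * (indicator E x *\<^sub>R (W x $ k $ j * u x $ j))
        - indicator E x *\<^sub>R (Q x $ k $ j * u x $ j))"
      by (intro Bochner_Integration.integrable_sum Bochner_Integration.integrable_diff
          integrable_mult_right integrable_against_tame[OF u])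
    also have "(\<lambda>x. \<Sum>j\<in>UNIV. lam * (indicator E x *\<^sub>R (W x $ k $ j * u x $ j))
        - indicator E x *\<^sub>R (Q x $ k $ j * u x $ j)) = (\<lambda>x. indicator E x *\<^sub>R flux lam u x k)"
      by (simp add: flux_def scaleR_sum_right algebra_simps fun_eq_iff)
    finally show ?thesis .
  qed
  then show ?thesis
    unfolding drive_def by (cases "i = 1") simp_all
qed

lemma derivative_density:
  assumes eq: "Jmat *v \<nu> E + measure_times q u E = lam *s measure_times w u E"
    and E: "E \<in> sets borel" "E \<subseteq> {0<..<c}" and u: "tame_on E u"
  shows "\<nu> E $ i = (\<integral>x. indicator E x *\<^sub>R drive lam u i x \<partial>M)"
proof -
  have int: "integrable M (\<lambda>x. indicator E x *\<^sub>R (\<Sum>j\<in>UNIV. W x $ k $ j * u x $ j))"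
      "integrable M (\<lambda>x. indicator E x *\<^sub>R (\<Sum>j\<in>UNIV. Q x $ k $ j * u x $ j))" for k
    unfolding scaleR_sum_right
    by (intro Bochner_Integration.integrable_sum integrable_against_tame[OF u])+
  have fluxE: "lam * (measure_times w u E $ k) - measure_times q u E $ k = (\<integral>x. indicator E x *\<^sub>R flux lam u x k \<partial>M)" for k
  proof -
    have "lam * (measure_times w u E $ k) - measure_times q u E $ k
        = (\<integral>x. lam * (indicator E x *\<^sub>R (\<Sum>j\<in>UNIV. W x $ k $ j * u x $ j))
            - indicator E x *\<^sub>R (\<Sum>j\<in>UNIV. Q x $ k $ j * u x $ j) \<partial>M)"
      unfolding measure_times_density[OF E u] integral_mult_right_zero[symmetric]
      by (intro Bochner_Integration.integral_diff[symmetric] int integrable_mult_right)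
    also have "\<dots> = (\<integral>x. indicator E x *\<^sub>R flux lam u x k \<partial>M)"
      by (intro Bochner_Integration.integral_cong)
        (simp_all add: flux_def indicator_def sum_distrib_left sum_subtractf algebra_simps)
    finally show ?thesis .
  qed
  have "- \<nu> E $ 2 + measure_times q u E $ 1 = lam * (measure_times w u E $ 1)"
    "\<nu> E $ 1 + measure_times q u E $ 2 = lam * (measure_times w u E $ 2)"
    using eq by (auto simp: vec_eq_iff forall_2 Jmat_def matrix_vector_mult_def sum_2)
  then have "\<nu> E $ 1 = lam * (measure_times w u E $ 2) - measure_times q u E $ 2"
    "\<nu> E $ 2 = - (lam * (measure_times w u E $ 1) - measure_times q u E $ 1)"
    by (auto simp: algebra_simps eq_neg_iff_add_eq_0 add_eq_0_iff)
  then show ?thesis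
    using exhaust_2[of i] by (auto simp: fluxE drive_def)
qed

text \<open>
  Where the coefficients have small total mass, \<open>u\<close> oscillates by at most half of its own supremum,
  so the supremum is controlled by any value \<open>a\<close> near \<open>u\<close>.  The two uses are \<open>a = u(y)\<close>, which bounds
  solutions near \<open>0\<close>, and \<open>a = 0\<close>, which gives uniqueness.
\<close>
lemma small_interval_estimate:
  assumes I: "I \<in> sets borel" and u: "tame_on I u"
    and small: "(norm lam + 1) * (\<integral>y. indicator I y * weight y \<partial>M) \<le> 1/4"
    and near: "\<And>x i. x \<in> I \<Longrightarrow> norm (u x $ i - a $ i) \<le> (\<integral>y. indicator I y * norm (drive lam u i y) \<partial>M)"
    and x: "x \<in> I"
  shows "norm (u x) \<le> 2 * norm a"
proof -
  let ?B = "SUP x\<in>I. norm (u x)"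
  have bdd: "bdd_above ((\<lambda>x. norm (u x)) ` I)"
    using u by (auto simp: tame_on_def bdd_above_def)
  have le_B: "norm (u y) \<le> ?B" if "y \<in> I" for y
    using cSUP_upper[OF that bdd] .
  have "?B \<ge> 0"
    using le_B[OF x] norm_ge_zero order_trans by blast
  have int: "(\<integral>y. indicator I y * norm (drive lam u i y) \<partial>M) \<le> 1/4 * ?B" for i
  proof -
    have "(\<integral>y. indicator I y * norm (drive lam u i y) \<partial>M)
        \<le> (\<integral>y. (norm lam + 1) * ?B * (indicator I y * weight y) \<partial>M)"
    proof (rule integral_mono)
      show "integrable M (\<lambda>y. indicator I y * norm (drive lam u i y))"
        using integrable_norm[OF integrable_drive_on[OF u, of lam i]] by simp
      show "integrable M (\<lambda>y. (norm lam + 1) * ?B * (indicator I y * weight y))"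
        using integrable_mult_indicator[OF _ integrable_weight, of I] I
        by (intro integrable_mult_right) (simp add: sets_borel)
      fix y
      show "indicator I y * norm (drive lam u i y) \<le> (norm lam + 1) * ?B * (indicator I y * weight y)"
      proof (cases "y \<in> I")
        case True
        have "norm (drive lam u i y) \<le> (norm lam + 1) * weight y * ?B"
          using le_B[OF True] weight_nonneg by (intro order_trans[OF norm_drive_le] mult_left_mono) auto
        then show ?thesis
          using True by (simp add: mult_ac)
      qed simp
    qed
    also have "\<dots> = (norm lam + 1) * (\<integral>y. indicator I y * weight y \<partial>M) * ?B"
      by simp
    also have "\<dots> \<le> 1/4 * ?B"
      using small \<open>?B \<ge> 0\<close> by (rule mult_right_mono)
    finally show ?thesis .
  qed
  have "norm (u y) \<le> norm a + 1/2 * ?B" if y: "y \<in> I" for y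
  proof -
    have "norm (u y - a) \<le> norm (u y $ 1 - a $ 1) + norm (u y $ 2 - a $ 2)"
      using norm_vec2_le[of "u y - a"] by simp
    also have "\<dots> \<le> 1/4 * ?B + 1/4 * ?B"
      by (intro add_mono order_trans[OF near[OF y] int])
    finally show ?thesis
      using norm_triangle_ineq2[of "u y" a] by linarith
  qed
  then have "?B \<le> norm a + 1/2 * ?B"
    using x by (intro cSUP_least) auto
  then show ?thesis
    using le_B[OF x] by linarith
qed

text \<open>
  The interval is open at \<open>x\<close>, which excludes a possible atom there; the intervals shrink to the
  empty set and \<open>weight\<close> is integrable.
\<close>
lemma weight_small_right:
  assumes "0 < e"
  shows "\<exists>d>x. \<forall>t\<le>d. (\<integral>y. indicator {x<..<t} y * weight y \<partial>M) < e"
proof -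
  have "((\<lambda>t. \<integral>y. indicator {x<..<t} y *\<^sub>R complex_of_real (weight y) \<partial>M)
      \<longlongrightarrow> (\<integral>y. 0 *\<^sub>R complex_of_real (weight y) \<partial>M)) (at_right x)"
  proof (rule tendsto_integral_weights)
    fix y
    show "((\<lambda>t. indicat_real {x<..<t} y) \<longlongrightarrow> 0) (at_right x)"
    proof (rule tendsto_eventually)
      show "\<forall>\<^sub>F t in at_right x. indicat_real {x<..<t} y = 0"
      proof (cases "x < y")
        case True
        then show ?thesis
          by (auto simp: eventually_at_right_field intro!: exI[of _ y])
      next
        case False
        then show ?thesis
          by (auto simp: eventually_at_right_field intro!: exI[of _ "x + 1"])
      qed
    qed
  qed (use integrable_weight in \<open>auto simp: indicator_def\<close>)
  then have "((\<lambda>t. norm (\<integral>y. indicator {x<..<t} y *\<^sub>R complex_of_real (weight y) \<partial>M)) \<longlongrightarrow> 0) (at_right x)"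
    by (simp add: tendsto_norm_zero_iff)
  moreover have "norm (\<integral>y. indicator {x<..<t} y *\<^sub>R complex_of_real (weight y) \<partial>M)
      = (\<integral>y. indicator {x<..<t} y * weight y \<partial>M)" for t
  proof -
    have "(\<integral>y. indicator {x<..<t} y *\<^sub>R complex_of_real (weight y) \<partial>M)
        = complex_of_real (\<integral>y. indicator {x<..<t} y * weight y \<partial>M)"
      by (simp add: scaleR_conv_of_real flip: of_real_mult)
    moreover have "0 \<le> (\<integral>y. indicator {x<..<t} y * weight y \<partial>M)"
      using weight_nonneg by (intro integral_nonneg_AE) auto
    ultimately show ?thesis by simp
  qed
  ultimately have "\<forall>\<^sub>F t in at_right x. (\<integral>y. indicator {x<..<t} y * weight y \<partial>M) < e"
    using assms by (auto dest: order_tendstoD(2))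
  then obtain d where d: "d > x" "\<And>t. x < t \<Longrightarrow> t < d \<Longrightarrow> (\<integral>y. indicator {x<..<t} y * weight y \<partial>M) < e"
    by (auto simp: eventually_at_right_field)
  have "(\<integral>y. indicator {x<..<t} y * weight y \<partial>M) < e" if "t \<le> (x + d) / 2" for t
  proof (cases "x < t")
    case True
    then show ?thesis
      using d that by simp
  next
    case False
    then show ?thesis
      using assms by simp
  qed
  then show ?thesis
    using d(1) by (intro exI[of _ "(x + d) / 2"]) auto
qed

end

lemma invertible_kernel:
  fixes A :: "complex^2^2"
  assumes "det A \<noteq> 0" "A *v x = 0"
  shows "x = 0"
proof -
  obtain B where "B ** A = mat 1"
    using assms(1) by (auto simp: invertible_det_nz[symmetric] invertible_def)
  then have "x = B *v (A *v x)"
    by (simp add: matrix_vector_mul_assoc)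
  then show ?thesis
    using assms(2) by simp
qed

lemma solution_tame_compact:
  assumes "is_solution b q w lam u" "0 < s" "ereal t < b"
  shows "tame_on {s..t} u"
proof (cases "s \<le> t")
  case True
  then show ?thesis
    using assms balanced_tame_on_compact unfolding is_solution_def by blast
next
  case False
  then show ?thesis
    by (simp add: tame_on_def)
qed

context hermitian_system
begin

lemma c_pos: "0 < c" and c_less: "ereal c < b"
  using c_in by (auto simp: ivl_def)

text \<open>The integral equation on \<open>(0,c)\<close>, with initial value \<open>\<eta>\<close> at the regular endpoint.\<close>
definition represents :: "complex \<Rightarrow> (real \<Rightarrow> complex^2) \<Rightarrow> complex^2 \<Rightarrow> bool" where
  "represents lam u \<eta> \<longleftrightarrow> tame_on {0<..<c} u \<and> (\<forall>i. integrable M (drive lam u i)) \<and>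
     (\<forall>x\<in>{0<..<c}. \<forall>i. u x $ i = \<eta> $ i + primitive M (drive lam u i) x)"

lemma integrable_drive:
  assumes "tame_on {0<..<c} u"
  shows "integrable M (drive lam u i)"
proof -
  have "(\<lambda>x. indicator {0<..<c} x *\<^sub>R drive lam u i x) = drive lam u i"
    using drive_outside by (auto simp: indicator_def fun_eq_iff)
  then show ?thesis
    using integrable_drive_on[OF assms, of lam i] by simp
qed

lemma solution_local_representation:
  assumes sol: "is_solution b q w lam u" and s: "0 < s" and x: "s \<le> x" "x < c"
  shows "u x $ i = left_limit u s $ i + primitive M (\<lambda>y. indicator {s..<c} y *\<^sub>R drive lam u i y) x"
    and "left_limit u x $ i = left_limit u s $ i
      + (\<integral>y. indicator {..<x} y *\<^sub>R (indicator {s..<c} y *\<^sub>R drive lam u i y) \<partial>M)"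
proof -
  obtain \<nu> where \<nu>: "is_derivative_measure b u \<nu>"
    and eq: "\<And>E. E \<in> local_borel b \<Longrightarrow> Jmat *v \<nu> E + measure_times q u E = lam *s measure_times w u E"
    using sol by (auto simp: is_solution_def)
  have bal: "balanced b u"
    using sol by (simp add: is_solution_def)
  have tame: "tame_on {s..c} u"
    using solution_tame_compact[OF sol s c_less] .
  let ?g = "\<lambda>y. indicator {s..<c} y *\<^sub>R drive lam u i y"
  have dens: "\<nu> E $ i = (\<integral>y. indicator E y *\<^sub>R drive lam u i y \<partial>M)"
    if E: "E \<in> sets borel" "E \<subseteq> {s..<c}" for E
  proof (rule derivative_density[OF eq])
    show "E \<in> local_borel b"
      using E by (intro local_borel_initial[OF c_in s]) auto
    show "tame_on E u"
      using E by (intro tame_on_subset[OF tame]) auto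
  qed (use E s in auto)
  have g: "integrable M ?g"
    by (rule integrable_drive_on, rule tame_on_subset[OF tame]) auto
  have "\<nu> {s..x} $ i = (\<integral>y. indicator {s..x} y *\<^sub>R drive lam u i y \<partial>M)"
    using x by (intro dens) auto
  also have "\<dots> = (\<integral>y. indicator {..x} y *\<^sub>R ?g y \<partial>M)"
    using x by (intro Bochner_Integration.integral_cong) (auto simp: indicator_def)
  finally have 1: "\<nu> {s..x} $ i = (\<integral>y. indicator {..x} y *\<^sub>R ?g y \<partial>M)" .
  have "\<nu> {x} $ i = (\<integral>y. indicator {x} y *\<^sub>R drive lam u i y \<partial>M)"
    using x by (intro dens) auto
  also have "\<dots> = (\<integral>y. indicator {x} y *\<^sub>R ?g y \<partial>M)"
    using x by (intro Bochner_Integration.integral_cong) (auto simp: indicator_def)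
  finally have 2: "\<nu> {x} $ i = (\<integral>y. indicator {x} y *\<^sub>R ?g y \<partial>M)" .
  have "ereal x < b"
    using x c_less less_trans[of "ereal x" "ereal c" b] by simp
  note rep = representation_from_derivative[OF \<nu> bal s x(1) this g 1 2]
  show "u x $ i = left_limit u s $ i + primitive M ?g x"
    by (rule rep(1))
  show "left_limit u x $ i = left_limit u s $ i + (\<integral>y. indicator {..<x} y *\<^sub>R ?g y \<partial>M)"
    by (rule rep(2))
qed

text \<open>
  On \<open>[x,t)\<close> with \<open>t\<close> small, \<open>u\<close> is bounded by twice its norm at the fixed point \<open>t/2\<close>, and this
  bound does not depend on \<open>x\<close>.
\<close>
lemma solution_bounded_near_0:
  assumes sol: "is_solution b q w lam u"
  shows "\<exists>t B. 0 < t \<and> t < c \<and> (\<forall>x\<in>{0<..t}. norm (u x) \<le> B)"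
proof -
  have pos: "0 < norm lam + 1"
    by (simp add: add_nonneg_pos)
  obtain d where d: "d > 0" "\<And>t. t \<le> d \<Longrightarrow> (\<integral>y. indicator {0<..<t} y * weight y \<partial>M) < 1 / (4 * (norm lam + 1))"
    using weight_small_right[of "1 / (4 * (norm lam + 1))" 0] pos by auto
  define t where "t = min d c"
  have t: "0 < t" "t \<le> c" "t \<le> d"
    using d(1) c_pos by (auto simp: t_def)
  have "norm (u x) \<le> 2 * norm (u (t/2))" if x: "x \<in> {0<..t/2}" for x
  proof (rule small_interval_estimate)
    let ?I = "{x..<t}"
    show tame: "tame_on ?I u"
      using x t by (intro tame_on_subset[OF solution_tame_compact[OF sol, of x c]]) (auto simp: c_less)
    have "(\<integral>y. indicator ?I y * weight y \<partial>M) \<le> (\<integral>y. indicator {0<..<t} y * weight y \<partial>M)"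
    proof (rule integral_mono)
      show "integrable M (\<lambda>y. indicator ?I y * weight y)" "integrable M (\<lambda>y. indicator {0<..<t} y * weight y)"
        using integrable_mult_indicator[OF _ integrable_weight] by (simp_all add: sets_borel)
    qed (use weight_nonneg x in \<open>auto simp: indicator_def\<close>)
    then have "(\<integral>y. indicator ?I y * weight y \<partial>M) \<le> 1 / (4 * (norm lam + 1))"
      using d(2)[OF t(3)] by simp
    then have "(norm lam + 1) * (\<integral>y. indicator ?I y * weight y \<partial>M) \<le> (norm lam + 1) * (1 / (4 * (norm lam + 1)))"
      using pos by (intro mult_left_mono) auto
    also have "\<dots> = 1 / 4"
      using pos by (simp add: divide_simps)
    finally show "(norm lam + 1) * (\<integral>y. indicator ?I y * weight y \<partial>M) \<le> 1 / 4" .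
    show "x \<in> ?I"
      using x t by auto
    fix z i assume z: "z \<in> ?I"
    let ?g = "\<lambda>y. indicator {x..<c} y *\<^sub>R drive lam u i y"
    have g: "integrable M ?g"
      by (rule integrable_drive_on, rule tame_on_subset[OF solution_tame_compact[OF sol, of x c]])
        (use x c_less in auto)
    have "u z $ i - u (t/2) $ i = primitive M ?g z - primitive M ?g (t/2)"
      using solution_local_representation(1)[OF sol, of x z i] solution_local_representation(1)[OF sol, of x "t/2" i] x z t
      by auto
    also have "\<dots> = (\<integral>y. halfstep z y *\<^sub>R ?g y - halfstep (t/2) y *\<^sub>R ?g y \<partial>M)"
      unfolding primitive_def by (intro Bochner_Integration.integral_diff[symmetric] integrable_halfstep g)
    finally have "norm (u z $ i - u (t/2) $ i) \<le> (\<integral>y. norm (halfstep z y *\<^sub>R ?g y - halfstep (t/2) y *\<^sub>R ?g y) \<partial>M)"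
      by simp
    also have "\<dots> \<le> (\<integral>y. indicator ?I y * norm (drive lam u i y) \<partial>M)"
    proof (rule integral_mono)
      show "integrable M (\<lambda>y. norm (halfstep z y *\<^sub>R ?g y - halfstep (t/2) y *\<^sub>R ?g y))"
        by (intro integrable_norm Bochner_Integration.integrable_diff integrable_halfstep g)
      show "integrable M (\<lambda>y. indicator ?I y * norm (drive lam u i y))"
        using integrable_norm[OF integrable_drive_on[OF tame, of lam i]] by simp
      fix y
      have "norm (halfstep z y *\<^sub>R ?g y - halfstep (t/2) y *\<^sub>R ?g y) = \<bar>halfstep z y - halfstep (t/2) y\<bar> * norm (?g y)"
        by (metis norm_scaleR scaleR_left_diff_distrib)
      also have "\<dots> \<le> indicator ?I y * norm (drive lam u i y)"
        using z x t by (auto simp: halfstep_def indicator_def intro: mult_left_le_one_le)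
      finally show "norm (halfstep z y *\<^sub>R ?g y - halfstep (t/2) y *\<^sub>R ?g y) \<le> indicator ?I y * norm (drive lam u i y)" .
    qed
    finally show "norm (u z $ i - u (t/2) $ i) \<le> (\<integral>y. indicator ?I y * norm (drive lam u i y) \<partial>M)" .
  qed auto
  then show ?thesis
    using t by (intro exI[of _ "t/2"] exI[of _ "2 * norm (u (t/2))"]) auto
qed

lemma solution_tame:
  assumes sol: "is_solution b q w lam u"
  shows "tame_on {0<..<c} u"
  unfolding tame_on_def
proof (intro conjI allI)
  fix j
  let ?f = "\<lambda>n x. indicator {inverse (real (Suc n))..<c} x *\<^sub>R u x $ j"
  have f: "?f n \<in> borel_measurable borel" for n
  proof -
    have "tame_on {inverse (real (Suc n))..c} u"
      by (rule solution_tame_compact[OF sol _ c_less]) simp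
    then have "tame_on {inverse (real (Suc n))..<c} u"
      by (rule tame_on_subset) auto
    then show ?thesis
      by (simp add: tame_on_def)
  qed
  show "(\<lambda>x. indicator {0<..<c} x *\<^sub>R u x $ j) \<in> borel_measurable borel"
  proof (rule borel_measurable_LIMSEQ_metric[OF f])
    fix x :: real
    show "(\<lambda>n. ?f n x) \<longlonglongrightarrow> indicator {0<..<c} x *\<^sub>R u x $ j"
    proof (cases "0 < x")
      case True
      have "\<forall>\<^sub>F n in sequentially. inverse (real (Suc n)) < x"
        using order_tendstoD(2)[OF LIMSEQ_inverse_real_of_nat True] .
      then have "\<forall>\<^sub>F n in sequentially. ?f n x = indicator {0<..<c} x *\<^sub>R u x $ j"
        by eventually_elim (use True in \<open>auto simp: indicator_def\<close>)
      then show ?thesis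
        by (rule tendsto_eventually)
    next
      case False
      then have f0: "(\<lambda>n. ?f n x) = (\<lambda>n. 0)"
        using less_le_trans[of 0 "inverse (real (Suc _))" x] by (auto simp: indicator_def fun_eq_iff)
      show ?thesis
        unfolding f0 using False by simp
    qed
  qed
next
  obtain t B where t: "0 < t" "t < c" "\<And>x. x \<in> {0<..t} \<Longrightarrow> norm (u x) \<le> B"
    using solution_bounded_near_0[OF sol] by blast
  obtain C where C: "\<And>x. x \<in> {t..c} \<Longrightarrow> norm (u x) \<le> C"
    using solution_tame_compact[OF sol t(1) c_less] unfolding tame_on_def by blast
  have "norm (u x) \<le> max B C" if "x \<in> {0<..<c}" for x
    using t(3)[of x] C[of x] that by (cases "x \<le> t") auto
  then show "\<exists>B. \<forall>x\<in>{0<..<c}. norm (u x) \<le> B" by blast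
qed

text \<open>
  The local representations start at \<open>s > 0\<close>.  Now that the drive is integrable down to \<open>0\<close>, the
  missing integral over \<open>(0,s)\<close> can be added and subtracted, and what remains of the left limit at
  \<open>s\<close> does not depend on \<open>s\<close>.  It is the initial value.
\<close>
lemma solution_represented:
  assumes sol: "is_solution b q w lam u"
  shows "\<exists>\<eta>. represents lam u \<eta>"
proof -
  let ?d = "drive lam u"
  have tame: "tame_on {0<..<c} u"
    by (rule solution_tame[OF sol])
  have int: "integrable M (?d i)" for i
    by (rule integrable_drive[OF tame])
  have intA: "integrable M (\<lambda>y. indicator A y *\<^sub>R ?d i y)" if "A \<in> sets borel" for A i
    using int that by (intro integrable_mult_indicator) (simp_all add: sets_borel)
  have split: "(\<integral>y. a y *\<^sub>R ?d i y \<partial>M) = (\<integral>y. indicator {..<s} y *\<^sub>R ?d i y \<partial>M)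
      + (\<integral>y. a y *\<^sub>R (indicator {s..<c} y *\<^sub>R ?d i y) \<partial>M)"
    if a: "\<And>y. y < s \<Longrightarrow> a y = 1" "a \<in> borel_measurable borel" "\<And>y. \<bar>a y\<bar> \<le> 1" for a :: "real \<Rightarrow> real" and s i
  proof -
    have "(\<integral>y. a y *\<^sub>R ?d i y \<partial>M) = (\<integral>y. indicator {..<s} y *\<^sub>R ?d i y + a y *\<^sub>R (indicator {s..<c} y *\<^sub>R ?d i y) \<partial>M)"
    proof (intro Bochner_Integration.integral_cong refl)
      fix y
      have "c \<le> y \<Longrightarrow> ?d i y = 0" by (rule drive_outside) simp
      then show "a y *\<^sub>R ?d i y = indicator {..<s} y *\<^sub>R ?d i y + a y *\<^sub>R (indicator {s..<c} y *\<^sub>R ?d i y)"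
        using a(1)[of y] by (cases "y < s"; cases "y < c") auto
    qed
    also have "\<dots> = (\<integral>y. indicator {..<s} y *\<^sub>R ?d i y \<partial>M) + (\<integral>y. a y *\<^sub>R (indicator {s..<c} y *\<^sub>R ?d i y) \<partial>M)"
      using a by (intro Bochner_Integration.integral_add integrable_weighted intA) auto
    finally show ?thesis .
  qed
  define e where "e s i = left_limit u s $ i - (\<integral>y. indicator {..<s} y *\<^sub>R ?d i y \<partial>M)" for s i
  have u: "u x $ i = e x i + primitive M (?d i) x" if x: "0 < x" "x < c" for x i
  proof -
    have "primitive M (?d i) x = (\<integral>y. indicator {..<x} y *\<^sub>R ?d i y \<partial>M)
        + primitive M (\<lambda>y. indicator {x..<c} y *\<^sub>R ?d i y) x"
      unfolding primitive_def by (rule split) (auto simp: halfstep_def halfstep_bounds)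
    then show ?thesis
      using solution_local_representation(1)[OF sol x(1) order_refl x(2), of i] by (simp add: e_def)
  qed
  have e_eq: "e x i = e s i" if "0 < s" "s \<le> x" "x < c" for s x i
  proof -
    have "(\<integral>y. indicator {..<x} y *\<^sub>R ?d i y \<partial>M) = (\<integral>y. indicator {..<s} y *\<^sub>R ?d i y \<partial>M)
        + (\<integral>y. indicator {..<x} y *\<^sub>R (indicator {s..<c} y *\<^sub>R ?d i y) \<partial>M)"
      using that by (intro split) (auto simp: indicator_def)
    then show ?thesis
      using solution_local_representation(2)[OF sol that, of i] by (simp add: e_def)
  qed
  have e_const: "e x i = e (c/2) i" if "0 < x" "x < c" for x i
    using e_eq[of x "c/2" i] e_eq[of "c/2" x i] that c_pos by (cases "x \<le> c/2") auto
  have "u x $ i = (\<chi> i. e (c/2) i) $ i + primitive M (?d i) x" if x: "0 < x" "x < c" for x i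
    unfolding vec_lambda_beta u[OF x] e_const[OF x, of i] ..
  then have "represents lam u (\<chi> i. e (c/2) i)"
    unfolding represents_def using tame int by auto
  then show ?thesis ..
qed

lemma represents_tendsto:
  assumes rep: "represents lam u \<eta>"
  shows "(u \<longlongrightarrow> \<eta>) (at_right 0)"
    and "z \<in> {0<..<c} \<Longrightarrow> (u \<longlongrightarrow> (\<chi> i. \<eta> $ i + (\<integral>y. indicator {..z} y *\<^sub>R drive lam u i y \<partial>M))) (at_right z)"
    and "z \<in> {0<..<c} \<Longrightarrow> (u \<longlongrightarrow> (\<chi> i. \<eta> $ i + (\<integral>y. indicator {..<z} y *\<^sub>R drive lam u i y \<partial>M))) (at_left z)"
proof -
  have int: "integrable M (drive lam u i)" for i
    using rep by (simp add: represents_def)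
  have right: "(u \<longlongrightarrow> (\<chi> i. \<eta> $ i + (\<integral>y. indicator {..z} y *\<^sub>R drive lam u i y \<partial>M))) (at_right z)"
    if z: "z \<in> {0..<c}" for z
  proof (rule vec_tendstoI)
    fix i
    have "((\<lambda>x. \<eta> $ i + primitive M (drive lam u i) x) \<longlongrightarrow>
        \<eta> $ i + (\<integral>y. indicator {..z} y *\<^sub>R drive lam u i y \<partial>M)) (at_right z)"
      by (intro tendsto_add tendsto_const primitive_tendsto int)
    moreover have "\<forall>\<^sub>F x in at_right z. \<eta> $ i + primitive M (drive lam u i) x = u x $ i"
      unfolding eventually_at_right_field using rep z by (auto simp: represents_def intro!: exI[of _ c])
    ultimately show "((\<lambda>x. u x $ i) \<longlongrightarrow> (\<chi> i. \<eta> $ i + (\<integral>y. indicator {..z} y *\<^sub>R drive lam u i y \<partial>M)) $ i) (at_right z)"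
      by (simp add: Lim_transform_eventually)
  qed
  have "(\<integral>y. indicator {..0} y *\<^sub>R drive lam u i y \<partial>M) = 0" for i
  proof -
    have "(\<lambda>y. indicator {..0} y *\<^sub>R drive lam u i y) = (\<lambda>y. 0)"
      using drive_outside by (auto simp: indicator_def fun_eq_iff)
    then show ?thesis by simp
  qed
  then show "(u \<longlongrightarrow> \<eta>) (at_right 0)"
    using right[of 0] c_pos by simp
  show "(u \<longlongrightarrow> (\<chi> i. \<eta> $ i + (\<integral>y. indicator {..z} y *\<^sub>R drive lam u i y \<partial>M))) (at_right z)"
    if "z \<in> {0<..<c}"
    using right[of z] that by auto
  show "(u \<longlongrightarrow> (\<chi> i. \<eta> $ i + (\<integral>y. indicator {..<z} y *\<^sub>R drive lam u i y \<partial>M))) (at_left z)"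
    if z: "z \<in> {0<..<c}"
  proof (rule vec_tendstoI)
    fix i
    have "((\<lambda>x. \<eta> $ i + primitive M (drive lam u i) x) \<longlongrightarrow>
        \<eta> $ i + (\<integral>y. indicator {..<z} y *\<^sub>R drive lam u i y \<partial>M)) (at_left z)"
      by (intro tendsto_add tendsto_const primitive_tendsto int)
    moreover have "\<forall>\<^sub>F x in at_left z. \<eta> $ i + primitive M (drive lam u i) x = u x $ i"
      unfolding eventually_at_left_field using rep z by (auto simp: represents_def intro!: exI[of _ 0])
    ultimately show "((\<lambda>x. u x $ i) \<longlongrightarrow> (\<chi> i. \<eta> $ i + (\<integral>y. indicator {..<z} y *\<^sub>R drive lam u i y \<partial>M)) $ i) (at_left z)"
      by (simp add: Lim_transform_eventually)
  qed
qed

lemma represents_limit: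
  assumes "is_solution b q w lam u" "(u \<longlongrightarrow> \<eta>) (at_right 0)"
  shows "represents lam u \<eta>"
  using solution_represented[OF assms(1)] represents_tendsto(1) assms(2)
  by (metis tendsto_unique trivial_limit_at_right_real)

lemma integral_singleton: "(\<integral>y. indicator {x} y *\<^sub>R f y \<partial>M) = measure M {x} *\<^sub>R (f x :: complex)"
proof -
  have "(\<integral>y. indicator {x} y *\<^sub>R f y \<partial>M) = (\<integral>y. indicator {x} y *\<^sub>R f x \<partial>M)"
    by (intro Bochner_Integration.integral_cong) (auto simp: indicator_def)
  also have "\<dots> = (\<integral>y. indicator {x} y \<partial>M) *\<^sub>R f x"
    by (intro integral_scaleR_left integrable_real_indicator) (simp_all add: sets_borel emeasure_finite less_top[symmetric])
  also have "\<dots> = measure M {x} *\<^sub>R f x"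
    by (simp add: space_UNIV)
  finally show ?thesis .
qed

lemma atom_q: "x \<in> {0<..<c} \<Longrightarrow> q {x} $ i $ j = measure M {x} *\<^sub>R Q x $ i $ j"
  and atom_w: "x \<in> {0<..<c} \<Longrightarrow> w {x} $ i $ j = measure M {x} *\<^sub>R W x $ i $ j"
  using has_density_measure[OF density_q, of "{x}" i j] has_density_measure[OF density_w, of "{x}" i j]
  by (simp_all add: integral_singleton)

lemma atom_flux:
  assumes "x \<in> {0<..<c}"
  shows "measure M {x} *\<^sub>R flux lam u x i = (\<Sum>j\<in>UNIV. (lam * w {x} $ i $ j - q {x} $ i $ j) * u x $ j)"
  unfolding flux_def atom_q[OF assms] atom_w[OF assms] scaleR_sum_right
  by (intro sum.cong refl) (simp add: algebra_simps)

section \<open>Uniqueness of initial value problems\<close>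

text \<open>
  If \<open>u\<close> vanishes before \<open>x\<close>, its value at \<open>x\<close> is half the jump there, which says \<open>B\<^sub>+(x,\<lambda>) u(x) = 0\<close>.
\<close>
lemma solution_zero_at_atom:
  assumes x: "x \<in> {0<..<c}" and lam: "lam \<notin> Lambda_set b q w"
    and u: "\<And>i. u x $ i = (1/2) *\<^sub>R (measure M {x} *\<^sub>R drive lam u i x)"
  shows "u x = 0"
proof (rule invertible_kernel)
  have "x \<in> ivl b"
    using x c_less less_trans[of "ereal x" "ereal c" b] by (auto simp: ivl_def)
  then show "det (Bmat 1 q w x lam) \<noteq> 0"
    using lam by (auto simp: Lambda_set_def)
  define X where "X i = (\<Sum>j\<in>UNIV. (lam * w {x} $ i $ j - q {x} $ i $ j) * u x $ j)" for i
  have "u x $ 1 = (1/2) *\<^sub>R X 2" "u x $ 2 = (1/2) *\<^sub>R (- X 1)"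
    using u[of 1] u[of 2] unfolding X_def drive_def atom_flux[OF x, symmetric] by simp_all
  moreover have "(Bmat 1 q w x lam *v u x) $ 1 = - u x $ 2 - (1/2) *\<^sub>R X 1"
    "(Bmat 1 q w x lam *v u x) $ 2 = u x $ 1 - (1/2) *\<^sub>R X 2"
    by (simp_all add: X_def matrix_vector_mult_def Bmat_def Jmat_def sum_2 scaleR_conv_of_real field_simps)
  ultimately show "Bmat 1 q w x lam *v u x = 0"
    unfolding vec_eq_iff forall_2 by simp
qed

text \<open>
  Let \<open>z\<close> be the end of the largest initial interval on which \<open>u\<close> vanishes.  At \<open>z\<close> itself \<open>u\<close>
  vanishes because \<open>B\<^sub>+\<close> is invertible, and on a short interval beyond \<open>z\<close> it vanishes because the
  coefficients have small mass there; so \<open>z\<close> cannot be smaller than \<open>c\<close>.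
\<close>
lemma solution_unique_on_initial_interval:
  assumes sol: "is_solution b q w lam u" and lam: "lam \<notin> Lambda_set b q w"
    and lim: "(u \<longlongrightarrow> 0) (at_right 0)" and x: "x \<in> {0<..<c}"
  shows "u x = 0"
proof -
  have rep: "u y $ i = primitive M (drive lam u i) y" if "y \<in> {0<..<c}" for y i
    using represents_limit[OF sol lim] that by (simp add: represents_def)
  have tame: "tame_on {0<..<c} u"
    by (rule solution_tame[OF sol])
  have int: "integrable M (drive lam u i)" for i
    by (rule integrable_drive[OF tame])
  have drive0: "drive lam u i y = 0" if "u y = 0" for i y
    using that by (simp add: drive_def flux_def)
  define Z where "Z = {t \<in> {0..c}. \<forall>y\<in>{0<..<t}. u y = 0}"
  have Z: "0 \<in> Z" "bdd_above Z"
    using c_pos by (auto simp: Z_def bdd_above_def)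
  define z where "z = Sup Z"
  have "0 \<le> z"
    unfolding z_def by (rule cSup_upper[OF Z])
  moreover have "z \<le> c"
    unfolding z_def using Z(1) by (intro cSup_least) (auto simp: Z_def)
  ultimately have z: "0 \<le> z" "z \<le> c" .
  have zero: "u y = 0" if y: "0 < y" "y < z" for y
  proof -
    obtain t where "t \<in> Z" "y < t"
      using less_cSupE[OF y(2)[unfolded z_def]] Z(1) by blast
    then show ?thesis
      using y by (auto simp: Z_def)
  qed
  have "z = c"
  proof (rule ccontr)
    assume "z \<noteq> c"
    then have zc: "z < c" using z by simp
    have drive_before: "drive lam u i y = 0" if "y < z" for i y
      using that zero[of y] drive0[of y i] drive_outside[of y lam u i] by (cases "0 < y") auto
    have drive_z: "drive lam u i z = 0" for i
    proof (cases "z = 0")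
      case True
      then show ?thesis by (simp add: drive_outside)
    next
      case False
      then have z': "z \<in> {0<..<c}" using z zc by auto
      have "u z $ i = (1/2) *\<^sub>R (measure M {z} *\<^sub>R drive lam u i z)" for i
      proof -
        have "u z $ i = (\<integral>y. (1/2) *\<^sub>R (indicator {z} y *\<^sub>R drive lam u i y) \<partial>M)"
          unfolding rep[OF z'] primitive_def
          by (intro Bochner_Integration.integral_cong) (auto simp: halfstep_def indicator_def drive_before)
        then show ?thesis
          by (simp only: integral_scaleR_right integral_singleton)
      qed
      then show ?thesis
        using solution_zero_at_atom[OF z' lam] drive0 by blast
    qed
    have pos: "0 < norm lam + 1"
      by (simp add: add_nonneg_pos)
    obtain d where d: "d > z" "\<And>t. t \<le> d \<Longrightarrow> (\<integral>y. indicator {z<..<t} y * weight y \<partial>M) < 1 / (4 * (norm lam + 1))"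
      using weight_small_right[of "1 / (4 * (norm lam + 1))" z] pos by auto
    define t where "t = min d c"
    have t: "z < t" "t \<le> c" "t \<le> d"
      using d(1) zc by (auto simp: t_def)
    have small: "u x = 0" if x: "x \<in> {z<..<t}" for x
    proof -
      have "norm (u x) \<le> 2 * norm (0 :: complex^2)"
      proof (rule small_interval_estimate[OF _ _ _ _ x])
        show tame': "tame_on {z<..<t} u"
          using z t by (intro tame_on_subset[OF tame]) auto
        have "(norm lam + 1) * (\<integral>y. indicator {z<..<t} y * weight y \<partial>M) \<le> (norm lam + 1) * (1 / (4 * (norm lam + 1)))"
          using pos d(2)[OF t(3)] by (intro mult_left_mono) auto
        also have "\<dots> = 1 / 4"
          using pos by (simp add: divide_simps)
        finally show "(norm lam + 1) * (\<integral>y. indicator {z<..<t} y * weight y \<partial>M) \<le> 1 / 4" .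
        fix y i assume y: "y \<in> {z<..<t}"
        have "u y $ i - 0 $ i = (\<integral>s. halfstep y s *\<^sub>R drive lam u i s \<partial>M)"
          using rep[of y i] y z t unfolding primitive_def by auto
        then have "norm (u y $ i - 0 $ i) \<le> (\<integral>s. norm (halfstep y s *\<^sub>R drive lam u i s) \<partial>M)"
          by (simp only: integral_norm_bound)
        also have "\<dots> \<le> (\<integral>s. indicator {z<..<t} s * norm (drive lam u i s) \<partial>M)"
        proof (rule integral_mono)
          show "integrable M (\<lambda>s. norm (halfstep y s *\<^sub>R drive lam u i s))"
            by (intro integrable_norm integrable_halfstep int)
          show "integrable M (\<lambda>s. indicator {z<..<t} s * norm (drive lam u i s))"
            using integrable_norm[OF integrable_drive_on[OF tame', of lam i]] by simp
          fix s
          show "norm (halfstep y s *\<^sub>R drive lam u i s) \<le> indicator {z<..<t} s * norm (drive lam u i s)"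
          proof (cases "s \<le> z")
            case True
            then show ?thesis
              using drive_before[of s i] drive_z[of i] by (cases "s = z") auto
          next
            case False
            then show ?thesis
              using y by (auto simp: halfstep_def indicator_def)
          qed
        qed
        finally show "norm (u y $ i - 0 $ i) \<le> (\<integral>s. indicator {z<..<t} s * norm (drive lam u i s) \<partial>M)" .
      qed auto
      then show ?thesis by simp
    qed
    have "u y = 0" if "y \<in> {0<..<t}" for y
    proof -
      consider "y < z" | "y = z" | "z < y" by linarith
      then show ?thesis
      proof cases
        case 2
        then have z': "z \<in> {0<..<c}"
          using that zc by auto
        have "(\<lambda>s. halfstep z s *\<^sub>R drive lam u i s) = (\<lambda>s. 0)" for i
          using drive_before drive_z by (auto simp: halfstep_def fun_eq_iff)
        then have "u z $ i = 0" for i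
          unfolding rep[OF z'] primitive_def by simp
        then show ?thesis
          using 2 by (simp add: vec_eq_iff)
      qed (use that zero small in auto)
    qed
    then have "t \<in> Z"
      using t z by (auto simp: Z_def)
    then have "t \<le> z"
      unfolding z_def by (rule cSup_upper) (rule Z(2))
    then show False
      using t by simp
  qed
  then show ?thesis
    using zero x by auto
qed

end

section \<open>Lagrange's identity and the semi-norm\<close>

text \<open>This is the form \<open>x\<^sup>* J y\<close>.\<close>
definition symplectic :: "complex^2 \<Rightarrow> complex^2 \<Rightarrow> complex" where
  "symplectic x y = cnj (x $ 2) * y $ 1 - cnj (x $ 1) * y $ 2"

lemma sesquilinear_form_add_right:
  "sesquilinear_form A x (a *s y + z) = a * sesquilinear_form A x y + sesquilinear_form A x z"
  by (simp add: sesquilinear_form_def sum_2 algebra_simps)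

lemma sesquilinear_form_add_left:
  "sesquilinear_form A (a *s y + z) x = cnj a * sesquilinear_form A y x + sesquilinear_form A z x"
  by (simp add: sesquilinear_form_def sum_2 algebra_simps)

lemma sesquilinear_form_kernel: "A *v y = 0 \<Longrightarrow> sesquilinear_form A x y = 0"
  by (simp add: sesquilinear_form_def matrix_vector_mult_def vec_eq_iff mult.assoc flip: sum_distrib_left)

lemma hermitian_cnj: "hermitian A \<Longrightarrow> cnj (A $ i $ j) = A $ j $ i"
  unfolding hermitian_iff by (metis complex_cnj_cnj)

lemma sesquilinear_form_cnj:
  assumes "hermitian A"
  shows "cnj (sesquilinear_form A x y) = sesquilinear_form A y x"
  by (simp add: sesquilinear_form_def sum_2 hermitian_cnj[OF assms] algebra_simps)

text \<open>
  Moving from \<open>v\<close> in the direction \<open>- A v\<close> would make the form negative to first order if \<open>A v\<close>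
  were not \<open>0\<close>.
\<close>
lemma nonneg_matrix_kernel:
  assumes A: "nonneg_matrix A" and v: "Re (quadratic_form A v) = 0"
  shows "A *v v = 0"
proof -
  define y where "y = A *v v"
  have herm: "hermitian A" and pos: "\<And>v. 0 \<le> Re (quadratic_form A v)"
    using A by (auto simp: nonneg_matrix_iff)
  have yv: "sesquilinear_form A y v = complex_of_real ((norm (y $ 1))\<^sup>2 + (norm (y $ 2))\<^sup>2)"
  proof -
    have "sesquilinear_form A y v = (\<Sum>i\<in>UNIV. cnj (y $ i) * y $ i)"
      by (simp add: sesquilinear_form_def y_def matrix_vector_mult_def sum_distrib_left mult.assoc)
    then show ?thesis
      by (simp add: sum_2 mult.commute[of "cnj _"] complex_mult_cnj cmod_power2)
  qed
  define k where "k = (norm (y $ 1))\<^sup>2 + (norm (y $ 2))\<^sup>2"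
  define m where "m = Re (quadratic_form A y)"
  have vy: "sesquilinear_form A v y = complex_of_real k"
    using sesquilinear_form_cnj[OF herm, of y v] by (simp add: yv k_def)
  have quad: "0 \<le> t\<^sup>2 * m - 2 * t * k" for t :: real
  proof -
    have "quadratic_form A (complex_of_real (-t) *s y + v)
        = complex_of_real (t\<^sup>2) * quadratic_form A y - complex_of_real (2 * t * k) + quadratic_form A v"
      unfolding sesquilinear_form_add_right sesquilinear_form_add_left
      by (simp add: vy yv flip: k_def) (simp add: algebra_simps power2_eq_square)
    then have "Re (quadratic_form A (complex_of_real (-t) *s y + v)) = t\<^sup>2 * m - 2 * t * k"
      using v by (simp add: m_def)
    then show ?thesis
      using pos[of "complex_of_real (-t) *s y + v"] by linarith
  qed
  have "k = 0"
  proof (rule ccontr)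
    assume "k \<noteq> 0"
    then have k: "0 < k" by (simp add: k_def add_nonneg_eq_0_iff less_le)
    have m: "0 \<le> m" unfolding m_def by (rule pos)
    \<comment> \<open>Small enough for the linear term to win; the \<open>1\<close> covers the case \<open>m = 0\<close>.\<close>
    define t where "t = k / (m + 1)"
    have t: "0 < t" using k m by (simp add: t_def)
    have "0 \<le> t * (t * m - 2 * k)"
      using quad[of t] by (simp add: power2_eq_square algebra_simps)
    then have "2 * k \<le> t * m"
      using t by (simp add: zero_le_mult_iff)
    also have "t * m \<le> k"
      using k m by (simp add: t_def field_simps)
    finally show False using k by simp
  qed
  then have "y $ 1 = 0" "y $ 2 = 0"
    by (auto simp: k_def add_nonneg_eq_0_iff)
  then show ?thesis
    unfolding vec_eq_iff forall_2 y_def by simp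
qed

text \<open>The polarisation of \<open>normsq_upto\<close>.\<close>
definition inner_upto ::
    "(real set \<Rightarrow> complex^2^2) \<Rightarrow> (real \<Rightarrow> complex^2) \<Rightarrow> (real \<Rightarrow> complex^2) \<Rightarrow> real \<Rightarrow> complex" where
  "inner_upto w v u z = (\<Sum>i\<in>UNIV. \<Sum>j\<in>UNIV.
     complex_measure_integral {0<..<z} (\<lambda>A. w A $ i $ j) (\<lambda>x. cnj (v x $ i) * u x $ j))"

lemma normsq_upto_eq: "normsq_upto w u z = Re (inner_upto w u u z)"
  by (simp add: normsq_upto_def inner_upto_def)

context hermitian_system
begin

text \<open>
  For \<open>A = {..<z}\<close> and \<open>A = {..z}\<close> these are the left and the right limit of \<open>u\<close> at \<open>z\<close>.  Both are
  needed: the first at points of continuity, the second to exclude degenerate values at atoms.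
\<close>
definition value_after :: "real set \<Rightarrow> complex \<Rightarrow> (real \<Rightarrow> complex^2) \<Rightarrow> complex^2 \<Rightarrow> complex^2" where
  "value_after A lam u \<eta> = (\<chi> i. \<eta> $ i + (\<integral>y. indicator A y *\<^sub>R drive lam u i y \<partial>M))"

lemma integrable_mult_drive:
  assumes "tame_on {0<..<c} v" "tame_on {0<..<c} u"
  shows "integrable M (\<lambda>x. cnj (v x $ i) * drive lam u k x)"
proof -
  obtain B where B: "\<And>x. x \<in> {0<..<c} \<Longrightarrow> norm (v x) \<le> B"
    using assms(1) unfolding tame_on_def by blast
  have [measurable]: "(\<lambda>x. indicator {0<..<c} x *\<^sub>R v x $ i) \<in> borel_measurable borel"
    using assms(1) by (simp add: tame_on_def)
  have "(\<lambda>x. cnj (indicator {0<..<c} x *\<^sub>R v x $ i)) \<in> borel_measurable borel"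
    by (intro borel_measurable_continuous_on[OF continuous_on_cnj[OF continuous_on_id]]) measurable
  then have "integrable M (\<lambda>x. indicator {0<..<c} x *\<^sub>R (drive lam u k x * cnj (v x $ i)))"
    using B Finite_Cartesian_Product.norm_nth_le[of "v _" i]
    by (intro integrable_mult_bounded_on[OF integrable_drive[OF assms(2)] sets_borel, where B = B])
      (auto intro: order_trans)
  also have "(\<lambda>x. indicator {0<..<c} x *\<^sub>R (drive lam u k x * cnj (v x $ i)))
      = (\<lambda>x. cnj (v x $ i) * drive lam u k x)"
    using drive_outside by (auto simp: indicator_def fun_eq_iff)
  finally show ?thesis .
qed

text \<open>
  Integration by parts is applied to the densities cut off to the initial segment \<open>A\<close>; inside \<open>A\<close> the
  cut-off does not change the primitives, as these look only to the left.
\<close>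
lemma integral_by_parts_components:
  assumes u: "represents lam u \<eta>" and v: "represents mu v \<zeta>"
    and A: "A \<in> sets borel" "\<And>x y. x \<in> A \<Longrightarrow> y \<le> x \<Longrightarrow> y \<in> A"
  shows "cnj (value_after A mu v \<zeta> $ i) * value_after A lam u \<eta> $ k = cnj (\<zeta> $ i) * \<eta> $ k
    + (\<integral>x. indicator A x *\<^sub>R (cnj (v x $ i) * drive lam u k x + cnj (drive mu v i x) * u x $ k) \<partial>M)"
proof -
  let ?du = "drive lam u k" and ?dv = "drive mu v i"
  let ?h = "\<lambda>y. indicator A y *\<^sub>R ?du y" and ?g = "\<lambda>y. indicator A y *\<^sub>R cnj (?dv y)"
  have int: "integrable M ?du" "integrable M ?dv"
    using u v by (auto simp: represents_def)
  have "integrable M (\<lambda>y. cnj (?dv y))"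
    using int(2) by simp
  then have gh: "integrable M ?g" "integrable M ?h"
    using int(1) A(1) by (auto intro!: integrable_mult_indicator simp: sets_borel)
  have prim: "primitive M (\<lambda>y. indicator A y *\<^sub>R d y) x = primitive M d x" if "x \<in> A" for d x
    unfolding primitive_def
    by (intro Bochner_Integration.integral_cong) (use A(2)[OF that] in \<open>auto simp: indicator_def halfstep_def\<close>)
  have cnj_prim: "primitive M (\<lambda>y. cnj (?dv y)) x = cnj (primitive M ?dv x)" for x
    unfolding primitive_def Bochner_Integration.integral_cnj[symmetric] by simp
  have 1: "(cnj (\<zeta> $ i) + primitive M ?g x) * ?h x = indicator A x *\<^sub>R (cnj (v x $ i) * ?du x)" for x
  proof (cases "x \<in> A \<and> x \<in> {0<..<c}")
    case True
    then have "v x $ i = \<zeta> $ i + primitive M ?dv x"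
      using v by (simp add: represents_def)
    then show ?thesis
      using True prim[of x "\<lambda>y. cnj (?dv y)"] cnj_prim[of x] by simp
  next
    case False
    then show ?thesis
      using drive_outside[of x lam u k] by (auto simp: indicator_def)
  qed
  have 2: "?g x * (\<eta> $ k + primitive M ?h x) = indicator A x *\<^sub>R (cnj (?dv x) * u x $ k)" for x
  proof (cases "x \<in> A \<and> x \<in> {0<..<c}")
    case True
    then have "u x $ k = \<eta> $ k + primitive M ?du x"
      using u by (simp add: represents_def)
    then show ?thesis
      using True prim[of x ?du] by simp
  next
    case False
    then show ?thesis
      using drive_outside[of x mu v i] by (auto simp: indicator_def)
  qed
  have tame: "tame_on {0<..<c} u" "tame_on {0<..<c} v"
    using u v by (auto simp: represents_def)
  have "integrable M (\<lambda>x. cnj (cnj (u x $ k) * ?dv x))"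
    by (rule complex_integrable_cnj[THEN iffD2]) (rule integrable_mult_drive[OF tame])
  then have "integrable M (\<lambda>x. cnj (?dv x) * u x $ k)"
    by (simp add: mult.commute)
  then have int': "integrable M (\<lambda>x. indicator A x *\<^sub>R (cnj (v x $ i) * ?du x))"
      "integrable M (\<lambda>x. indicator A x *\<^sub>R (cnj (?dv x) * u x $ k))"
    using integrable_mult_drive[OF tame(2,1)] A(1) by (auto intro!: integrable_mult_indicator simp: sets_borel)
  have "cnj (value_after A mu v \<zeta> $ i) = cnj (\<zeta> $ i) + (\<integral>y. ?g y \<partial>M)"
    by (simp add: value_after_def flip: Bochner_Integration.integral_cnj)
  then have "cnj (value_after A mu v \<zeta> $ i) * value_after A lam u \<eta> $ k
      = (cnj (\<zeta> $ i) + (\<integral>y. ?g y \<partial>M)) * (\<eta> $ k + (\<integral>y. ?h y \<partial>M))"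
    by (simp add: value_after_def)
  also have "\<dots> = cnj (\<zeta> $ i) * \<eta> $ k + (\<integral>x. indicator A x *\<^sub>R (cnj (v x $ i) * ?du x) \<partial>M)
      + (\<integral>x. indicator A x *\<^sub>R (cnj (?dv x) * u x $ k) \<partial>M)"
    unfolding integral_by_parts[OF gh] 1 2 ..
  finally show ?thesis
    unfolding scaleR_add_right using int' by simp
qed

text \<open>
  The terms with \<open>Q\<close> cancel since \<open>Q\<close> is Hermitian, and those with \<open>W\<close> combine since \<open>W\<close> is.
\<close>
lemma lagrange_integrand:
  "(cnj (v x $ 2) * drive lam u 1 x + cnj (drive mu v 2 x) * u x $ 1)
    - (cnj (v x $ 1) * drive lam u 2 x + cnj (drive mu v 1 x) * u x $ 2)
    = (lam - cnj mu) * sesquilinear_form (W x) (v x) (u x)"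
  using hermitian_cnj[OF hermitian_Q, of x] hermitian_cnj[of "W x"] nonneg_W[of x]
  by (simp add: drive_def flux_def sum_2 sesquilinear_form_def nonneg_matrix_def algebra_simps)

lemma lagrange_identity:
  assumes u: "represents lam u \<eta>" and v: "represents mu v \<zeta>"
    and A: "A \<in> sets borel" "\<And>x y. x \<in> A \<Longrightarrow> y \<le> x \<Longrightarrow> y \<in> A"
  shows "symplectic (value_after A mu v \<zeta>) (value_after A lam u \<eta>) = symplectic \<zeta> \<eta>
    + (lam - cnj mu) * (\<integral>x. indicator A x *\<^sub>R sesquilinear_form (W x) (v x) (u x) \<partial>M)"
proof -
  have tame: "tame_on {0<..<c} u" "tame_on {0<..<c} v"
    using u v by (auto simp: represents_def)
  let ?f = "\<lambda>i k x. cnj (v x $ i) * drive lam u k x + cnj (drive mu v i x) * u x $ k"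
  have int: "integrable M (\<lambda>x. indicator A x *\<^sub>R ?f i k x)" for i k
  proof -
    have "integrable M (\<lambda>x. cnj (cnj (u x $ k) * drive mu v i x))"
      by (rule complex_integrable_cnj[THEN iffD2]) (rule integrable_mult_drive[OF tame])
    then have "integrable M (\<lambda>x. cnj (drive mu v i x) * u x $ k)"
      by (simp add: mult.commute)
    then show ?thesis
      using integrable_mult_drive[OF tame(2,1)] A(1)
      by (intro integrable_mult_indicator Bochner_Integration.integrable_add) (auto simp: sets_borel)
  qed
  have "symplectic (value_after A mu v \<zeta>) (value_after A lam u \<eta>) = symplectic \<zeta> \<eta>
      + ((\<integral>x. indicator A x *\<^sub>R ?f 2 1 x \<partial>M) - (\<integral>x. indicator A x *\<^sub>R ?f 1 2 x \<partial>M))"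
  proof -
    have "cnj (value_after A mu v \<zeta> $ i) * value_after A lam u \<eta> $ k
        = cnj (\<zeta> $ i) * \<eta> $ k + (\<integral>x. indicator A x *\<^sub>R ?f i k x \<partial>M)" for i k
      by (rule integral_by_parts_components[OF u v A])
    then show ?thesis
      unfolding symplectic_def by simp
  qed
  also have "(\<integral>x. indicator A x *\<^sub>R ?f 2 1 x \<partial>M) - (\<integral>x. indicator A x *\<^sub>R ?f 1 2 x \<partial>M)
      = (\<integral>x. indicator A x *\<^sub>R ?f 2 1 x - indicator A x *\<^sub>R ?f 1 2 x \<partial>M)"
    by (rule Bochner_Integration.integral_diff[symmetric]) (rule int)+
  also have "\<dots> = (\<integral>x. (lam - cnj mu) * (indicator A x *\<^sub>R sesquilinear_form (W x) (v x) (u x)) \<partial>M)"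
    unfolding scaleR_diff_right[symmetric] lagrange_integrand mult_scaleR_right ..
  also have "\<dots> = (lam - cnj mu) * (\<integral>x. indicator A x *\<^sub>R sesquilinear_form (W x) (v x) (u x) \<partial>M)"
    by (rule integral_mult_right_zero)
  finally show ?thesis .
qed

lemma value_at_continuity_point:
  assumes u: "represents lam u \<eta>" and z: "z \<in> {0<..<c}" "q {z} = 0" "w {z} = 0"
  shows "value_after {..<z} lam u \<eta> = u z"
proof -
  have d: "measure M {z} *\<^sub>R drive lam u i z = 0" for i
    using atom_flux[OF z(1), of lam u] z(2,3) unfolding drive_def by (cases "i = 1") simp_all
  have "u z $ i = value_after {..<z} lam u \<eta> $ i" for i
  proof -
    have int: "integrable M (drive lam u i)"
      using u by (simp add: represents_def)
    have "primitive M (drive lam u i) z = (\<integral>y. indicator {..<z} y *\<^sub>R drive lam u i y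
        + (1/2) *\<^sub>R (indicator {z} y *\<^sub>R drive lam u i y) \<partial>M)"
      unfolding primitive_def
      by (intro Bochner_Integration.integral_cong) (auto simp: halfstep_def indicator_def)
    also have "\<dots> = (\<integral>y. indicator {..<z} y *\<^sub>R drive lam u i y \<partial>M)
        + (\<integral>y. (1/2) *\<^sub>R (indicator {z} y *\<^sub>R drive lam u i y) \<partial>M)"
      using int by (intro Bochner_Integration.integral_add integrable_scaleR_right integrable_mult_indicator)
        (simp_all add: sets_borel)
    also have "(\<integral>y. (1/2) *\<^sub>R (indicator {z} y *\<^sub>R drive lam u i y) \<partial>M) = 0"
      unfolding integral_scaleR_right integral_singleton d by simp
    finally show ?thesis
      using u z(1) by (simp add: represents_def value_after_def)
  qed
  then show ?thesis
    by (simp add: vec_eq_iff)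
qed

lemma integrable_sesquilinear:
  assumes v: "tame_on {0<..<z} v" and u: "tame_on {0<..<z} u"
  shows "integrable M (\<lambda>x. indicator {0<..<z} x *\<^sub>R (W x $ i $ j * (cnj (v x $ i) * u x $ j)))"
    and "z \<le> c \<Longrightarrow> complex_measure_integral {0<..<z} (\<lambda>A. w A $ i $ j) (\<lambda>x. cnj (v x $ i) * u x $ j)
      = (\<integral>x. indicator {0<..<z} x *\<^sub>R (W x $ i $ j * (cnj (v x $ i) * u x $ j)) \<partial>M)"
proof -
  obtain Bv where Bv: "\<And>x. x \<in> {0<..<z} \<Longrightarrow> norm (v x) \<le> Bv"
    using v unfolding tame_on_def by blast
  obtain Bu where Bu: "\<And>x. x \<in> {0<..<z} \<Longrightarrow> norm (u x) \<le> Bu"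
    using u unfolding tame_on_def by blast
  have B: "norm (cnj (v x $ i) * u x $ j) \<le> Bv * Bu" if x: "x \<in> {0<..<z}" for x
    unfolding norm_mult complex_mod_cnj
    using Bv[OF x] Bu[OF x] order_trans[OF norm_ge_zero Bv[OF x]]
    by (intro mult_mono order_trans[OF Finite_Cartesian_Product.norm_nth_le]) auto
  have [measurable]: "(\<lambda>x. indicator {0<..<z} x *\<^sub>R v x $ i) \<in> borel_measurable borel"
      "(\<lambda>x. indicator {0<..<z} x *\<^sub>R u x $ j) \<in> borel_measurable borel"
    using u v by (simp_all add: tame_on_def)
  have "(\<lambda>x. cnj (indicator {0<..<z} x *\<^sub>R v x $ i)) \<in> borel_measurable borel"
    by (intro borel_measurable_continuous_on[OF continuous_on_cnj[OF continuous_on_id]]) measurable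
  then have "(\<lambda>x. cnj (indicator {0<..<z} x *\<^sub>R v x $ i) * (indicator {0<..<z} x *\<^sub>R u x $ j)) \<in> borel_measurable borel"
    by measurable
  also have "(\<lambda>x. cnj (indicator {0<..<z} x *\<^sub>R v x $ i) * (indicator {0<..<z} x *\<^sub>R u x $ j))
      = (\<lambda>x. indicator {0<..<z} x *\<^sub>R (cnj (v x $ i) * u x $ j))"
    by (auto simp: indicator_def fun_eq_iff)
  finally have m: "(\<lambda>x. indicator {0<..<z} x *\<^sub>R (cnj (v x $ i) * u x $ j)) \<in> borel_measurable borel" .
  show "integrable M (\<lambda>x. indicator {0<..<z} x *\<^sub>R (W x $ i $ j * (cnj (v x $ i) * u x $ j)))"
    by (rule integrable_mult_bounded_on[OF integrable_W sets_borel m B])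
  show "complex_measure_integral {0<..<z} (\<lambda>A. w A $ i $ j) (\<lambda>x. cnj (v x $ i) * u x $ j)
      = (\<integral>x. indicator {0<..<z} x *\<^sub>R (W x $ i $ j * (cnj (v x $ i) * u x $ j)) \<partial>M)" if "z \<le> c"
    using that by (intro has_density_integral[OF density_w _ _ m B]) auto
qed

lemma integrable_form:
  assumes "tame_on {0<..<z} v" "tame_on {0<..<z} u"
  shows "integrable M (\<lambda>x. indicator {0<..<z} x *\<^sub>R sesquilinear_form (W x) (v x) (u x))"
proof -
  have "integrable M (\<lambda>x. \<Sum>i\<in>UNIV. \<Sum>j\<in>UNIV. indicator {0<..<z} x *\<^sub>R (W x $ i $ j * (cnj (v x $ i) * u x $ j)))"
    by (intro Bochner_Integration.integrable_sum integrable_sesquilinear(1) assms)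
  then show ?thesis
    by (simp add: sesquilinear_form_def scaleR_sum_right mult_ac)
qed

lemma inner_upto_integral:
  assumes "tame_on {0<..<z} v" "tame_on {0<..<z} u" "z \<le> c"
  shows "inner_upto w v u z = (\<integral>x. indicator {0<..<z} x *\<^sub>R sesquilinear_form (W x) (v x) (u x) \<partial>M)"
proof -
  have "inner_upto w v u z = (\<Sum>i\<in>UNIV. \<Sum>j\<in>UNIV.
      \<integral>x. indicator {0<..<z} x *\<^sub>R (W x $ i $ j * (cnj (v x $ i) * u x $ j)) \<partial>M)"
    unfolding inner_upto_def by (intro sum.cong refl integrable_sesquilinear(2) assms)
  also have "\<dots> = (\<integral>x. (\<Sum>i\<in>UNIV. \<Sum>j\<in>UNIV. indicator {0<..<z} x *\<^sub>R (W x $ i $ j * (cnj (v x $ i) * u x $ j))) \<partial>M)"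
  proof -
    note ii = integrable_sesquilinear(1)[OF assms(1,2)]
    show ?thesis
      by (subst Bochner_Integration.integral_sum, intro Bochner_Integration.integrable_sum ii,
          intro sum.cong refl, subst Bochner_Integration.integral_sum, rule ii, rule refl)
  qed
  also have "\<dots> = (\<integral>x. indicator {0<..<z} x *\<^sub>R sesquilinear_form (W x) (v x) (u x) \<partial>M)"
    by (simp add: sesquilinear_form_def scaleR_sum_right mult_ac)
  finally show ?thesis .
qed

lemma normsq_upto_integral:
  assumes "tame_on {0<..<z} u" "z \<le> c"
  shows "integrable M (\<lambda>x. indicator {0<..<z} x * Re (quadratic_form (W x) (u x)))"
    and "normsq_upto w u z = (\<integral>x. indicator {0<..<z} x * Re (quadratic_form (W x) (u x)) \<partial>M)"
proof -
  have eq: "(\<lambda>x. indicator {0<..<z} x * Re (quadratic_form (W x) (u x)))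
      = (\<lambda>x. Re (indicator {0<..<z} x *\<^sub>R sesquilinear_form (W x) (u x) (u x)))"
    by simp
  show "integrable M (\<lambda>x. indicator {0<..<z} x * Re (quadratic_form (W x) (u x)))"
    unfolding eq by (intro integrable_Re integrable_form assms(1))
  show "normsq_upto w u z = (\<integral>x. indicator {0<..<z} x * Re (quadratic_form (W x) (u x)) \<partial>M)"
    unfolding eq normsq_upto_eq inner_upto_integral[OF assms(1,1,2)]
    by (intro integral_Re[symmetric] integrable_form assms(1))
qed

lemma quadratic_form_nonneg: "0 \<le> Re (quadratic_form (W x) v)"
  using nonneg_W[of x] by (simp add: nonneg_matrix_iff)

lemma normsq_upto_nonneg:
  assumes "tame_on {0<..<z} u" "z \<le> c"
  shows "0 \<le> normsq_upto w u z"
  unfolding normsq_upto_integral(2)[OF assms]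
  by (intro integral_nonneg_AE) (simp add: quadratic_form_nonneg)

lemma normsq_upto_mono:
  assumes "tame_on {0<..<z} u" "z \<le> c" "y \<le> z"
  shows "normsq_upto w u y \<le> normsq_upto w u z"
proof -
  have "tame_on {0<..<y} u"
    using assms by (intro tame_on_subset[OF assms(1)]) auto
  then show ?thesis
    using assms normsq_upto_integral[of y u] normsq_upto_integral[of z u]
    by (auto intro!: integral_mono simp: indicator_def quadratic_form_nonneg)
qed

lemma hermitian_W: "hermitian (W x)"
  using nonneg_W by (simp add: nonneg_matrix_def)

lemma inner_upto_real:
  assumes "tame_on {0<..<z} u" "z \<le> c"
  shows "inner_upto w u u z = complex_of_real (normsq_upto w u z)"
proof -
  have "cnj (inner_upto w u u z) = inner_upto w u u z"
    unfolding inner_upto_integral[OF assms(1,1,2)]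
    by (simp add: sesquilinear_form_cnj[OF hermitian_W] flip: Bochner_Integration.integral_cnj)
  then show ?thesis
    unfolding normsq_upto_eq by (metis Reals_cnj_iff of_real_Re)
qed

text \<open>
  A non-negative function with integral \<open>0\<close> vanishes almost everywhere, and a vector on which a
  non-negative form vanishes lies in its kernel.  This is how a vanishing norm becomes \<open>w u = 0\<close>.
\<close>
lemma null_kernel:
  assumes "tame_on {0<..<z} u" "z \<le> c" "normsq_upto w u z = 0"
  shows "AE x in M. x \<in> {0<..<z} \<longrightarrow> W x *v u x = 0"
proof -
  have "AE x in M. indicator {0<..<z} x * Re (quadratic_form (W x) (u x)) = 0"
    using assms normsq_upto_integral[OF assms(1,2)]
    by (subst integral_nonneg_eq_0_iff_AE[symmetric]) (auto simp: quadratic_form_nonneg)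
  then show ?thesis
  proof eventually_elim
    case (elim x)
    then show ?case
      using nonneg_matrix_kernel[OF nonneg_W, of x "u x"] by auto
  qed
qed

lemma inner_upto_null:
  assumes u: "tame_on {0<..<z} u" and z: "z \<le> c" and null: "normsq_upto w u z = 0" and v: "tame_on {0<..<z} v"
  shows "inner_upto w v u z = 0" and "inner_upto w u v z = 0"
proof -
  have ae: "AE x in M. indicator {0<..<z} x *\<^sub>R sesquilinear_form (W x) (v x) (u x) = 0"
    using null_kernel[OF u z null]
    by eventually_elim (auto simp: indicator_def sesquilinear_form_kernel)
  then show "inner_upto w v u z = 0"
    unfolding inner_upto_integral[OF v u z] by (rule integral_eq_zero_AE)
  from ae have "AE x in M. indicator {0<..<z} x *\<^sub>R sesquilinear_form (W x) (u x) (v x) = 0"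
    by eventually_elim (metis complex_cnj_scaleR complex_cnj_zero hermitian_W sesquilinear_form_cnj)
  then show "inner_upto w u v z = 0"
    unfolding inner_upto_integral[OF u v z] by (rule integral_eq_zero_AE)
qed

lemma normsq_upto_add_null:
  assumes p: "tame_on {0<..<z} p" and z: "z \<le> c" and null: "normsq_upto w p z = 0" and u: "tame_on {0<..<z} u"
  shows "normsq_upto w (\<lambda>x. a *s u x + p x) z = (norm a)\<^sup>2 * normsq_upto w u z"
proof -
  have m: "(\<lambda>x. indicator {0<..<z} x * Re (quadratic_form (W x) (f x))) \<in> borel_measurable M"
    if "tame_on {0<..<z} f" for f
    using normsq_upto_integral(1)[OF that z] by simp
  have "normsq_upto w (\<lambda>x. a *s u x + p x) z
      = (\<integral>x. (norm a)\<^sup>2 * (indicator {0<..<z} x * Re (quadratic_form (W x) (u x))) \<partial>M)"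
    unfolding normsq_upto_integral(2)[OF tame_on_add[OF u p] z]
  proof (rule integral_cong_AE)
    show "AE x in M. indicator {0<..<z} x * Re (quadratic_form (W x) (a *s u x + p x))
        = (norm a)\<^sup>2 * (indicator {0<..<z} x * Re (quadratic_form (W x) (u x)))"
      using null_kernel[OF p z null]
    proof eventually_elim
      case (elim x)
      show ?case
      proof (cases "x \<in> {0<..<z}")
        case True
        then have "sesquilinear_form (W x) y (p x) = 0" for y
          using elim sesquilinear_form_kernel by blast
        moreover from this have "sesquilinear_form (W x) (p x) y = 0" for y
          by (metis complex_cnj_zero hermitian_W sesquilinear_form_cnj)
        ultimately have "quadratic_form (W x) (a *s u x + p x) = (a * cnj a) * quadratic_form (W x) (u x)"
          unfolding sesquilinear_form_add_left sesquilinear_form_add_right by simp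
        then show ?thesis
          using True by (simp add: complex_mult_cnj cmod_power2)
      qed simp
    qed
  qed (use m[OF tame_on_add[OF u p]] m[OF u] in simp_all)
  then show ?thesis
    unfolding normsq_upto_integral(2)[OF u z] by simp
qed

lemma measure_times_null:
  assumes u: "tame_on {0<..<z} u" and z: "z \<le> c" and null: "normsq_upto w u z = 0"
    and E: "E \<in> sets borel" "E \<subseteq> {0<..<z}"
  shows "measure_times w u E = 0"
proof -
  have "measure_times w u E $ i = 0" for i
  proof -
    have "measure_times w u E $ i = (\<integral>x. indicator E x *\<^sub>R (W x *v u x) $ i \<partial>M)"
      using E z by (subst measure_times_density(2)[OF E(1) _ tame_on_subset[OF u E(2,1)]])
        (auto simp: matrix_vector_mult_def)
    also have "\<dots> = 0"
      by (rule integral_eq_zero_AE, use null_kernel[OF u z null] in eventually_elim)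
        (use E in \<open>auto simp: indicator_def\<close>)
    finally show ?thesis .
  qed
  then show ?thesis
    by (simp add: vec_eq_iff)
qed

lemma measure_times_linear:
  assumes u: "tame_on {0<..<c} u" and v: "tame_on {0<..<c} v" and E: "E \<in> sets borel" "E \<subseteq> {0<..<c}"
  shows "measure_times q (\<lambda>x. a *s u x + v x) E = a *s measure_times q u E + measure_times q v E"
    and "measure_times w (\<lambda>x. a *s u x + v x) E = a *s measure_times w u E + measure_times w v E"
proof -
  note tu = tame_on_subset[OF u E(2,1)] and tv = tame_on_subset[OF v E(2,1)]
  note tuv = tame_on_add[OF tu tv]
  have lin: "(\<integral>x. indicator E x *\<^sub>R (\<Sum>j\<in>UNIV. A x $ i $ j * (a *s u x + v x) $ j) \<partial>M)
      = a * (\<integral>x. indicator E x *\<^sub>R (\<Sum>j\<in>UNIV. A x $ i $ j * u x $ j) \<partial>M)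
        + (\<integral>x. indicator E x *\<^sub>R (\<Sum>j\<in>UNIV. A x $ i $ j * v x $ j) \<partial>M)"
    if int: "\<And>i j k f. tame_on E f \<Longrightarrow> integrable M (\<lambda>x. indicator E x *\<^sub>R (A x $ i $ j * f x $ k))"
    for A :: "real \<Rightarrow> complex^2^2" and i
  proof -
    have I: "integrable M (\<lambda>x. indicator E x *\<^sub>R (\<Sum>j\<in>UNIV. A x $ i $ j * f x $ j))" if "tame_on E f" for f
      unfolding scaleR_sum_right by (intro Bochner_Integration.integrable_sum int that)
    have "(\<integral>x. indicator E x *\<^sub>R (\<Sum>j\<in>UNIV. A x $ i $ j * (a *s u x + v x) $ j) \<partial>M)
        = (\<integral>x. a * (indicator E x *\<^sub>R (\<Sum>j\<in>UNIV. A x $ i $ j * u x $ j))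
          + indicator E x *\<^sub>R (\<Sum>j\<in>UNIV. A x $ i $ j * v x $ j) \<partial>M)"
      by (intro Bochner_Integration.integral_cong) (simp_all add: indicator_def sum_2 algebra_simps)
    then show ?thesis
      unfolding integral_mult_right_zero[symmetric]
      by (simp only: Bochner_Integration.integral_add[OF integrable_mult_right[OF I[OF tu]] I[OF tv]])
  qed
  show "measure_times q (\<lambda>x. a *s u x + v x) E = a *s measure_times q u E + measure_times q v E"
    using lin[OF integrable_against_tame(1)]
    unfolding vec_eq_iff measure_times_density(1)[OF E tuv] vector_add_component vector_smult_component
      measure_times_density(1)[OF E tu] measure_times_density(1)[OF E tv] by blast
  show "measure_times w (\<lambda>x. a *s u x + v x) E = a *s measure_times w u E + measure_times w v E"
    using lin[OF integrable_against_tame(2)]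
    unfolding vec_eq_iff measure_times_density(2)[OF E tuv] vector_add_component vector_smult_component
      measure_times_density(2)[OF E tu] measure_times_density(2)[OF E tv] by blast
qed

end

text \<open>The Wronskian of two solutions, when evaluated at their values at a point.\<close>
definition det2 :: "complex^2 \<Rightarrow> complex^2 \<Rightarrow> complex" where
  "det2 x y = x $ 1 * y $ 2 - x $ 2 * y $ 1"

text \<open>
  The determinant of \<open>X\<^sup>* J Z\<close> for the matrices \<open>X\<close> and \<open>Z\<close> with columns \<open>x, y\<close> and \<open>z, t\<close>;
  recall \<open>det J = 1\<close>.
\<close>
lemma symplectic_gram:
  "cnj (det2 x y) * det2 z t = symplectic x z * symplectic y t - symplectic x t * symplectic y z"
  by (simp add: det2_def symplectic_def algebra_simps)

context hermitian_system
begin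

text \<open>
  If two solutions are null, all their symplectic products are constant, so the Gram identity keeps
  the modulus of their Wronskian away from \<open>0\<close> at every right limit.  The values at a point \<open>x\<close> are mapped to the
  right limits by a matrix \<open>T\<close>, hence they are independent as well, and a matrix \<open>W x\<close> that kills both
  must be \<open>0\<close>.
\<close>
lemma null_pair_weight_zero:
  assumes u: "represents lam u \<eta>" "normsq_upto w u z = 0" and v: "represents lam v \<zeta>" "normsq_upto w v z = 0"
    and z: "z \<le> c" and det: "det2 \<eta> \<zeta> \<noteq> 0"
  shows "AE x in M. x \<in> {0<..<z} \<longrightarrow> W x = 0"
proof -
  have sub: "{0<..<z} \<subseteq> {0<..<c}" using z by auto
  have tu: "tame_on {0<..<z} u" and tv: "tame_on {0<..<z} v"
    using u(1) v(1) sub by (auto simp: represents_def intro: tame_on_subset)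
  have ku: "AE x in M. x \<in> {0<..<z} \<longrightarrow> W x *v u x = 0" and kv: "AE x in M. x \<in> {0<..<z} \<longrightarrow> W x *v v x = 0"
    using null_kernel[OF tu z u(2)] null_kernel[OF tv z v(2)] .
  have det_x: "det2 (u x) (v x) \<noteq> 0" if x: "x \<in> {0<..<z}" for x
  proof
    assume 0: "det2 (u x) (v x) = 0"
    have const: "symplectic (value_after {..x} lam f a) (value_after {..x} lam g d) = symplectic a d"
      if f: "represents lam f a" and g: "represents lam g d"
        and k: "AE x in M. x \<in> {0<..<z} \<longrightarrow> W x *v g x = 0" for f g a d
    proof -
      have "(\<integral>y. indicator {..x} y *\<^sub>R sesquilinear_form (W y) (f y) (g y) \<partial>M) = 0"
      proof (rule integral_eq_zero_AE)
        show "AE y in M. indicator {..x} y *\<^sub>R sesquilinear_form (W y) (f y) (g y) = 0"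
          using k
        proof eventually_elim
          case (elim y)
          show ?case
          proof (cases "y \<in> {0<..<z}")
            case True
            then show ?thesis
              using elim sesquilinear_form_kernel by simp
          next
            case False
            then have "y \<notin> {..x} \<or> y \<notin> {0<..<c}"
              using x by auto
            then show ?thesis
              by (auto simp: sesquilinear_form_def W_outside)
          qed
        qed
      qed
      then show ?thesis
        using lagrange_identity[OF g f, of "{..x}"] by simp
    qed
    let ?u = "value_after {..x} lam u \<eta>" and ?v = "value_after {..x} lam v \<zeta>"
    have "cnj (det2 ?u ?v) * det2 ?u ?v = cnj (det2 \<eta> \<zeta>) * det2 \<eta> \<zeta>"
      unfolding symplectic_gram by (simp only: const[OF u(1) u(1) ku] const[OF u(1) v(1) kv] const[OF v(1) u(1) ku] const[OF v(1) v(1) kv])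
    then have det_after: "det2 ?u ?v \<noteq> 0"
      using det by auto
    define \<kappa> where "\<kappa> = complex_of_real (measure M {x} / 2)"
    have \<kappa>: "(1/2) *\<^sub>R (measure M {x} *\<^sub>R d) = \<kappa> * d" for d
      by (simp add: \<kappa>_def scaleR_conv_of_real)
    define T :: "complex^2^2" where "T = (\<chi> i j. (if i = j then 1 else 0) + \<kappa> *
      (if i = 1 then lam * W x $ 2 $ j - Q x $ 2 $ j else - (lam * W x $ 1 $ j - Q x $ 1 $ j)))"
    have jump: "value_after {..x} lam f a $ i = (\<Sum>j\<in>UNIV. T $ i $ j * f x $ j)" if f: "represents lam f a" for f a i
    proof -
      have int: "integrable M (drive lam f i)"
        using f by (simp add: represents_def)
      have "(\<integral>y. indicator {..x} y *\<^sub>R drive lam f i y \<partial>M)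
          = (\<integral>y. halfstep x y *\<^sub>R drive lam f i y + (1/2) *\<^sub>R (indicator {x} y *\<^sub>R drive lam f i y) \<partial>M)"
        by (intro Bochner_Integration.integral_cong) (auto simp: halfstep_def indicator_def simp flip: scaleR_add_left)
      also have "\<dots> = primitive M (drive lam f i) x + (\<integral>y. (1/2) *\<^sub>R (indicator {x} y *\<^sub>R drive lam f i y) \<partial>M)"
        unfolding primitive_def
        using int by (intro Bochner_Integration.integral_add integrable_scaleR_right integrable_mult_indicator integrable_halfstep)
          (simp_all add: sets_borel)
      also have "(\<integral>y. (1/2) *\<^sub>R (indicator {x} y *\<^sub>R drive lam f i y) \<partial>M)
          = (1/2) *\<^sub>R (measure M {x} *\<^sub>R drive lam f i x)"
        unfolding integral_scaleR_right integral_singleton ..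
      finally have after: "value_after {..x} lam f a $ i
          = a $ i + primitive M (drive lam f i) x + (1/2) *\<^sub>R (measure M {x} *\<^sub>R drive lam f i x)"
        by (simp add: value_after_def)
      have "x \<in> {0<..<c}"
        using x sub by blast
      then have "a $ i + primitive M (drive lam f i) x = f x $ i"
        using f unfolding represents_def by metis
      then have "value_after {..x} lam f a $ i = f x $ i + (1/2) *\<^sub>R (measure M {x} *\<^sub>R drive lam f i x)"
        unfolding after by simp
      then show ?thesis
        using exhaust_2[of i] unfolding \<kappa>
        by (auto simp: T_def drive_def flux_def sum_2 algebra_simps)
    qed
    have "det2 ?u ?v = (T $ 1 $ 1 * T $ 2 $ 2 - T $ 1 $ 2 * T $ 2 $ 1) * det2 (u x) (v x)"
      unfolding det2_def jump[OF u(1)] jump[OF v(1)] by (simp add: sum_2 algebra_simps)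
    then show False
      using 0 det_after by simp
  qed
  from ku kv show ?thesis
  proof eventually_elim
    case (elim x)
    show ?case
    proof
      assume x: "x \<in> {0<..<z}"
      have rows: "W x $ i $ 1 * u x $ 1 + W x $ i $ 2 * u x $ 2 = 0" "W x $ i $ 1 * v x $ 1 + W x $ i $ 2 * v x $ 2 = 0" for i
        using elim x by (auto simp: vec_eq_iff matrix_vector_mult_def sum_2)
      have "W x $ i $ 1 * det2 (u x) (v x) = (W x $ i $ 1 * u x $ 1 + W x $ i $ 2 * u x $ 2) * v x $ 2
          - (W x $ i $ 1 * v x $ 1 + W x $ i $ 2 * v x $ 2) * u x $ 2" for i
        by (simp add: det2_def algebra_simps)
      moreover have "W x $ i $ 2 * det2 (u x) (v x) = (W x $ i $ 1 * v x $ 1 + W x $ i $ 2 * v x $ 2) * u x $ 1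
          - (W x $ i $ 1 * u x $ 1 + W x $ i $ 2 * u x $ 2) * v x $ 1" for i
        by (simp add: det2_def algebra_simps)
      ultimately have "W x $ i $ 1 = 0" "W x $ i $ 2 = 0" for i
        using det_x[OF x] unfolding rows by simp_all
      then show "W x = 0"
        by (simp add: vec_eq_iff forall_2)
    qed
  qed
qed

end

section \<open>Regular problems on the whole interval\<close>

text \<open>
  Facts about solutions up to a point \<open>z\<close> are transferred from a representation by densities on
  an interval \<open>(0,c)\<close> with \<open>z < c\<close>, which then no longer appears.
\<close>
locale regular_problem =
  fixes b :: ereal and q w :: "real set \<Rightarrow> complex^2^2"
  assumes b_pos: "0 < b"
    and q_hermitian: "hermitian_measure b q" and w_nonneg: "nonneg_measure b w"
    and q_regular: "regular_at_0 b q" and w_regular: "regular_at_0 b w"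
begin

lemma ivl_beyond:
  assumes "ereal z < b"
  shows "\<exists>c\<in>ivl b. z < c \<and> 0 < c"
proof -
  have "max (ereal z) 0 < b"
    using assms b_pos by simp
  then obtain c where c: "max (ereal z) 0 < ereal c" "ereal c < b"
    using ereal_dense2 by blast
  then show ?thesis
    by (intro bexI[of _ c]) (auto simp: ivl_def)
qed

lemma system_beyond:
  assumes "z \<in> ivl b"
  obtains M c Q W where "z < c" "hermitian_system M b c q w Q W"
proof -
  obtain c where c: "c \<in> ivl b" "z < c"
    using ivl_beyond[of z] assms by (auto simp: ivl_def)
  then show ?thesis
    using that hermitian_system_exists[OF c(1) q_hermitian q_regular w_nonneg w_regular] by blast
qed

lemma ivl_mono:
  assumes "z \<in> ivl b" "0 < y" "y \<le> z"
  shows "y \<in> ivl b"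
proof -
  have "ereal y < b"
    by (rule le_less_trans[of _ "ereal z"]) (use assms in \<open>simp_all add: ivl_def\<close>)
  then show ?thesis
    using assms(2) by (simp add: ivl_def)
qed

lemma solution_limit:
  assumes "is_solution b q w lam u"
  shows "\<exists>\<eta>. (u \<longlongrightarrow> \<eta>) (at_right 0)"
proof -
  obtain z where z: "z \<in> ivl b"
    using ivl_beyond[of 0] b_pos by (auto simp: zero_ereal_def)
  obtain M c Q W where "z < c" "hermitian_system M b c q w Q W"
    by (rule system_beyond[OF z])
  then interpret hermitian_system M b c q w Q W by simp
  show ?thesis
    using solution_represented[OF assms] represents_tendsto(1) by blast
qed

lemma solution_unique:
  assumes "is_solution b q w lam u" "lam \<notin> Lambda_set b q w" "(u \<longlongrightarrow> 0) (at_right 0)" "x \<in> ivl b"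
  shows "u x = 0"
proof -
  obtain M c Q W where c: "x < c" "hermitian_system M b c q w Q W"
    by (rule system_beyond[OF assms(4)])
  then interpret hermitian_system M b c q w Q W by simp
  show ?thesis
    using solution_unique_on_initial_interval[OF assms(1-3)] assms(4) c by (auto simp: ivl_def)
qed

lemma solution_tame_initial:
  assumes "is_solution b q w lam u" "z \<in> ivl b"
  shows "tame_on {0<..<z} u"
proof -
  obtain M c Q W where c: "z < c" "hermitian_system M b c q w Q W"
    by (rule system_beyond[OF assms(2)])
  then interpret hermitian_system M b c q w Q W by simp
  show ?thesis
    using c by (intro tame_on_subset[OF solution_tame[OF assms(1)]]) auto
qed

lemma solution_one_sided_limits:
  assumes sol: "is_solution b q w lam u" and x: "x \<in> ivl b"
  shows "(u \<longlongrightarrow> right_limit u x) (at_right x)" and "(u \<longlongrightarrow> left_limit u x) (at_left x)"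
proof -
  obtain M c Q W where c: "x < c" "hermitian_system M b c q w Q W"
    by (rule system_beyond[OF x])
  then interpret hermitian_system M b c q w Q W by simp
  obtain \<eta> where rep: "represents lam u \<eta>"
    using solution_represented[OF sol] by blast
  have "x \<in> {0<..<c}"
    using x c by (auto simp: ivl_def)
  note lims = represents_tendsto(2,3)[OF rep this]
  show "(u \<longlongrightarrow> right_limit u x) (at_right x)"
    using lims(1) tendsto_Lim[OF trivial_limit_at_right_real lims(1)] by (simp only: right_limit_def)
  show "(u \<longlongrightarrow> left_limit u x) (at_left x)"
    using lims(2) tendsto_Lim[OF trivial_limit_at_left_real lims(2)] by (simp only: left_limit_def)
qed

lemma local_borel_below:
  assumes "E \<in> local_borel b"
  shows "\<exists>z\<in>ivl b. E \<in> sets borel \<and> E \<subseteq> {0<..<z}"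
proof -
  obtain K where K: "compact K" "K \<subseteq> ivl b" "E \<subseteq> K" and E: "E \<in> sets borel"
    using assms by (auto simp: local_borel_def)
  obtain s where s: "ereal s < b" "\<And>y. y \<in> K \<Longrightarrow> y \<le> s"
  proof (cases "K = {}")
    case True
    then show ?thesis
      using that[of 0] b_pos by (simp add: zero_ereal_def)
  next
    case False
    then obtain s where "s \<in> K" "\<And>y. y \<in> K \<Longrightarrow> y \<le> s"
      using compact_attains_sup[OF K(1)] by blast
    then show ?thesis
      using K(2) that[of s] by (auto simp: ivl_def)
  qed
  obtain z where "z \<in> ivl b" "s < z"
    using ivl_beyond[OF s(1)] by blast
  then show ?thesis
    using s(2) K E by (intro bexI[of _ z]) (force simp: ivl_def)+
qed

lemma tendsto_vec2_linear:
  assumes "(u \<longlongrightarrow> l) F" "(v \<longlongrightarrow> m) F"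
  shows "((\<lambda>x. a *s u x + v x :: complex^2) \<longlongrightarrow> a *s l + m) F"
  by (rule vec_tendstoI)
    (simp add: tendsto_add tendsto_mult_left tendsto_vec_nth assms)

text \<open>
  The one-sided limits have to exist for the limits of a sum to be the sums of the limits; the
  integral representation provides them.
\<close>
lemma solution_linear:
  assumes u: "is_solution b q w lam u" and v: "is_solution b q w lam v"
  shows "is_solution b q w lam (\<lambda>x. a *s u x + v x)"
proof -
  let ?s = "\<lambda>x. a *s u x + v x"
  have lbv: "locally_bounded_variation b ?s"
    unfolding locally_bounded_variation_def
  proof (intro allI impI)
    fix s t assume st: "0 < s \<and> s \<le> t \<and> ereal t < b"
    let ?P = "\<lambda>n (p :: nat \<Rightarrow> real). (\<forall>k\<le>n. p k \<in> {s..t}) \<and> (\<forall>k<n. p k \<le> p (Suc k))"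
    obtain A where A: "\<And>n p. ?P n p \<Longrightarrow> (\<Sum>k<n. norm (u (p (Suc k)) - u (p k))) \<le> A"
      using u st unfolding is_solution_def locally_bounded_variation_def by blast
    obtain B where B: "\<And>n p. ?P n p \<Longrightarrow> (\<Sum>k<n. norm (v (p (Suc k)) - v (p k))) \<le> B"
      using v st unfolding is_solution_def locally_bounded_variation_def by blast
    have "(\<Sum>k<n. norm (?s (p (Suc k)) - ?s (p k))) \<le> norm a * A + B" if p: "?P n p" for n p
    proof -
      have norm_smult: "norm (a *s y) = norm a * norm y" for y :: "complex^2"
        by (simp add: norm_vec_def norm_mult L2_set_right_distrib)
      have "(\<Sum>k<n. norm (?s (p (Suc k)) - ?s (p k)))
          \<le> (\<Sum>k<n. norm a * norm (u (p (Suc k)) - u (p k)) + norm (v (p (Suc k)) - v (p k)))"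
      proof (rule sum_mono)
        fix k
        have "?s (p (Suc k)) - ?s (p k) = a *s (u (p (Suc k)) - u (p k)) + (v (p (Suc k)) - v (p k))"
          by (simp add: vec_eq_iff algebra_simps)
        then show "norm (?s (p (Suc k)) - ?s (p k))
            \<le> norm a * norm (u (p (Suc k)) - u (p k)) + norm (v (p (Suc k)) - v (p k))"
          by (metis norm_smult norm_triangle_ineq)
      qed
      also have "\<dots> = norm a * (\<Sum>k<n. norm (u (p (Suc k)) - u (p k))) + (\<Sum>k<n. norm (v (p (Suc k)) - v (p k)))"
        by (simp add: sum.distrib sum_distrib_left)
      also have "\<dots> \<le> norm a * A + B"
        using A[OF p] B[OF p] by (intro add_mono mult_left_mono) auto
      finally show ?thesis .
    qed
    then show "\<exists>M. \<forall>n p. ?P n p \<longrightarrow> (\<Sum>k<n. norm (?s (p (Suc k)) - ?s (p k))) \<le> M"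
      by blast
  qed
  have lims: "right_limit ?s x = a *s right_limit u x + right_limit v x"
      "left_limit ?s x = a *s left_limit u x + left_limit v x" if x: "x \<in> ivl b" for x
    unfolding right_limit_def[of ?s] left_limit_def[of ?s]
    by (intro tendsto_Lim tendsto_vec2_linear solution_one_sided_limits[OF u x] solution_one_sided_limits[OF v x]; simp)+
  have "balanced b ?s"
    unfolding balanced_def
  proof
    fix x assume x: "x \<in> ivl b"
    have "u x = (1/2) *\<^sub>R (left_limit u x + right_limit u x)" "v x = (1/2) *\<^sub>R (left_limit v x + right_limit v x)"
      using u v x unfolding is_solution_def balanced_def by blast+
    then have "u x $ i = (1/2) *\<^sub>R (left_limit u x + right_limit u x) $ i"
      "v x $ i = (1/2) *\<^sub>R (left_limit v x + right_limit v x) $ i" for i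
      by simp_all
    then show "?s x = (1/2) *\<^sub>R (left_limit ?s x + right_limit ?s x)"
      unfolding lims[OF x] by (simp add: vec_eq_iff algebra_simps add_divide_distrib)
  qed
  note lbv_balanced = lbv this
  have "\<exists>\<nu>. is_derivative_measure b ?s \<nu> \<and>
      (\<forall>E\<in>local_borel b. Jmat *v \<nu> E + measure_times q ?s E = lam *s measure_times w ?s E)"
  proof -
    obtain \<mu> where \<mu>: "is_derivative_measure b u \<mu>"
      "\<And>E. E \<in> local_borel b \<Longrightarrow> Jmat *v \<mu> E + measure_times q u E = lam *s measure_times w u E"
      using u by (auto simp: is_solution_def)
    obtain \<nu> where \<nu>: "is_derivative_measure b v \<nu>"
      "\<And>E. E \<in> local_borel b \<Longrightarrow> Jmat *v \<nu> E + measure_times q v E = lam *s measure_times w v E"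
      using v by (auto simp: is_solution_def)
    have "is_derivative_measure b ?s (\<lambda>E. a *s \<mu> E + \<nu> E)"
      unfolding is_derivative_measure_def
    proof (intro conjI allI impI)
      fix i
      show "local_complex_measure b (\<lambda>E. (a *s \<mu> E + \<nu> E) $ i)"
        using \<mu>(1) \<nu>(1)
        unfolding is_derivative_measure_def local_complex_measure_def complex_measure_on_def
        by (auto intro!: sums_add sums_mult)
    next
      fix s t assume st: "0 < s \<and> s \<le> t \<and> ereal t < b"
      then have s: "s \<in> ivl b" and t: "t \<in> ivl b"
        using le_less_trans[of "ereal s" "ereal t" b] by (auto simp: ivl_def)
      have jumps: "\<mu> {s..t} = right_limit u t - left_limit u s" "\<nu> {s..t} = right_limit v t - left_limit v s"
        using \<mu>(1) \<nu>(1) st unfolding is_derivative_measure_def by blast+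
      show "a *s \<mu> {s..t} + \<nu> {s..t} = right_limit ?s t - left_limit ?s s"
        unfolding lims(1)[OF t] lims(2)[OF s] jumps by (simp add: vec_eq_iff algebra_simps)
    qed
    moreover have "Jmat *v (a *s \<mu> E + \<nu> E) + measure_times q ?s E = lam *s measure_times w ?s E"
      if E: "E \<in> local_borel b" for E
    proof -
      obtain z where z: "z \<in> ivl b" "E \<in> sets borel" "E \<subseteq> {0<..<z}"
        using local_borel_below[OF E] by blast
      obtain M c Q W where c: "z < c" "hermitian_system M b c q w Q W"
        by (rule system_beyond[OF z(1)])
      then interpret hermitian_system M b c q w Q W by simp
      have Ec: "E \<subseteq> {0<..<c}" using z(3) c(1) by auto
      note lin = measure_times_linear[OF solution_tame[OF u] solution_tame[OF v] z(2) Ec, of a]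
      have "Jmat *v (a *s \<mu> E + \<nu> E) + measure_times q ?s E
          = a *s (Jmat *v \<mu> E + measure_times q u E) + (Jmat *v \<nu> E + measure_times q v E)"
        unfolding lin by (simp add: vec_eq_iff forall_2 matrix_vector_mult_def sum_2 algebra_simps)
      also have "\<dots> = lam *s measure_times w ?s E"
        unfolding lin \<mu>(2)[OF E] \<nu>(2)[OF E] by (simp add: vec_eq_iff algebra_simps)
      finally show ?thesis .
    qed
    ultimately show ?thesis
      by (intro exI[of _ "\<lambda>E. a *s \<mu> E + \<nu> E"] conjI ballI)
  qed
  with lbv_balanced show ?thesis
    unfolding is_solution_def by (intro conjI)
qed

lemma zero_solution:
  assumes "is_solution b q w lam u"
  shows "is_solution b q w lam (\<lambda>x. 0)"
proof -
  have "(\<lambda>x. (-1) *s u x + u x) = (\<lambda>x. 0)"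
    by (simp add: fun_eq_iff vec_eq_iff)
  then show ?thesis
    using solution_linear[OF assms assms, of "-1"] by (simp only:)
qed

lemma solution_scale:
  assumes "is_solution b q w lam u"
  shows "is_solution b q w lam (\<lambda>x. a *s u x)"
proof -
  have "(\<lambda>x. a *s u x + 0) = (\<lambda>x. a *s u x)"
    by simp
  then show ?thesis
    using solution_linear[OF assms zero_solution[OF assms], of a] by (simp only:)
qed

lemma lagrange:
  assumes u: "is_solution b q w lam u" "(u \<longlongrightarrow> \<eta>) (at_right 0)"
    and v: "is_solution b q w mu v" "(v \<longlongrightarrow> \<zeta>) (at_right 0)" and z: "z \<in> continuity_points b q w"
  shows "symplectic (v z) (u z) = symplectic \<zeta> \<eta> + (lam - cnj mu) * inner_upto w v u z"
proof -
  have zb: "z \<in> ivl b" "q {z} = 0" "w {z} = 0"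
    using z by (auto simp: continuity_points_def)
  obtain M c Q W where c: "z < c" "hermitian_system M b c q w Q W"
    by (rule system_beyond[OF zb(1)])
  then interpret hermitian_system M b c q w Q W by simp
  have zc: "z \<in> {0<..<c}"
    using zb c by (auto simp: ivl_def)
  note ru = represents_limit[OF u] and rv = represents_limit[OF v]
  have A: "{..<z} \<in> sets borel" "\<And>x y. x \<in> {..<z} \<Longrightarrow> y \<le> x \<Longrightarrow> y \<in> {..<z}"
    by auto
  have "inner_upto w v u z = (\<integral>x. indicator {0<..<z} x *\<^sub>R sesquilinear_form (W x) (v x) (u x) \<partial>M)"
    using c by (intro inner_upto_integral solution_tame_initial[OF u(1) zb(1)] solution_tame_initial[OF v(1) zb(1)]) simp
  also have "\<dots> = (\<integral>x. indicator {..<z} x *\<^sub>R sesquilinear_form (W x) (v x) (u x) \<partial>M)"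
  proof (intro Bochner_Integration.integral_cong refl)
    fix x
    have "x \<le> 0 \<Longrightarrow> sesquilinear_form (W x) (v x) (u x) = 0"
      using W_outside[of x] by (simp add: sesquilinear_form_def)
    then show "indicator {0<..<z} x *\<^sub>R sesquilinear_form (W x) (v x) (u x)
        = indicator {..<z} x *\<^sub>R sesquilinear_form (W x) (v x) (u x)"
      by (cases "0 < x") (auto simp: indicator_def)
  qed
  finally show ?thesis
    using lagrange_identity[OF ru rv A]
    unfolding value_at_continuity_point[OF ru zc zb(2,3)] value_at_continuity_point[OF rv zc zb(2,3)] by simp
qed

lemma norm_upto_nonneg:
  assumes "is_solution b q w lam u" "z \<in> ivl b"
  shows "0 \<le> normsq_upto w u z"
proof -
  obtain M c Q W where c: "z < c" "hermitian_system M b c q w Q W"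
    by (rule system_beyond[OF assms(2)])
  then interpret hermitian_system M b c q w Q W by simp
  show ?thesis
    using c by (intro normsq_upto_nonneg solution_tame_initial[OF assms]) simp
qed

lemma norm_upto_mono:
  assumes "is_solution b q w lam u" "z \<in> ivl b" "y \<le> z"
  shows "normsq_upto w u y \<le> normsq_upto w u z"
proof -
  obtain M c Q W where c: "z < c" "hermitian_system M b c q w Q W"
    by (rule system_beyond[OF assms(2)])
  then interpret hermitian_system M b c q w Q W by simp
  show ?thesis
    using c by (intro normsq_upto_mono solution_tame_initial[OF assms(1,2)] assms(3)) simp
qed

lemma inner_upto_self:
  assumes "is_solution b q w lam u" "z \<in> ivl b"
  shows "inner_upto w u u z = complex_of_real (normsq_upto w u z)"
proof -
  obtain M c Q W where c: "z < c" "hermitian_system M b c q w Q W"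
    by (rule system_beyond[OF assms(2)])
  then interpret hermitian_system M b c q w Q W by simp
  show ?thesis
    using c by (intro inner_upto_real solution_tame_initial[OF assms]) simp
qed

lemma norm_zero_upto:
  assumes "is_solution b q w lam u" "normsq b w u = 0" "z \<in> ivl b"
  shows "normsq_upto w u z = 0"
proof -
  have "ennreal (normsq_upto w u z) \<le> normsq b w u"
    unfolding normsq_def using assms(3) by (rule SUP_upper)
  then show ?thesis
    using norm_upto_nonneg[OF assms(1,3)] assms(2) by (simp add: ennreal_eq_0_iff)
qed

lemma inner_with_null:
  assumes p: "is_solution b q w lam p" "normsq b w p = 0" and v: "is_solution b q w mu v" and z: "z \<in> ivl b"
  shows "inner_upto w v p z = 0" "inner_upto w p v z = 0"
proof -
  obtain M c Q W where c: "z < c" "hermitian_system M b c q w Q W"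
    by (rule system_beyond[OF z])
  then interpret hermitian_system M b c q w Q W by simp
  have "z \<le> c" using c by simp
  note null = inner_upto_null[OF solution_tame_initial[OF p(1) z] this norm_zero_upto[OF p z] solution_tame_initial[OF v z]]
  show "inner_upto w v p z = 0" "inner_upto w p v z = 0"
    using null by auto
qed

lemma norm_add_null:
  assumes p: "is_solution b q w mu p" "normsq b w p = 0" and u: "is_solution b q w lam u" and z: "z \<in> ivl b"
  shows "normsq_upto w (\<lambda>x. a *s u x + p x) z = (norm a)\<^sup>2 * normsq_upto w u z"
proof -
  obtain M c Q W where c: "z < c" "hermitian_system M b c q w Q W"
    by (rule system_beyond[OF z])
  then interpret hermitian_system M b c q w Q W by simp
  have "z \<le> c" using c by simp
  from normsq_upto_add_null[OF solution_tame_initial[OF p(1) z] this norm_zero_upto[OF p z] solution_tame_initial[OF u z]]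
  show ?thesis .
qed

text \<open>
  With \<open>w p = 0\<close> the parameter no longer enters the equation.
\<close>
lemma null_solves_all:
  assumes "is_solution b q w lam p" "normsq b w p = 0"
  shows "is_solution b q w mu p"
proof -
  obtain \<nu> where \<nu>: "is_derivative_measure b p \<nu>"
    "\<And>E. E \<in> local_borel b \<Longrightarrow> Jmat *v \<nu> E + measure_times q p E = lam *s measure_times w p E"
    using assms(1) by (auto simp: is_solution_def)
  have "measure_times w p E = 0" if E: "E \<in> local_borel b" for E
  proof -
    obtain z where z: "z \<in> ivl b" "E \<in> sets borel" "E \<subseteq> {0<..<z}"
      using local_borel_below[OF E] by blast
    obtain M c Q W where c: "z < c" "hermitian_system M b c q w Q W"
      by (rule system_beyond[OF z(1)])
    then interpret hermitian_system M b c q w Q W by simp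
    show ?thesis
      using c norm_zero_upto[OF assms z(1)]
      by (intro measure_times_null[OF solution_tame_initial[OF assms(1) z(1)] _ _ z(2,3)]) auto
  qed
  then have "Jmat *v \<nu> E + measure_times q p E = mu *s measure_times w p E" if "E \<in> local_borel b" for E
    using \<nu>(2)[OF that] that by simp
  then show ?thesis
    using assms(1) \<nu>(1) unfolding is_solution_def by blast
qed

text \<open>A finite measure has at most countably many atoms.\<close>
lemma continuity_point_beyond:
  assumes "ereal z < b"
  shows "\<exists>y\<in>continuity_points b q w. z < y"
proof -
  have "ereal (max z 0) < b"
    using assms b_pos by (auto simp: max_def zero_ereal_def)
  then obtain y where y: "y \<in> ivl b" "max z 0 < y"
    using ivl_beyond by blast
  obtain M c Q W where "y < c" "hermitian_system M b c q w Q W"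
    by (rule system_beyond[OF y(1)])
  with y(2) have c: "max z 0 < c" "hermitian_system M b c q w Q W"
    by auto
  then interpret hermitian_system M b c q w Q W by simp
  have "uncountable ({max z 0<..<c} - {x. measure M {x} \<noteq> 0})"
    using c(1) by (intro uncountable_minus_countable countable_support) (simp add: uncountable_open_interval)
  then have "{max z 0<..<c} - {x. measure M {x} \<noteq> 0} \<noteq> {}"
    using countable_empty by metis
  then obtain y where y: "y \<in> {max z 0<..<c}" "measure M {y} = 0"
    by blast
  then have y': "y \<in> {0<..<c}" by auto
  have "q {y} $ i $ j = 0" "w {y} $ i $ j = 0" for i j
    unfolding atom_q[OF y'] atom_w[OF y'] y(2) by simp_all
  then have "q {y} = 0" "w {y} = 0"
    by (simp_all add: vec_eq_iff)
  moreover have "y \<in> ivl b"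
    using y' by (intro ivl_mono[OF c_in]) auto
  ultimately show ?thesis
    using y by (intro bexI[of _ y]) (auto simp: continuity_points_def)
qed

text \<open>
  Consequently null solutions form an at most one-dimensional space on \<open>(0,b)\<close> when \<open>w\<close> is not \<open>0\<close>.
\<close>
lemma null_pair_zero_weight:
  assumes u: "is_solution b q w lam u" "(u \<longlongrightarrow> \<eta>) (at_right 0)" "normsq b w u = 0"
    and v: "is_solution b q w lam v" "(v \<longlongrightarrow> \<zeta>) (at_right 0)" "normsq b w v = 0"
    and det: "det2 \<eta> \<zeta> \<noteq> 0" and E: "E \<in> local_borel b"
  shows "w E = 0"
proof -
  obtain z where z: "z \<in> ivl b" "E \<in> sets borel" "E \<subseteq> {0<..<z}"
    using local_borel_below[OF E] by blast
  obtain M c Q W where c: "z < c" "hermitian_system M b c q w Q W"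
    by (rule system_beyond[OF z(1)])
  then interpret hermitian_system M b c q w Q W by simp
  have "AE x in M. x \<in> {0<..<z} \<longrightarrow> W x = 0"
    using c null_pair_weight_zero[OF represents_limit[OF u(1,2)] norm_zero_upto[OF u(1,3) z(1)]
      represents_limit[OF v(1,2)] norm_zero_upto[OF v(1,3) z(1)] _ det] by simp
  then have "(\<integral>x. indicator E x *\<^sub>R W x $ i $ j \<partial>M) = 0" for i j
    by (intro integral_eq_zero_AE, eventually_elim) (use z(3) in \<open>auto simp: indicator_def\<close>)
  moreover have "w E $ i $ j = (\<integral>x. indicator E x *\<^sub>R W x $ i $ j \<partial>M)" for i j
    using z c by (intro has_density_measure[OF density_w]) auto
  ultimately show ?thesis
    by (simp add: vec_eq_iff)
qed

end

section \<open>Counting dimensions modulo null solutions\<close>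

lemma has_dim_modulo_zero:
  assumes "has_dim_modulo V N n" "V \<subseteq> N"
  shows "n = 0"
proof (rule ccontr)
  assume "n \<noteq> 0"
  obtain f where f: "\<And>i. i < n \<Longrightarrow> f i \<in> V"
    "\<And>a :: nat \<Rightarrow> complex. (\<lambda>x. \<Sum>i<n. a i *s f i x) \<in> N \<Longrightarrow> \<forall>i<n. a i = 0"
    using assms(1) unfolding has_dim_modulo_def by blast
  have "(\<lambda>x. \<Sum>i<n. (if i = 0 then 1 else 0) *s f i x) = f 0"
    using \<open>n \<noteq> 0\<close> by (simp add: fun_eq_iff vec_eq_iff if_distrib[of "\<lambda>c. c * _"] cong: if_cong)
  moreover have "f 0 \<in> N"
    using f(1)[of 0] \<open>n \<noteq> 0\<close> assms(2) by auto
  ultimately show False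
    using f(2)[of "\<lambda>i. if i = 0 then 1 else 0"] \<open>n \<noteq> 0\<close> by auto
qed

text \<open>
  Two basis elements would be congruent to multiples \<open>a g\<close> and \<open>b g\<close>, and \<open>b\<close> times the first minus
  \<open>a\<close> times the second would be a trivial combination modulo \<open>N\<close>.
\<close>
lemma has_dim_modulo_one:
  assumes dim: "has_dim_modulo V N n"
    and N: "\<And>a u v. u \<in> N \<Longrightarrow> v \<in> N \<Longrightarrow> (\<lambda>x. a *s u x + v x) \<in> N"
    and g: "g \<in> V" "g \<notin> N" and span: "\<And>v. v \<in> V \<Longrightarrow> \<exists>a. (\<lambda>x. v x - a *s g x) \<in> N"
  shows "n = 1"
proof -
  obtain f where f: "\<And>i. i < n \<Longrightarrow> f i \<in> V"
    "\<And>a :: nat \<Rightarrow> complex. (\<lambda>x. \<Sum>i<n. a i *s f i x) \<in> N \<Longrightarrow> \<forall>i<n. a i = 0"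
    "\<And>v. v \<in> V \<Longrightarrow> \<exists>a. (\<lambda>x. v x - (\<Sum>i<n. a i *s f i x)) \<in> N"
    using dim unfolding has_dim_modulo_def by blast
  have "n \<noteq> 0"
  proof
    assume "n = 0"
    then show False
      using f(3)[OF g(1)] g(2) by simp
  qed
  moreover have "\<not> 2 \<le> n"
  proof
    assume n: "2 \<le> n"
    obtain a b where a: "(\<lambda>x. f 0 x - a *s g x) \<in> N" and b: "(\<lambda>x. f 1 x - b *s g x) \<in> N"
      using span f(1)[of 0] f(1)[of 1] n by fastforce
    have sum2: "(\<lambda>x. \<Sum>i<n. (if i = 0 then r else if i = 1 then s else 0) *s f i x) = (\<lambda>x. r *s f 0 x + s *s f 1 x)" for r s :: complex
    proof
      fix x
      have "(\<Sum>i<n. (if i = 0 then r else if i = 1 then s else 0) *s f i x)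
          = (\<Sum>i\<in>{0, 1}. (if i = 0 then r else if i = 1 then s else 0) *s f i x)"
        using n by (intro sum.mono_neutral_right) auto
      then show "(\<Sum>i<n. (if i = 0 then r else if i = 1 then s else 0) *s f i x) = r *s f 0 x + s *s f 1 x"
        by simp
    qed
    have zero: "(\<lambda>x. 0) \<in> N"
      using N[OF a a, of "-1"] by (simp add: vec_eq_iff)
    have "(\<lambda>x. b *s (f 0 x - a *s g x) + ((-a) *s (f 1 x - b *s g x) + 0)) \<in> N"
      by (intro N a b zero)
    also have "(\<lambda>x. b *s (f 0 x - a *s g x) + ((-a) *s (f 1 x - b *s g x) + 0)) = (\<lambda>x. b *s f 0 x + (-a) *s f 1 x)"
      by (simp add: fun_eq_iff vec_eq_iff algebra_simps)
    finally have "\<forall>i<n. (if i = 0 then b else if i = 1 then -a else 0) = 0"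
      unfolding sum2[symmetric] by (rule f(2))
    then have "a = 0"
      using n by (auto dest: spec[of _ 1])
    then have "f 0 \<in> N"
      using a by simp
    moreover have "f 0 = (\<lambda>x. 1 *s f 0 x + 0 *s f 1 x)"
      by (simp add: fun_eq_iff vec_eq_iff)
    ultimately have "(\<lambda>x. 1 *s f 0 x + 0 *s f 1 x) \<in> N"
      by simp
    then have "\<forall>i<n. (if i = 0 then 1 else if i = 1 then 0 else 0) = (0 :: complex)"
      unfolding sum2[symmetric] by (rule f(2))
    then show False
      using n by (auto dest: spec[of _ 0])
  qed
  ultimately show ?thesis by linarith
qed

lemma symplectic_add_right: "symplectic x (a *s y + z) = a * symplectic x y + symplectic x z"
  by (simp add: symplectic_def algebra_simps)

lemma symplectic_add_left: "symplectic (a *s y + z) x = cnj a * symplectic y x + symplectic z x"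
  by (simp add: symplectic_def algebra_simps)

lemma det2_zero_dependent:
  assumes "det2 x y = 0" "x \<noteq> 0"
  shows "\<exists>k. y = k *s x"
proof (cases "x $ 1 = 0")
  case True
  then have "x $ 2 \<noteq> 0"
    using assms(2) by (auto simp: vec_eq_iff forall_2)
  then show ?thesis
    using assms(1) True by (intro exI[of _ "y $ 2 / x $ 2"]) (auto simp: vec_eq_iff forall_2 det2_def)
next
  case False
  then show ?thesis
    using assms(1) by (intro exI[of _ "y $ 1 / x $ 1"]) (auto simp: vec_eq_iff forall_2 det2_def field_simps)
qed

text \<open>
  Completing the square: \<open>symplectic y y * cnj d\<close> is a real quadratic polynomial in \<open>m\<close> with leading
  term \<open>\<bar>d m\<bar>\<^sup>2\<close>, equal to \<open>\<bar>d m - n\<bar>\<^sup>2 - \<bar>A D - B C\<bar>\<^sup>2\<close> where \<open>n / d\<close> is the centre.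
\<close>
lemma weyl_disk_iff:
  fixes M :: "complex^2^2" and m :: complex
  defines "d \<equiv> symplectic (column 2 M) (column 2 M)"
    and "y \<equiv> m *s column 2 M + column 1 M"
  assumes d: "d \<noteq> 0"
  shows "m \<in> weyl_disk M \<longleftrightarrow> Re (symplectic y y * cnj d) \<le> 0"
proof -
  define A C B D where ABCD: "A = M $ 1 $ 1" "C = M $ 1 $ 2" "B = M $ 2 $ 1" "D = M $ 2 $ 2"
  have d_eq: "C * cnj D - cnj C * D = d"
    by (simp add: d_def symplectic_def column_def ABCD mult.commute)
  have "m \<in> weyl_disk M \<longleftrightarrow> cmod (m - (B * cnj C - A * cnj D) / d) \<le> cmod ((A * D - B * C) / d)"
    unfolding weyl_disk_def Let_def ABCD[symmetric] d_eq by simp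
  also have "m - (B * cnj C - A * cnj D) / d = (d * m - (B * cnj C - A * cnj D)) / d"
    using d by (simp add: field_simps)
  also have "cmod ((d * m - (B * cnj C - A * cnj D)) / d) \<le> cmod ((A * D - B * C) / d)
      \<longleftrightarrow> cmod (d * m - (B * cnj C - A * cnj D)) \<le> cmod (A * D - B * C)"
    using d by (simp add: norm_divide divide_le_cancel)
  also have "\<dots> \<longleftrightarrow> (cmod (d * m - (B * cnj C - A * cnj D)))\<^sup>2 - (cmod (A * D - B * C))\<^sup>2 \<le> 0"
    by (simp add: power2_le_iff_abs_le)
  also have "(cmod (d * m - (B * cnj C - A * cnj D)))\<^sup>2 - (cmod (A * D - B * C))\<^sup>2 = Re (symplectic y y * cnj d)"
  proof -
    have "symplectic y y * cnj d = (d * m - (B * cnj C - A * cnj D)) * cnj (d * m - (B * cnj C - A * cnj D))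
        - (A * D - B * C) * cnj (A * D - B * C)"
      unfolding d_eq[symmetric] y_def
      by (simp add: symplectic_def column_def ABCD[symmetric] algebra_simps)
    also have "\<dots> = complex_of_real ((cmod (d * m - (B * cnj C - A * cnj D)))\<^sup>2 - (cmod (A * D - B * C))\<^sup>2)"
      by (simp only: of_real_diff complex_norm_square)
    finally show ?thesis by simp
  qed
  finally show ?thesis .
qed

lemma half_plane_nonempty:
  assumes "is_half_plane H"
  shows "H \<noteq> {}"
proof -
  obtain a :: complex and s where a: "a \<noteq> 0" "H = {z. a \<bullet> z \<ge> s}"
    using assms by (auto simp: is_half_plane_def)
  have "a \<bullet> ((s / (a \<bullet> a)) *\<^sub>R a) = s"
    using a(1) by simp
  then show ?thesis
    unfolding a(2) by (metis empty_iff mem_Collect_eq order_refl)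
qed

context regular_problem
begin

abbreviation "null_space \<equiv> null_solutions b q w"

lemma null_space_iff: "is_solution b q w lam u \<Longrightarrow> u \<in> null_space \<longleftrightarrow> normsq b w u = 0"
  using null_solves_all by (auto simp: null_solutions_def)

lemma null_space_solution: "u \<in> null_space \<Longrightarrow> is_solution b q w lam u"
  and null_space_norm: "u \<in> null_space \<Longrightarrow> normsq b w u = 0"
  using null_solves_all by (auto simp: null_solutions_def)

lemma normsq_add_null:
  assumes "p \<in> null_space" "is_solution b q w lam u"
  shows "normsq b w (\<lambda>x. a *s u x + p x) = ennreal ((norm a)\<^sup>2) * normsq b w u"
proof -
  have ne: "ivl b \<noteq> {}"
    using ivl_beyond[of 0] b_pos by (auto simp: zero_ereal_def)
  have "normsq b w (\<lambda>x. a *s u x + p x) = (SUP c\<in>ivl b. ennreal ((norm a)\<^sup>2) * ennreal (normsq_upto w u c))"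
    unfolding normsq_def
    using norm_add_null[OF null_space_solution[OF assms(1)] null_space_norm[OF assms(1)] assms(2)]
      norm_upto_nonneg[OF assms(2)]
    by (intro SUP_cong refl) (simp add: ennreal_mult)
  also have "\<dots> = ennreal ((norm a)\<^sup>2) * normsq b w u"
    unfolding normsq_def using ne by (simp add: SUP_mult_left_ennreal)
  finally show ?thesis .
qed

lemma null_space_linear:
  assumes "u \<in> null_space" "v \<in> null_space"
  shows "(\<lambda>x. a *s u x + v x) \<in> null_space"
proof -
  have "is_solution b q w 0 (\<lambda>x. a *s u x + v x)"
    by (intro solution_linear null_space_solution assms)
  then show ?thesis
    using normsq_add_null[OF assms(2) null_space_solution[OF assms(1)]] null_space_norm[OF assms(1)]
    by (simp add: null_space_iff)
qed

lemma vanishing_solution_null: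
  assumes u: "is_solution b q w lam u" and zero: "\<And>x. x \<in> ivl b \<Longrightarrow> u x = 0"
  shows "u \<in> null_space"
proof -
  have "normsq_upto w u z = 0" if z: "z \<in> ivl b" for z
  proof -
    obtain M c Q W where c: "z < c" "hermitian_system M b c q w Q W"
      by (rule system_beyond[OF z])
    then interpret hermitian_system M b c q w Q W by simp
    have "(\<lambda>x. indicator {0<..<z} x * Re (quadratic_form (W x) (u x))) = (\<lambda>x. 0)"
    proof
      fix x
      show "indicator {0<..<z} x * Re (quadratic_form (W x) (u x)) = 0"
      proof (cases "x \<in> {0<..<z}")
        case True
        then have "u x = 0"
          using ivl_mono[OF z, of x] zero by auto
        then show ?thesis
          by (simp add: sesquilinear_form_def)
      qed simp
    qed
    then show ?thesis
      using c normsq_upto_integral(2)[OF solution_tame_initial[OF u z]] by simp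
  qed
  then have "normsq b w u \<le> 0"
    unfolding normsq_def by (intro SUP_least) simp
  then have "normsq b w u = 0"
    by simp
  then show ?thesis
    using null_space_iff[OF u] by simp
qed

text \<open>
  Points of continuity suffice to compute the norm, because they accumulate at \<open>b\<close> and the
  norms up to \<open>c\<close> increase with \<open>c\<close>.
\<close>
lemma norm_bound_iff:
  assumes u: "is_solution b q w lam u"
  shows "(\<forall>c\<in>continuity_points b q w. normsq_upto w u c \<le> t) \<longleftrightarrow> 0 \<le> t \<and> normsq b w u \<le> ennreal t"
proof
  assume le: "\<forall>c\<in>continuity_points b q w. normsq_upto w u c \<le> t"
  obtain c where "c \<in> continuity_points b q w"
    using continuity_point_beyond[of 0] b_pos by (auto simp: zero_ereal_def)
  then have "0 \<le> t"
    using le norm_upto_nonneg[OF u, of c] by (auto simp: continuity_points_def)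
  moreover have "normsq b w u \<le> ennreal t"
    unfolding normsq_def
  proof (rule SUP_least, rule ennreal_leI)
    fix c assume "c \<in> ivl b"
    then obtain y where y: "y \<in> continuity_points b q w" "c < y"
      using continuity_point_beyond[of c] by (auto simp: ivl_def)
    then show "normsq_upto w u c \<le> t"
      using le norm_upto_mono[OF u, of y c] by (force simp: continuity_points_def)
  qed
  ultimately show "0 \<le> t \<and> normsq b w u \<le> ennreal t" ..
next
  assume t: "0 \<le> t \<and> normsq b w u \<le> ennreal t"
  show "\<forall>c\<in>continuity_points b q w. normsq_upto w u c \<le> t"
  proof
    fix c assume "c \<in> continuity_points b q w"
    then have "ennreal (normsq_upto w u c) \<le> normsq b w u"
      unfolding normsq_def by (intro SUP_upper) (simp add: continuity_points_def)
    then show "normsq_upto w u c \<le> t"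
      using t by (auto dest: order_trans simp: ennreal_le_iff)
  qed
qed

lemma dimension_from_generator:
  assumes dim: "has_dim_modulo (L2_solutions b q w lam) null_space n"
    and g: "is_solution b q w lam g" "g \<notin> null_space"
    and span: "\<And>v. is_solution b q w lam v \<Longrightarrow> \<exists>a. (\<lambda>x. v x - a *s g x) \<in> null_space"
  shows "normsq b w g < \<infinity> \<Longrightarrow> n = 1" and "normsq b w g = \<infinity> \<Longrightarrow> n = 0"
proof -
  assume "normsq b w g < \<infinity>"
  then show "n = 1"
    using g span by (intro has_dim_modulo_one[OF dim null_space_linear]) (auto simp: L2_solutions_def)
next
  assume inf: "normsq b w g = \<infinity>"
  have "v \<in> null_space" if v: "v \<in> L2_solutions b q w lam" for v
  proof -
    have sol: "is_solution b q w lam v" and fin: "normsq b w v < \<infinity>"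
      using v by (auto simp: L2_solutions_def)
    obtain a where a: "(\<lambda>x. v x - a *s g x) \<in> null_space"
      using span[OF sol] by blast
    have "v = (\<lambda>x. a *s g x + (v x - a *s g x))"
      by simp
    then have "normsq b w v = ennreal ((norm a)\<^sup>2) * normsq b w g"
      using normsq_add_null[OF a g(1), of a] by simp
    then have "a = 0"
      using fin inf by (auto simp: ennreal_mult_top split: if_splits)
    then show ?thesis
      using a by simp
  qed
  then show "n = 0"
    using has_dim_modulo_zero[OF dim] by blast
qed

end

section \<open>The Weyl half-plane\<close>

locale weyl_problem = regular_problem b q w
  for b :: ereal and q w :: "real set \<Rightarrow> complex^2^2" +
  fixes \<alpha> :: real and lam :: complex and U :: "real \<Rightarrow> complex^2^2"
  assumes w_nonzero: "\<exists>E \<in> local_borel b. w E \<noteq> 0"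
    and lam_nonreal: "lam \<notin> \<real>" and lam_regular: "lam \<notin> Lambda_set b q w"
    and fundamental: "is_fundamental_matrix b q w \<alpha> lam U"
    and indefinite: "\<not> definiteness_condition b q w"
begin

definition phi0 :: "complex^2" where "phi0 = vector [of_real (cos \<alpha>), of_real (sin \<alpha>)]"
definition psi0 :: "complex^2" where "psi0 = vector [of_real (- sin \<alpha>), of_real (cos \<alpha>)]"

lemma phi_solution: "is_solution b q w lam (phi U)"
  and psi_solution: "is_solution b q w lam (psi U)"
  using fundamental by (auto simp: is_fundamental_matrix_def phi_def[abs_def] psi_def[abs_def])

lemma phi_tendsto: "(phi U \<longlongrightarrow> phi0) (at_right 0)"
  and psi_tendsto: "(psi U \<longlongrightarrow> psi0) (at_right 0)"
proof -
  let ?L = "vector [vector [of_real (cos \<alpha>), of_real (- sin \<alpha>)],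
                   vector [of_real (sin \<alpha>), of_real (cos \<alpha>)]] :: complex^2^2"
  have "(U \<longlongrightarrow> ?L) (at_right 0)"
    using fundamental by (simp add: is_fundamental_matrix_def)
  then have "((\<lambda>x. column j (U x)) \<longlongrightarrow> column j ?L) (at_right 0)" for j
    unfolding column_def by (intro vec_tendstoI) (simp add: tendsto_vec_nth)
  moreover have "column 1 ?L = phi0" "column 2 ?L = psi0"
    by (simp_all add: column_def phi0_def psi0_def vec_eq_iff forall_2)
  ultimately show "(phi U \<longlongrightarrow> phi0) (at_right 0)" "(psi U \<longlongrightarrow> psi0) (at_right 0)"
    unfolding phi_def[abs_def] psi_def[abs_def] by metis+
qed

lemma cos_sin_of_real: "(of_real (cos \<alpha>) :: complex) * of_real (cos \<alpha>) + of_real (sin \<alpha>) * of_real (sin \<alpha>) = 1"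
  by (metis of_real_1 of_real_add of_real_mult power2_eq_square sin_cos_squared_add2)

lemma initial_values:
  "det2 phi0 psi0 = 1" "symplectic phi0 phi0 = 0" "symplectic psi0 psi0 = 0"
  "symplectic phi0 psi0 = -1" "symplectic psi0 phi0 = 1"
  using cos_sin_of_real
  by (simp_all add: det2_def symplectic_def phi0_def psi0_def algebra_simps)

lemma initial_expansion: "\<eta> = det2 \<eta> psi0 *s phi0 + det2 phi0 \<eta> *s psi0"
proof -
  have "det2 \<eta> psi0 * phi0 $ i + det2 phi0 \<eta> * psi0 $ i = det2 phi0 psi0 * \<eta> $ i" for i
    using exhaust_2[of i] by (auto simp: det2_def algebra_simps)
  then show ?thesis
    by (simp add: vec_eq_iff initial_values)
qed

lemma null_if_zero_limit:
  assumes "is_solution b q w mu u" "mu \<notin> Lambda_set b q w" "(u \<longlongrightarrow> 0) (at_right 0)"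
  shows "u \<in> null_space"
  using solution_unique[OF assms] by (intro vanishing_solution_null[OF assms(1)])

text \<open>
  The remainder \<open>r\<close> has initial value \<open>0\<close>.  It vanishes on \<open>(0,b)\<close>,
  but its values elsewhere are arbitrary, so as a function it is only a null solution.
\<close>
lemma fundamental_expansion:
  assumes v: "is_solution b q w lam v" "(v \<longlongrightarrow> \<eta>) (at_right 0)"
  defines "r \<equiv> \<lambda>x. (-1) *s (det2 \<eta> psi0 *s phi U x + det2 phi0 \<eta> *s psi U x) + v x"
  shows "r \<in> null_space" and "x \<in> ivl b \<Longrightarrow> r x = 0"
proof -
  have r: "is_solution b q w lam r"
    unfolding r_def by (intro solution_linear solution_scale phi_solution psi_solution v)
  have "(r \<longlongrightarrow> (-1) *s (det2 \<eta> psi0 *s phi0 + det2 phi0 \<eta> *s psi0) + \<eta>) (at_right 0)"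
  proof -
    have "((\<lambda>x. det2 \<eta> psi0 *s phi U x + det2 phi0 \<eta> *s psi U x)
        \<longlongrightarrow> det2 \<eta> psi0 *s phi0 + det2 phi0 \<eta> *s psi0) (at_right 0)"
      using tendsto_vec2_linear[OF psi_tendsto tendsto_const[of 0], of "det2 phi0 \<eta>"]
      by (intro tendsto_vec2_linear phi_tendsto) simp
    then show ?thesis
      unfolding r_def by (rule tendsto_vec2_linear[OF _ v(2)])
  qed
  then have lim: "(r \<longlongrightarrow> 0) (at_right 0)"
    unfolding initial_expansion[symmetric] by (simp add: vec_eq_iff)
  show "r \<in> null_space"
    by (rule null_if_zero_limit[OF r lam_regular lim])
  show "x \<in> ivl b \<Longrightarrow> r x = 0"
    by (rule solution_unique[OF r lam_regular lim])
qed

lemma Im_lam: "Im lam \<noteq> 0"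
  using lam_nonreal complex_is_Real_iff by blast

lemma half_plane_at_point:
  assumes "c \<in> continuity_points b q w"
  shows "m \<in> weyl_half_plane lam (U c) \<longleftrightarrow> normsq_upto w (phi U) c \<le> Im m / Im lam"
proof -
  have c: "c \<in> ivl b" using assms by (simp add: continuity_points_def)
  have "symplectic (phi U c) (phi U c) = (lam - cnj lam) * complex_of_real (normsq_upto w (phi U) c)"
    using lagrange[OF phi_solution phi_tendsto phi_solution phi_tendsto assms] inner_upto_self[OF phi_solution c]
    by (simp add: initial_values)
  moreover have "lam - cnj lam = 2 * \<i> * of_real (Im lam)"
    by (simp add: complex_eq_iff)
  ultimately have "U c $ 1 $ 1 * cnj (U c $ 2 $ 1) - cnj (U c $ 1 $ 1) * (U c $ 2 $ 1)
      = 2 * \<i> * of_real (Im lam) * complex_of_real (normsq_upto w (phi U) c)"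
    by (simp add: symplectic_def phi_def column_def mult.commute)
  then show ?thesis
    using Im_lam by (simp add: weyl_half_plane_def Let_def)
qed

text \<open>
  By the Lagrange identity \<open>y\<^sup>* J y\<close> at \<open>c\<close> is \<open>2 \<i> (Im \<lambda> \<parallel>y\<parallel>\<^sub>c\<^sup>2 - Im m)\<close> for \<open>y = \<phi> + m \<psi>\<close>, the
  second term being the initial value, and \<open>\<psi>\<^sup>* J \<psi>\<close> is \<open>2 \<i> Im \<lambda> \<parallel>\<psi>\<parallel>\<^sub>c\<^sup>2\<close>.
\<close>
lemma disk_at_point:
  assumes c: "c \<in> continuity_points b q w" and pos: "normsq_upto w (psi U) c > 0"
  shows "m \<in> weyl_disk (U c) \<longleftrightarrow> normsq_upto w (\<lambda>x. m *s psi U x + phi U x) c \<le> Im m / Im lam"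
proof -
  let ?n = "normsq_upto w (psi U) c" and ?y = "\<lambda>x. m *s psi U x + phi U x"
  let ?k = "normsq_upto w ?y c"
  have ci: "c \<in> ivl b" using c by (simp add: continuity_points_def)
  have y: "is_solution b q w lam ?y"
    by (intro solution_linear psi_solution phi_solution)
  have ylim: "(?y \<longlongrightarrow> m *s psi0 + phi0) (at_right 0)"
    by (intro tendsto_vec2_linear psi_tendsto phi_tendsto)
  have lam2: "lam - cnj lam = 2 * \<i> * of_real (Im lam)"
    by (simp add: complex_eq_iff)
  have d: "symplectic (psi U c) (psi U c) = 2 * \<i> * of_real (Im lam) * complex_of_real ?n"
    using lagrange[OF psi_solution psi_tendsto psi_solution psi_tendsto c] inner_upto_self[OF psi_solution ci]
    by (simp add: initial_values lam2)
  have Y: "symplectic (?y c) (?y c) = cnj m - m + 2 * \<i> * of_real (Im lam) * complex_of_real ?k"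
    using lagrange[OF y ylim y ylim c] inner_upto_self[OF y ci]
    by (simp add: initial_values lam2 symplectic_add_left symplectic_add_right)
  have Im_m: "cnj m - m = - (2 * \<i> * of_real (Im m))"
    by (simp add: complex_eq_iff)
  have "symplectic (?y c) (?y c) * cnj (symplectic (psi U c) (psi U c))
      = complex_of_real (4 * ?n * (Im lam * (Im lam * ?k - Im m)))"
    unfolding d Y Im_m by (simp add: algebra_simps)
  then have Re: "Re (symplectic (?y c) (?y c) * cnj (symplectic (psi U c) (psi U c)))
      = 4 * ?n * (Im lam * (Im lam * ?k - Im m))"
    by simp
  have "symplectic (psi U c) (psi U c) \<noteq> 0"
    unfolding d using Im_lam pos by simp
  then have "m \<in> weyl_disk (U c) \<longleftrightarrow> 4 * ?n * (Im lam * (Im lam * ?k - Im m)) \<le> 0"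
    using weyl_disk_iff[of "U c" m] Re by (simp add: psi_def phi_def)
  also have "\<dots> \<longleftrightarrow> Im lam * (Im lam * ?k - Im m) \<le> 0"
    using pos by (simp add: mult_le_0_iff)
  also have "\<dots> \<longleftrightarrow> ?k \<le> Im m / Im lam"
    using Im_lam by (cases "Im lam > 0") (auto simp: mult_le_0_iff field_simps)
  finally show ?thesis .
qed

text \<open>
  The failure of definiteness provides a null solution that does not vanish on \<open>(0,b)\<close>.
\<close>
lemma null_solution_expansion:
  obtains a d where "(\<lambda>x. a *s phi U x + d *s psi U x) \<in> null_space" "a \<noteq> 0 \<or> d \<noteq> 0"
proof -
  obtain u x where u: "u \<in> null_space" and x: "x \<in> ivl b" "u x \<noteq> 0"
    using indefinite by (auto simp: definiteness_condition_def)
  have sol: "is_solution b q w lam u"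
    by (rule null_space_solution[OF u])
  obtain \<eta> where \<eta>: "(u \<longlongrightarrow> \<eta>) (at_right 0)"
    using solution_limit[OF sol] by blast
  let ?r = "\<lambda>x. (-1) *s (det2 \<eta> psi0 *s phi U x + det2 phi0 \<eta> *s psi U x) + u x"
  have "(\<lambda>x. (-1) *s ?r x + u x) \<in> null_space"
    by (intro null_space_linear fundamental_expansion(1)[OF sol \<eta>] u)
  also have "(\<lambda>x. (-1) *s ?r x + u x) = (\<lambda>x. det2 \<eta> psi0 *s phi U x + det2 phi0 \<eta> *s psi U x)"
    by (simp add: fun_eq_iff vec_eq_iff)
  finally have "(\<lambda>x. det2 \<eta> psi0 *s phi U x + det2 phi0 \<eta> *s psi U x) \<in> null_space" .
  moreover have "det2 \<eta> psi0 \<noteq> 0 \<or> det2 phi0 \<eta> \<noteq> 0"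
    using fundamental_expansion(2)[OF sol \<eta> x(1)] x(2) by auto
  ultimately show ?thesis
    using that by blast
qed

text \<open>
  Modulo the null solution \<open>\<psi>\<close> every solution is a multiple of \<open>\<phi>\<close>; and \<open>\<phi>\<close> is not null as \<open>w\<close>
  is not \<open>0\<close>.
\<close>
lemma phi_spans_if_psi_null:
  assumes psi: "psi U \<in> null_space"
  shows "phi U \<notin> null_space"
    and "is_solution b q w lam v \<Longrightarrow> \<exists>a. (\<lambda>x. v x - a *s phi U x) \<in> null_space"
proof -
  show "phi U \<notin> null_space"
  proof
    assume "phi U \<in> null_space"
    then have "w E = 0" if "E \<in> local_borel b" for E
      using null_pair_zero_weight[OF phi_solution phi_tendsto _ psi_solution psi_tendsto _ _ that]
        null_space_norm psi initial_values(1) by simp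
    then show False
      using w_nonzero by blast
  qed
  assume v: "is_solution b q w lam v"
  obtain \<eta> where \<eta>: "(v \<longlongrightarrow> \<eta>) (at_right 0)"
    using solution_limit[OF v] by blast
  let ?r = "\<lambda>x. (-1) *s (det2 \<eta> psi0 *s phi U x + det2 phi0 \<eta> *s psi U x) + v x"
  have "(\<lambda>x. det2 phi0 \<eta> *s psi U x + ?r x) \<in> null_space"
    by (intro null_space_linear fundamental_expansion(1)[OF v \<eta>] psi)
  also have "(\<lambda>x. det2 phi0 \<eta> *s psi U x + ?r x) = (\<lambda>x. v x - det2 \<eta> psi0 *s phi U x)"
    by (simp add: fun_eq_iff vec_eq_iff)
  finally show "\<exists>a. (\<lambda>x. v x - a *s phi U x) \<in> null_space"
    by blast
qed

text \<open>
  The nontrivial null combination of \<open>\<phi>\<close> and \<open>\<psi>\<close> must involve \<open>\<phi>\<close>, so it can be used to eliminate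
  \<open>\<phi>\<close> from every solution.
\<close>
lemma psi_spans_if_not_null:
  assumes psi: "psi U \<notin> null_space"
  shows "\<exists>m. (\<lambda>x. m *s psi U x + phi U x) \<in> null_space"
    and "is_solution b q w lam v \<Longrightarrow> \<exists>a. (\<lambda>x. v x - a *s psi U x) \<in> null_space"
proof -
  obtain a d where ad: "(\<lambda>x. a *s phi U x + d *s psi U x) \<in> null_space" "a \<noteq> 0 \<or> d \<noteq> 0"
    by (rule null_solution_expansion)
  have zero: "(\<lambda>x. 0) \<in> null_space"
    using null_space_linear[OF ad(1) ad(1), of "-1"] by (simp add: vec_eq_iff)
  have "a \<noteq> 0"
  proof
    assume a: "a = 0"
    have "(\<lambda>x. (1 / d) *s (a *s phi U x + d *s psi U x) + 0) \<in> null_space"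
      by (intro null_space_linear ad zero)
    also have "(\<lambda>x. (1 / d) *s (a *s phi U x + d *s psi U x) + 0) = psi U"
      using a ad(2) by (simp add: fun_eq_iff vec_eq_iff)
    finally show False using psi by blast
  qed
  have "(\<lambda>x. (1 / a) *s (a *s phi U x + d *s psi U x) + 0) \<in> null_space"
    by (intro null_space_linear ad zero)
  also have "(\<lambda>x. (1 / a) *s (a *s phi U x + d *s psi U x) + 0) = (\<lambda>x. (d / a) *s psi U x + phi U x)"
    using \<open>a \<noteq> 0\<close> by (simp add: fun_eq_iff vec_eq_iff field_simps)
  finally have p: "(\<lambda>x. (d / a) *s psi U x + phi U x) \<in> null_space" .
  then show "\<exists>m. (\<lambda>x. m *s psi U x + phi U x) \<in> null_space" by blast
  assume v: "is_solution b q w lam v"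
  obtain \<eta> where \<eta>: "(v \<longlongrightarrow> \<eta>) (at_right 0)"
    using solution_limit[OF v] by blast
  let ?r = "\<lambda>x. (-1) *s (det2 \<eta> psi0 *s phi U x + det2 phi0 \<eta> *s psi U x) + v x"
  have "(\<lambda>x. det2 \<eta> psi0 *s ((d / a) *s psi U x + phi U x) + ?r x) \<in> null_space"
    by (intro null_space_linear fundamental_expansion(1)[OF v \<eta>] p)
  also have "(\<lambda>x. det2 \<eta> psi0 *s ((d / a) *s psi U x + phi U x) + ?r x)
      = (\<lambda>x. v x - (det2 phi0 \<eta> - det2 \<eta> psi0 * (d / a)) *s psi U x)"
    by (simp add: fun_eq_iff vec_eq_iff algebra_simps)
  finally show "\<exists>a. (\<lambda>x. v x - a *s psi U x) \<in> null_space"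
    by blast
qed

lemma limit_half_plane_eq:
  "limit_half_plane b q w lam U = {m. 0 \<le> Im m / Im lam \<and> normsq b w (phi U) \<le> ennreal (Im m / Im lam)}"
  unfolding limit_half_plane_def
  using half_plane_at_point norm_bound_iff[OF phi_solution] by auto

lemma limit_half_plane_finite:
  assumes "normsq b w (phi U) < \<infinity>"
  shows "is_half_plane (limit_half_plane b q w lam U)"
proof -
  let ?N = "enn2real (normsq b w (phi U))"
  have "normsq b w (phi U) = ennreal ?N"
    using assms by (simp add: less_top)
  then have "limit_half_plane b q w lam U = {m. 0 \<le> Im m / Im lam \<and> ennreal ?N \<le> ennreal (Im m / Im lam)}"
    unfolding limit_half_plane_eq by simp
  also have "\<dots> = {m. ?N \<le> Im m / Im lam}"
    using order_trans[OF enn2real_nonneg] by (auto simp: ennreal_le_iff)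
  also have "\<dots> = {m. Complex 0 (1 / Im lam) \<bullet> m \<ge> ?N}"
    by (simp add: inner_complex_def)
  finally show ?thesis
    unfolding is_half_plane_def using Im_lam by (intro exI[of _ "Complex 0 (1 / Im lam)"] exI[of _ ?N]) (simp add: complex_eq_iff)
qed

lemma limit_half_plane_infinite:
  assumes "normsq b w (phi U) = \<infinity>"
  shows "limit_half_plane b q w lam U = {}"
  unfolding limit_half_plane_eq using assms by (auto simp: top_unique)

end

section \<open>The Weyl disks\<close>

context regular_problem
begin

text \<open>
  Since \<open>J\<^sup>* = -J\<close> and the atoms are Hermitian, \<open>B\<^sub>+(x, cnj \<mu>)\<close> is the negative of the adjoint of
  \<open>B\<^sub>-(x, \<mu>)\<close>.
\<close>
lemma Lambda_set_cnj:
  assumes "mu \<notin> Lambda_set b q w"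
  shows "cnj mu \<notin> Lambda_set b q w"
proof
  assume "cnj mu \<in> Lambda_set b q w"
  then obtain x where x: "x \<in> ivl b"
    and det: "det (Bmat 1 q w x (cnj mu)) * det (Bmat (-1) q w x (cnj mu)) = 0"
    by (auto simp: Lambda_set_def)
  have "{x} \<in> local_borel b"
    using x by (auto simp: local_borel_def intro!: exI[of _ "{x}"])
  then have herm: "hermitian (q {x})" "hermitian (w {x})"
    using q_hermitian w_nonneg by (auto simp: hermitian_measure_def nonneg_measure_def nonneg_matrix_def)
  note h = hermitian_cnj[OF herm(1)] hermitian_cnj[OF herm(2)]
  have "det (Bmat 1 q w x (cnj mu)) = cnj (det (Bmat (-1) q w x mu))"
    "det (Bmat (-1) q w x (cnj mu)) = cnj (det (Bmat 1 q w x mu))"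
    by (simp_all add: det_2 Bmat_def Jmat_def h algebra_simps)
  then have "det (Bmat 1 q w x mu) * det (Bmat (-1) q w x mu) = 0"
    using det by (auto simp: mult.commute)
  then show False
    using assms x by (auto simp: Lambda_set_def)
qed

end

context weyl_problem
begin

text \<open>
  A null solution solves the equation for every parameter and is orthogonal to everything, so its
  symplectic products with solutions do not change along the interval.
\<close>
lemma lagrange_null:
  assumes p: "p \<in> null_space" "(p \<longlongrightarrow> \<pi>) (at_right 0)"
    and u: "is_solution b q w mu u" "(u \<longlongrightarrow> \<eta>) (at_right 0)" and c: "c \<in> continuity_points b q w"
  shows "symplectic (p c) (u c) = symplectic \<pi> \<eta>" and "symplectic (u c) (p c) = symplectic \<eta> \<pi>"
proof -
  have ci: "c \<in> ivl b" using c by (simp add: continuity_points_def)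
  have ps: "is_solution b q w mu p" by (rule null_space_solution[OF p(1)])
  note zero = inner_with_null[OF ps null_space_norm[OF p(1)] u(1) ci]
  show "symplectic (p c) (u c) = symplectic \<pi> \<eta>"
    using lagrange[OF u ps p(2) c] zero by simp
  show "symplectic (u c) (p c) = symplectic \<eta> \<pi>"
    using lagrange[OF ps p(2) u c] zero by simp
qed

lemma psi_symplectic:
  assumes c: "c \<in> continuity_points b q w"
  shows "symplectic (psi U c) (psi U c) = 2 * \<i> * of_real (Im lam) * of_real (normsq_upto w (psi U) c)"
proof -
  have ci: "c \<in> ivl b" using c by (simp add: continuity_points_def)
  have "lam - cnj lam = 2 * \<i> * of_real (Im lam)"
    by (simp add: complex_eq_iff)
  then show ?thesis
    using lagrange[OF psi_solution psi_tendsto psi_solution psi_tendsto c] inner_upto_self[OF psi_solution ci]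
    by (simp add: initial_values)
qed

text \<open>
  Of the four symplectic products of \<open>p = \<phi> + m\<^sub>0 \<psi>\<close> and \<open>\<psi>\<close> three are constant; only
  \<open>\<psi>\<^sup>* J \<psi> = 2 \<i> Im \<lambda> \<parallel>\<psi>\<parallel>\<^sub>c\<^sup>2\<close> varies.  The Gram identity gives the Wronskian.
\<close>
lemma wronskian_growth:
  assumes p: "(\<lambda>x. m0 *s psi U x + phi U x) \<in> null_space" and c: "c \<in> continuity_points b q w"
  shows "(cmod (det2 (m0 *s psi U c + phi U c) (psi U c)))\<^sup>2 = 1 + 4 * Im m0 * Im lam * normsq_upto w (psi U) c"
proof -
  let ?p = "\<lambda>x. m0 *s psi U x + phi U x"
  let ?\<pi> = "m0 *s psi0 + phi0"
  have plim: "(?p \<longlongrightarrow> ?\<pi>) (at_right 0)"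
    by (intro tendsto_vec2_linear psi_tendsto phi_tendsto)
  have "symplectic (?p c) (?p c) = cnj m0 - m0"
    using lagrange_null(1)[OF p plim null_space_solution[OF p] plim c]
    by (simp add: symplectic_add_left symplectic_add_right initial_values)
  also have "\<dots> = - (2 * \<i> * of_real (Im m0))"
    by (simp add: complex_eq_iff)
  finally have pp: "symplectic (?p c) (?p c) = - (2 * \<i> * of_real (Im m0))" .
  have pq: "symplectic (?p c) (psi U c) = -1" "symplectic (psi U c) (?p c) = 1"
    using lagrange_null[OF p plim psi_solution psi_tendsto c]
    by (simp_all add: symplectic_add_left symplectic_add_right initial_values)
  have "complex_of_real ((cmod (det2 (?p c) (psi U c)))\<^sup>2) = cnj (det2 (?p c) (psi U c)) * det2 (?p c) (psi U c)"
    unfolding complex_norm_square by (rule mult.commute)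
  also have "\<dots> = complex_of_real (1 + 4 * Im m0 * Im lam * normsq_upto w (psi U) c)"
  proof -
    have calc: "- (2 * \<i> * of_real x) * (2 * \<i> * of_real y * of_real n) - (-1) * 1 = complex_of_real (1 + 4 * x * y * n)"
      for x y n :: real
      by (simp add: complex_eq_iff)
    show ?thesis
      unfolding symplectic_gram pp pq psi_symplectic[OF c] by (rule calc)
  qed
  finally show ?thesis
    unfolding of_real_eq_iff .
qed

text \<open>
  As \<open>\<phi> + m \<psi>\<close> is \<open>(m - m\<^sub>0) \<psi>\<close> plus a null solution, all disks are described by the norm of \<open>\<psi>\<close>.
  The points \<open>c\<close> with \<open>\<parallel>\<psi>\<parallel>\<^sub>c = 0\<close>, which carry no disk, may be included since the remaining conditions
  force \<open>Im m / Im \<lambda> \<ge> 0\<close>.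
\<close>
lemma limit_disk_iff:
  assumes p: "(\<lambda>x. m0 *s psi U x + phi U x) \<in> null_space" and psi: "psi U \<notin> null_space"
  shows "m \<in> limit_disk b q w U \<longleftrightarrow>
    (\<forall>c\<in>continuity_points b q w. (cmod (m - m0))\<^sup>2 * normsq_upto w (psi U) c \<le> Im m / Im lam)"
proof -
  let ?cp = "continuity_points b q w" and ?n = "normsq_upto w (psi U)"
  have shifted: "normsq_upto w (\<lambda>x. m *s psi U x + phi U x) c = (cmod (m - m0))\<^sup>2 * ?n c" if "c \<in> ?cp" for c
  proof -
    have "(\<lambda>x. m *s psi U x + phi U x) = (\<lambda>x. (m - m0) *s psi U x + (m0 *s psi U x + phi U x))"
      by (simp add: fun_eq_iff vec_eq_iff algebra_simps)
    then show ?thesis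
      using norm_add_null[OF null_space_solution[OF p] null_space_norm[OF p] psi_solution, of c "m - m0"] that
      by (simp add: continuity_points_def)
  qed
  have nonneg: "0 \<le> ?n c" if "c \<in> ?cp" for c
    using norm_upto_nonneg[OF psi_solution] that by (simp add: continuity_points_def)
  have "\<exists>c\<in>?cp. 0 < ?n c"
  proof (rule ccontr)
    assume "\<not> (\<exists>c\<in>?cp. 0 < ?n c)"
    then have "normsq b w (psi U) \<le> ennreal 0"
      using norm_bound_iff[OF psi_solution, of 0] by (auto simp: not_less)
    then show False
      using psi null_space_iff[OF psi_solution] by simp
  qed
  then obtain c0 where c0: "c0 \<in> ?cp" "0 < ?n c0" by blast
  have "m \<in> limit_disk b q w U \<longleftrightarrow> (\<forall>c\<in>?cp. 0 < ?n c \<longrightarrow> (cmod (m - m0))\<^sup>2 * ?n c \<le> Im m / Im lam)"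
    unfolding limit_disk_def using disk_at_point shifted by auto
  also have "\<dots> \<longleftrightarrow> (\<forall>c\<in>?cp. (cmod (m - m0))\<^sup>2 * ?n c \<le> Im m / Im lam)"
  proof (intro iffI ballI impI)
    fix c assume le: "\<forall>c\<in>?cp. 0 < ?n c \<longrightarrow> (cmod (m - m0))\<^sup>2 * ?n c \<le> Im m / Im lam" and c: "c \<in> ?cp"
    have "0 \<le> (cmod (m - m0))\<^sup>2 * ?n c0"
      using c0(2) by simp
    also have "\<dots> \<le> Im m / Im lam"
      using le c0 by blast
    finally show "(cmod (m - m0))\<^sup>2 * ?n c \<le> Im m / Im lam"
      using le c nonneg[OF c] by (cases "?n c = 0") auto
  qed blast
  finally show ?thesis .
qed

text \<open>
  The membership of \<open>m\<^sub>0\<close> amounts to \<open>Im m\<^sub>0 / Im \<lambda> \<ge> 0\<close>.  Otherwise \<open>wronskian_growth\<close> would make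
  the square of a modulus negative once \<open>\<parallel>\<psi>\<parallel>\<^sub>c\<close> is large.
\<close>
lemma limit_disk_infinite:
  assumes p: "(\<lambda>x. m0 *s psi U x + phi U x) \<in> null_space" and inf: "normsq b w (psi U) = \<infinity>"
  shows "limit_disk b q w U = {m0}"
proof -
  let ?cp = "continuity_points b q w" and ?n = "normsq_upto w (psi U)"
  have psi: "psi U \<notin> null_space"
    using inf null_space_iff[OF psi_solution] by simp
  have unbounded: "\<exists>c\<in>?cp. t < ?n c" for t
    using norm_bound_iff[OF psi_solution, of t] inf by (auto simp: not_le top_unique)
  have "0 \<le> Im m0 / Im lam"
  proof (rule ccontr)
    assume "\<not> 0 \<le> Im m0 / Im lam"
    then have neg: "Im m0 * Im lam < 0"
      by (auto simp: mult_less_0_iff divide_less_0_iff not_le)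
    obtain c where c: "c \<in> ?cp" "1 / (- (4 * (Im m0 * Im lam))) < ?n c"
      using unbounded by blast
    then have "1 + 4 * Im m0 * Im lam * ?n c < 0"
      using neg by (simp add: field_simps)
    moreover have "0 \<le> 1 + 4 * Im m0 * Im lam * ?n c"
      unfolding wronskian_growth[OF p c(1), symmetric] by simp
    ultimately show False by simp
  qed
  then have "m0 \<in> limit_disk b q w U"
    unfolding limit_disk_iff[OF p psi] by simp
  moreover have "m = m0" if m: "m \<in> limit_disk b q w U" for m
  proof (rule ccontr)
    assume "m \<noteq> m0"
    then have pos: "0 < (cmod (m - m0))\<^sup>2" by simp
    obtain c where c: "c \<in> ?cp" "Im m / Im lam / (cmod (m - m0))\<^sup>2 < ?n c"
      using unbounded by blast
    then have "Im m / Im lam < (cmod (m - m0))\<^sup>2 * ?n c"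
      unfolding pos_divide_less_eq[OF pos] by (simp only: mult.commute)
    then show False
      using m c(1) unfolding limit_disk_iff[OF p psi] by force
  qed
  ultimately show ?thesis by blast
qed

text \<open>
  Completing the square in \<open>\<bar>m - m\<^sub>0\<bar>\<^sup>2 N \<le> Im m / Im \<lambda>\<close> with centre \<open>m\<^sub>0 + \<i> s\<close>.
\<close>
lemma limit_disk_finite:
  assumes p: "(\<lambda>x. m0 *s psi U x + phi U x) \<in> null_space" and psi: "psi U \<notin> null_space"
    and N: "normsq b w (psi U) = ennreal N" "0 < N" and pos: "0 < 1 + 4 * Im m0 * Im lam * N"
  shows "\<exists>z r. 0 < r \<and> limit_disk b q w U = cball z r"
proof -
  define s where "s = 1 / (2 * N * Im lam)"
  define r where "r = sqrt (s\<^sup>2 + Im m0 / (Im lam * N))"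
  have rad: "s\<^sup>2 + Im m0 / (Im lam * N) = (1 + 4 * Im m0 * Im lam * N) / (2 * N * Im lam)\<^sup>2"
    using N(2) Im_lam by (simp add: s_def field_simps power2_eq_square)
  then have radpos: "0 < s\<^sup>2 + Im m0 / (Im lam * N)"
    using pos N(2) Im_lam by simp
  have "m \<in> limit_disk b q w U \<longleftrightarrow> m \<in> cball (m0 + \<i> * of_real s) r" for m
  proof -
    let ?n = "normsq_upto w (psi U)"
    define k where "k = (cmod (m - m0))\<^sup>2"
    have "m \<in> limit_disk b q w U \<longleftrightarrow> (\<forall>c\<in>continuity_points b q w. k * ?n c \<le> Im m / Im lam)"
      unfolding k_def by (rule limit_disk_iff[OF p psi])
    also have "\<dots> \<longleftrightarrow> k * N \<le> Im m / Im lam"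
    proof (cases "k = 0")
      case True
      then show ?thesis
        using continuity_point_beyond[of 0] b_pos by (auto simp: zero_ereal_def)
    next
      case False
      then have k: "0 < k" by (simp add: k_def)
      have "(\<forall>c\<in>continuity_points b q w. k * ?n c \<le> Im m / Im lam)
          \<longleftrightarrow> (\<forall>c\<in>continuity_points b q w. ?n c \<le> Im m / Im lam / k)"
        by (simp only: pos_le_divide_eq[OF k] mult.commute)
      also have "\<dots> \<longleftrightarrow> 0 \<le> Im m / Im lam / k \<and> N \<le> Im m / Im lam / k"
        unfolding norm_bound_iff[OF psi_solution] N(1) by (auto simp: ennreal_le_iff)
      also have "\<dots> \<longleftrightarrow> N \<le> Im m / Im lam / k"
        using N(2) by auto
      also have "\<dots> \<longleftrightarrow> k * N \<le> Im m / Im lam"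
        by (simp only: pos_le_divide_eq[OF k] mult.commute)
      finally show ?thesis .
    qed
    also have "\<dots> \<longleftrightarrow> k - 2 * s * (Im m - Im m0) + s\<^sup>2 \<le> s\<^sup>2 + Im m0 / (Im lam * N)"
    proof -
      have "k * N \<le> Im m / Im lam \<longleftrightarrow> k \<le> Im m / Im lam / N"
        by (simp only: pos_le_divide_eq[OF N(2)])
      moreover have "Im m / Im lam / N = 2 * s * (Im m - Im m0) + Im m0 / (Im lam * N)"
        using N(2) Im_lam by (simp add: s_def field_simps)
      ultimately show ?thesis by linarith
    qed
    also have "k - 2 * s * (Im m - Im m0) + s\<^sup>2 = (dist (m0 + \<i> * of_real s) m)\<^sup>2"
      unfolding k_def dist_norm cmod_power2 by (simp add: power2_eq_square algebra_simps)
    also have "(dist (m0 + \<i> * of_real s) m)\<^sup>2 \<le> s\<^sup>2 + Im m0 / (Im lam * N) \<longleftrightarrow> m \<in> cball (m0 + \<i> * of_real s) r"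
      unfolding r_def mem_cball using radpos by (metis abs_of_nonneg real_sqrt_abs real_sqrt_le_iff zero_le_dist)
    finally show ?thesis .
  qed
  then have "limit_disk b q w U = cball (m0 + \<i> * of_real s) r"
    by blast
  moreover have "0 < r"
    using radpos by (simp add: r_def)
  ultimately show ?thesis
    by blast
qed

text \<open>
  If \<open>Im m\<^sub>0 Im \<lambda> \<ge> 0\<close>, the claim is immediate.  Otherwise the solution \<open>f\<close> at the conjugate
  parameter makes \<open>cnj (det2 p f) * det2 p \<psi>\<close> constant.  The constant
  is not \<open>0\<close>: otherwise \<open>f\<close> and \<open>p\<close> would have proportional initial values and \<open>f\<close> would be null by
  uniqueness.  The first factor is bounded since \<open>f\<close> has finite norm, so the second is bounded below;
  by \<open>wronskian_growth\<close> this bounds the norms of \<open>\<psi>\<close> up to \<open>c\<close> by some \<open>t\<close> with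
  \<open>1 + 4 Im m\<^sub>0 Im \<lambda> t > 0\<close>.
\<close>
lemma wronskian_bounded_below:
  assumes p: "(\<lambda>x. m0 *s psi U x + phi U x) \<in> null_space"
    and N: "normsq b w (psi U) = ennreal N" "0 \<le> N"
    and f: "f \<in> L2_solutions b q w (cnj lam)" "f \<notin> null_space"
  shows "0 < 1 + 4 * Im m0 * Im lam * N"
proof (cases "0 \<le> Im m0 * Im lam")
  case True
  then have "0 \<le> Im m0 * Im lam * N"
    using N(2) by (rule mult_nonneg_nonneg)
  then show ?thesis by simp
next
  case False
  define \<theta> where "\<theta> = - (4 * Im m0 * Im lam)"
  have \<theta>: "0 < \<theta>"
    using False unfolding \<theta>_def mult.assoc by linarith
  let ?p = "\<lambda>x. m0 *s psi U x + phi U x"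
  let ?cp = "continuity_points b q w"
  define \<pi> where "\<pi> = m0 *s psi0 + phi0"
  have plim: "(?p \<longlongrightarrow> \<pi>) (at_right 0)"
    unfolding \<pi>_def by (intro tendsto_vec2_linear psi_tendsto phi_tendsto)
  have fs: "is_solution b q w (cnj lam) f" and ffin: "normsq b w f < \<infinity>"
    using f(1) by (auto simp: L2_solutions_def)
  obtain \<zeta> where \<zeta>: "(f \<longlongrightarrow> \<zeta>) (at_right 0)"
    using solution_limit[OF fs] by blast
  have det_psi: "det2 \<pi> psi0 = 1"
    using initial_values(1) by (simp add: \<pi>_def det2_def algebra_simps)
  have K: "det2 \<pi> \<zeta> \<noteq> 0"
  proof
    assume 0: "det2 \<pi> \<zeta> = 0"
    have "\<pi> \<noteq> 0"
      using det_psi by (auto simp: det2_def)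
    then obtain k where k: "\<zeta> = k *s \<pi>"
      using det2_zero_dependent[OF 0] by blast
    let ?g = "\<lambda>x. (-k) *s ?p x + f x"
    have g: "is_solution b q w (cnj lam) ?g"
      by (rule solution_linear[OF null_space_solution[OF p] fs])
    have "(?g \<longlongrightarrow> (-k) *s \<pi> + \<zeta>) (at_right 0)"
      by (intro tendsto_vec2_linear[OF plim \<zeta>])
    also have "(-k) *s \<pi> + \<zeta> = 0"
      by (simp add: k vec_eq_iff)
    finally have "?g \<in> null_space"
      by (rule null_if_zero_limit[OF g Lambda_set_cnj[OF lam_regular]])
    then have "(\<lambda>x. k *s ?p x + ?g x) \<in> null_space"
      by (rule null_space_linear[OF p])
    also have "(\<lambda>x. k *s ?p x + ?g x) = f"
      by (simp add: fun_eq_iff vec_eq_iff)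
    finally show False using f(2) by blast
  qed
  define F where "F = enn2real (normsq b w f)"
  have F: "normsq b w f = ennreal F" "0 \<le> F"
    using ffin by (auto simp: F_def less_top)
  \<comment> \<open>The summand \<open>1\<close> only makes the bound positive.\<close>
  define C where "C = cmod (symplectic \<pi> \<pi>) * (cmod (symplectic \<zeta> \<zeta>) + cmod (cnj lam - lam) * F)
    + cmod (symplectic \<pi> \<zeta>) * cmod (symplectic \<zeta> \<pi>) + 1"
  have C: "0 < C"
    unfolding C_def using F(2) by (intro add_nonneg_pos add_nonneg_nonneg mult_nonneg_nonneg) auto
  have key: "(cmod (det2 \<pi> \<zeta>))\<^sup>2 \<le> C * (1 - \<theta> * normsq_upto w (psi U) c)" if c: "c \<in> ?cp" for c
  proof -
    have ci: "c \<in> ivl b" using c by (simp add: continuity_points_def)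
    note pf = lagrange_null[OF p plim fs \<zeta> c]
    have pp: "symplectic (?p c) (?p c) = symplectic \<pi> \<pi>"
      by (rule lagrange_null(1)[OF p plim null_space_solution[OF p] plim c])
    have ppsi: "symplectic (?p c) (psi U c) = symplectic \<pi> psi0"
      by (rule lagrange_null(1)[OF p plim psi_solution psi_tendsto c])
    have fpsi: "symplectic (f c) (psi U c) = symplectic \<zeta> psi0"
      using lagrange[OF psi_solution psi_tendsto fs \<zeta> c] by simp
    have ff: "symplectic (f c) (f c) = symplectic \<zeta> \<zeta> + (cnj lam - lam) * of_real (normsq_upto w f c)"
      using lagrange[OF fs \<zeta> fs \<zeta> c] inner_upto_self[OF fs ci] by simp
    have "cnj (det2 (?p c) (f c)) * det2 (?p c) (psi U c) = cnj (det2 \<pi> \<zeta>) * det2 \<pi> psi0"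
      unfolding symplectic_gram pp ppsi fpsi pf ..
    then have "cmod (det2 (?p c) (f c)) * cmod (det2 (?p c) (psi U c)) = cmod (det2 \<pi> \<zeta>)"
      unfolding det_psi by (metis complex_mod_cnj mult.right_neutral norm_mult)
    then have "(cmod (det2 \<pi> \<zeta>))\<^sup>2 = (cmod (det2 (?p c) (f c)))\<^sup>2 * (cmod (det2 (?p c) (psi U c)))\<^sup>2"
      by (metis power_mult_distrib)
    also have "(cmod (det2 (?p c) (psi U c)))\<^sup>2 = 1 - \<theta> * normsq_upto w (psi U) c"
      unfolding wronskian_growth[OF p c] \<theta>_def by simp
    finally have eq: "(cmod (det2 \<pi> \<zeta>))\<^sup>2
        = (cmod (det2 (?p c) (f c)))\<^sup>2 * (1 - \<theta> * normsq_upto w (psi U) c)" .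
    have nonneg: "0 \<le> 1 - \<theta> * normsq_upto w (psi U) c"
      using wronskian_growth[OF p c] zero_le_power2[of "cmod (det2 (?p c) (psi U c))"] by (simp add: \<theta>_def)
    have nf: "0 \<le> normsq_upto w f c" "normsq_upto w f c \<le> F"
      using norm_upto_nonneg[OF fs ci] norm_bound_iff[OF fs, of F] F c by auto
    have "(cmod (det2 (?p c) (f c)))\<^sup>2 = cmod (cnj (det2 (?p c) (f c)) * det2 (?p c) (f c))"
      by (simp add: norm_mult power2_eq_square)
    also have "\<dots> = cmod (symplectic \<pi> \<pi> * (symplectic \<zeta> \<zeta> + (cnj lam - lam) * of_real (normsq_upto w f c))
        - symplectic \<pi> \<zeta> * symplectic \<zeta> \<pi>)"
      unfolding symplectic_gram pp pf ff ..
    also have "\<dots> \<le> cmod (symplectic \<pi> \<pi>) * cmod (symplectic \<zeta> \<zeta> + (cnj lam - lam) * of_real (normsq_upto w f c))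
        + cmod (symplectic \<pi> \<zeta>) * cmod (symplectic \<zeta> \<pi>)"
      by (metis norm_mult norm_triangle_ineq4)
    also have "\<dots> \<le> cmod (symplectic \<pi> \<pi>) * (cmod (symplectic \<zeta> \<zeta>) + cmod (cnj lam - lam) * F)
        + cmod (symplectic \<pi> \<zeta>) * cmod (symplectic \<zeta> \<pi>)"
    proof (intro add_right_mono mult_left_mono)
      have "cmod (symplectic \<zeta> \<zeta> + (cnj lam - lam) * of_real (normsq_upto w f c))
          \<le> cmod (symplectic \<zeta> \<zeta>) + cmod (cnj lam - lam) * normsq_upto w f c"
        using norm_triangle_ineq[of "symplectic \<zeta> \<zeta>" "(cnj lam - lam) * of_real (normsq_upto w f c)"] nf(1)
        by (simp add: norm_mult)
      also have "\<dots> \<le> cmod (symplectic \<zeta> \<zeta>) + cmod (cnj lam - lam) * F"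
        using nf(2) by (intro add_left_mono mult_left_mono) auto
      finally show "cmod (symplectic \<zeta> \<zeta> + (cnj lam - lam) * of_real (normsq_upto w f c))
          \<le> cmod (symplectic \<zeta> \<zeta>) + cmod (cnj lam - lam) * F" .
    qed simp
    also have "\<dots> \<le> C"
      by (simp add: C_def)
    finally show ?thesis
      unfolding eq using nonneg by (intro mult_right_mono)
  qed
  define t where "t = (1 - (cmod (det2 \<pi> \<zeta>))\<^sup>2 / C) / \<theta>"
  have "normsq_upto w (psi U) c \<le> t" if "c \<in> ?cp" for c
  proof -
    have "(cmod (det2 \<pi> \<zeta>))\<^sup>2 / C \<le> 1 - \<theta> * normsq_upto w (psi U) c"
      using key[OF that] C by (simp add: pos_divide_le_eq mult.commute)
    then show ?thesis
      using \<theta> by (simp add: t_def pos_le_divide_eq mult.commute)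
  qed
  then have "0 \<le> t \<and> ennreal N \<le> ennreal t"
    using norm_bound_iff[OF psi_solution, of t] N(1) by simp
  then have "N \<le> t"
    using ennreal_le_iff by blast
  then have "\<theta> * N \<le> 1 - (cmod (det2 \<pi> \<zeta>))\<^sup>2 / C"
    using \<theta> by (simp add: t_def pos_le_divide_eq mult.commute)
  moreover have "0 < (cmod (det2 \<pi> \<zeta>))\<^sup>2 / C"
    using K C by simp
  ultimately show ?thesis
    by (simp add: \<theta>_def)
qed

end

theorem theorem3p3:
  fixes b :: ereal
    and q w :: "real set \<Rightarrow> complex^2^2"
    and \<alpha> :: real
    and lam :: complex
    and U :: "real \<Rightarrow> complex^2^2"
    and np nm :: nat
  assumes "0 < b"
    and "local_matrix_measure b q" and "local_matrix_measure b w"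
    and "hermitian_measure b q"
    and "nonneg_measure b w" and "\<exists>E \<in> local_borel b. w E \<noteq> 0"
    and "regular_at_0 b q" and "regular_at_0 b w"
    and "Lambda_set b q w \<noteq> UNIV"
    and "0 \<le> \<alpha>" and "\<alpha> < pi"
    and "lam \<notin> \<real>" and "lam \<notin> Lambda_set b q w"
    and "is_fundamental_matrix b q w \<alpha> lam U"
    and "\<not> definiteness_condition b q w"
    and "has_deficiency_index b q w {z. Im z > 0} np"
    and "has_deficiency_index b q w {z. Im z < 0} nm"
    and "np = nm"
  shows
    "(normsq b w (psi U) = 0 \<longrightarrow>
        ((is_half_plane (limit_half_plane b q w lam U) \<longleftrightarrow> normsq b w (phi U) < \<infinity>) \<and>
         (is_half_plane (limit_half_plane b q w lam U) \<longrightarrow> np = 1 \<and> nm = 1)) \<and>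
        ((limit_half_plane b q w lam U = {} \<longleftrightarrow> normsq b w (phi U) = \<infinity>) \<and>
         (limit_half_plane b q w lam U = {} \<longrightarrow> np = 0 \<and> nm = 0))) \<and>
     (normsq b w (psi U) > 0 \<longrightarrow>
        ((is_disk_of_positive_radius (limit_disk b q w U) \<longleftrightarrow> normsq b w (psi U) < \<infinity>) \<and>
         (is_disk_of_positive_radius (limit_disk b q w U) \<longrightarrow> np = 1 \<and> nm = 1)) \<and>
        ((\<exists>m. limit_disk b q w U = {m}) \<longleftrightarrow> normsq b w (psi U) = \<infinity>) \<and>
        ((\<exists>m. limit_disk b q w U = {m}) \<longrightarrow> np = 0 \<and> nm = 0))"
proof -
  interpret weyl_problem b q w \<alpha> lam U
    using assms by unfold_locales
  have dim: "has_dim_modulo (L2_solutions b q w mu) null_space np" if "Im mu \<noteq> 0" for mu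
    using assms(16-18) that by (cases "Im mu > 0") (auto simp: has_deficiency_index_def)
  have "Im (cnj lam) \<noteq> 0"
    using Im_lam by simp
  note dim_lam = dim[OF Im_lam] and dim_cnj = dim[OF this]
  show ?thesis
  proof (intro conjI impI)
    assume "normsq b w (psi U) = 0"
    then have psi: "psi U \<in> null_space"
      using null_space_iff[OF psi_solution] by simp
    have index1: "np = 1" if "normsq b w (phi U) < \<infinity>"
      by (rule dimension_from_generator(1)[OF dim_lam phi_solution _ _ that],
          rule phi_spans_if_psi_null(1)[OF psi], rule phi_spans_if_psi_null(2)[OF psi])
    have index0: "np = 0" if "normsq b w (phi U) = \<infinity>"
      by (rule dimension_from_generator(2)[OF dim_lam phi_solution _ _ that],
          rule phi_spans_if_psi_null(1)[OF psi], rule phi_spans_if_psi_null(2)[OF psi])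
    have fin: "is_half_plane (limit_half_plane b q w lam U) \<longleftrightarrow> normsq b w (phi U) < \<infinity>"
      "limit_half_plane b q w lam U = {} \<longleftrightarrow> normsq b w (phi U) = \<infinity>"
      using limit_half_plane_finite limit_half_plane_infinite half_plane_nonempty
      by (metis infinity_ennreal_def less_top)+
    then show "is_half_plane (limit_half_plane b q w lam U) \<longleftrightarrow> normsq b w (phi U) < \<infinity>"
      "limit_half_plane b q w lam U = {} \<longleftrightarrow> normsq b w (phi U) = \<infinity>"
      by auto
    show "np = 1" "nm = 1" if "is_half_plane (limit_half_plane b q w lam U)"
      using that fin(1) index1 assms(18) by auto
    show "np = 0" "nm = 0" if "limit_half_plane b q w lam U = {}"
      using that fin(2) index0 assms(18) by auto
  next
    assume "normsq b w (psi U) > 0"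
    then have psi: "psi U \<notin> null_space"
      using null_space_iff[OF psi_solution] by auto
    obtain m0 where p: "(\<lambda>x. m0 *s psi U x + phi U x) \<in> null_space"
      using psi_spans_if_not_null(1)[OF psi] by blast
    have index1: "np = 1" if "normsq b w (psi U) < \<infinity>"
      by (rule dimension_from_generator(1)[OF dim_lam psi_solution psi _ that],
          rule psi_spans_if_not_null(2)[OF psi])
    have index0: "np = 0" if "normsq b w (psi U) = \<infinity>"
      by (rule dimension_from_generator(2)[OF dim_lam psi_solution psi _ that],
          rule psi_spans_if_not_null(2)[OF psi])
    have finite_case: "\<exists>z r. 0 < r \<and> limit_disk b q w U = cball z r" if fin: "normsq b w (psi U) < \<infinity>"
    proof -
      define N where "N = enn2real (normsq b w (psi U))"
      have N: "normsq b w (psi U) = ennreal N" "0 < N"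
        using fin \<open>normsq b w (psi U) > 0\<close> by (auto simp: N_def less_top enn2real_positive_iff)
      have "\<exists>f. f \<in> L2_solutions b q w (cnj lam) \<and> f \<notin> null_space"
        using has_dim_modulo_zero[OF dim_cnj] index1[OF fin] by auto
      then obtain f where "f \<in> L2_solutions b q w (cnj lam)" "f \<notin> null_space" by blast
      from wronskian_bounded_below[OF p N(1) less_imp_le[OF N(2)] this]
      show ?thesis
        by (rule limit_disk_finite[OF p psi N])
    qed
    have not_both: "cball z r \<noteq> {m}" if "0 < r" for z m :: complex and r :: real
    proof
      assume eq: "cball z r = {m}"
      have "z \<in> cball z r" "z + of_real r \<in> cball z r"
        using that by (simp_all add: dist_norm)
      then have "z = m" "z + of_real r = m"
        unfolding eq by simp_all
      then show False using that by simp
    qed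
    have fin: "is_disk_of_positive_radius (limit_disk b q w U) \<longleftrightarrow> normsq b w (psi U) < \<infinity>"
      "(\<exists>m. limit_disk b q w U = {m}) \<longleftrightarrow> normsq b w (psi U) = \<infinity>"
    proof -
      have "(is_disk_of_positive_radius (limit_disk b q w U) \<longleftrightarrow> normsq b w (psi U) < \<infinity>) \<and>
        ((\<exists>m. limit_disk b q w U = {m}) \<longleftrightarrow> normsq b w (psi U) = \<infinity>)"
      proof (cases "normsq b w (psi U) = \<infinity>")
        case True
        then show ?thesis
          using limit_disk_infinite[OF p True] not_both[symmetric] by (auto simp: is_disk_of_positive_radius_def)
      next
        case False
        then have "normsq b w (psi U) < \<infinity>" by (simp add: less_top)
        with finite_case obtain z r where "0 < r" "limit_disk b q w U = cball z r" by blast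
        then show ?thesis
          using False not_both[of r z] \<open>normsq b w (psi U) < \<infinity>\<close>
          by (auto simp: is_disk_of_positive_radius_def)
      qed
      then show "is_disk_of_positive_radius (limit_disk b q w U) \<longleftrightarrow> normsq b w (psi U) < \<infinity>"
        "(\<exists>m. limit_disk b q w U = {m}) \<longleftrightarrow> normsq b w (psi U) = \<infinity>" by blast+
    qed
    then show "is_disk_of_positive_radius (limit_disk b q w U) \<longleftrightarrow> normsq b w (psi U) < \<infinity>"
      "(\<exists>m. limit_disk b q w U = {m}) \<longleftrightarrow> normsq b w (psi U) = \<infinity>"
      by auto
    show "np = 1" "nm = 1" if "is_disk_of_positive_radius (limit_disk b q w U)"
      using that fin(1) index1 assms(18) by auto
    show "np = 0" "nm = 0" if "\<exists>m. limit_disk b q w U = {m}"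
      using that fin(2) index0 assms(18) by auto
  qed
qed

end
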